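(* Let $T$ be a quasi-lift of an expanding circle map (see context), with invariant measure $\mu$. Then: (a) $T$ is mixing of type (GLM1) for any $\mathcal G\subset L^\infty$ and $\mathcal L=L^1$; i.e. for all $F\in L^\infty(\mathbb R,\mu)$ and all $g\in L^1(\mathbb R,\mu)$ with $\mu(g)=0$, $\lim_{n\to\infty}\mu((F\circ T^n)g)=0$. (b) $T$ is mixing of type (GLM2) w.r.t. $\mathcal G_1$ and $L^1$; i.e. for all $F\in\mathcal G_1$ and $g\in L^1(\mathbb R,\mu)$, $\lim_{n\to\infty}\mu((F\circ T^n)g)=\overline\mu(F)\,\mu(g)$. (c) $T$ is mixing of type (GGM1) and (GGM2) w.r.t. $\mathcal G_2$; i.e. for all $F,G\in\mathcal G_2$: $\overline\mu((F\circ T^n)G)$ exists for all sufficiently large $n$ and $\lim_{n\to\infty}\overline\mu((F\circ T^n)G)=\overline\mu(F)\,\overline\mu(G)$; and $$\lim_{M\to\infty}\ \sup_{V\in\mathscr V,\ \mu(V)\ge M,\ n\ge M}\left|\frac1{\mu(V)}\int_V(F\circ T^n)G\,d\mu-\overline\mu(F)\,\overline\mu(G)\right|=0 .$$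
   Context: Quasi-lift: fix $a>0$ and $I_j:=[aj,a(j+1)]$, $j\in\mathbb Z$. Let $\tau_0:I_0\to J_0$ be bijective, twice differentiable with bounded second derivative, and expanding ($|\tau_0'|\ge\lambda$ for some $\lambda>1$), where $J_0=[ak_{1,0},a(k_{2,0}+1)]$ with integers $k_{1,0}\le0\le k_{2,0}$. Define $T:\mathbb R\to\mathbb R$ by $T(x)=\tau_0(x-aj)+aj$ for $x$ in the interior of $I_j$ (values at points of $a\mathbb Z$ are irrelevant). Thus $T\circ\sigma=\sigma\circ T$ where $\sigma(x):=x+a$. Invariant measure: the circle map $T_a(x):=T(x)\bmod a$ on $[0,a)\cong\mathbb S_a$ (the circle of length $a$) has a finite invariant measure $\mu_a$ equivalent to Lebesgue measure; $\mu$ denotes the $\sigma$-invariant measure on $\mathbb R$ whose restriction to $[0,a)$ is $\mu_a$. It is $T$-invariant and equivalent to Lebesgue measure. Write $\mu(g):=\int_{\mathbb R}g\,d\mu$ for $g\in L^1(\mathbb R,\mu)$. Functions are complex-valued. Infinite-volume average: $\mathscr V:=\{\bigsqcup_{j=k}^{\ell}I_j : k\le\ell\}$. For $F\in L^\infty$, $\overline\mu(F)$ is (if it exists) the number such that $$\lim_{M\to\infty}\sup_{V\in\mathscr V,\ \mu(V)\ge M}\left|\frac1{\mu(V)}\int_VF\,d\mu-\overline\mu(F)\right|=0 .$$ Classes of global observables: with $\mathcal A_kF:=\frac1k\sum_{j=0}^{k-1}F\circ\sigma^j$, $$\mathcal G_1:=\{F\in L^\infty : \exists F_a=F_a\circ\sigma\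 \text{with}\ \lim_{k\to\infty}\|\mathcal A_kF-F_a\|_\infty=0\},$$ $$\mathcal G_2:=\overline{\mathrm{span}_{\mathbb C}\{F\in L^\infty : \exists\beta\in\mathbb R,\ F\circ\sigma=e^{ia\beta}F\}},$$ the closure being in the $L^\infty$-norm. One has $\mathcal G_2\subset\mathcal G_1$, and $\overline\mu(F)$ exists for every $F\in\mathcal G_1$. *)

theory Defs
  imports "HOL-Probability.Essential_Supremum" "HOL-Library.Real_Mod"
begin

definition cell :: "real \<Rightarrow> int \<Rightarrow> real set" where
  "cell a j = {a * of_int j .. a * (of_int j + 1)}"

definition shift :: "real \<Rightarrow> real \<Rightarrow> real" where
  "shift a x = x + a"

text \<open>Derivatives are taken within \<open>cell a 0\<close>, i.e. they are one-sided at its endpoints;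
  continuity of the second derivative \<open>\<tau>''\<close> is not required.\<close>

definition expanding_branch :: "real \<Rightarrow> int \<Rightarrow> int \<Rightarrow> (real \<Rightarrow> real) \<Rightarrow> bool" where
  "expanding_branch a k1 k2 \<tau> \<longleftrightarrow>
     k1 \<le> 0 \<and> 0 \<le> k2 \<and>
     bij_betw \<tau> (cell a 0) {a * of_int k1 .. a * (of_int k2 + 1)} \<and>
     (\<exists>\<tau>' \<tau>'' r C. r > 1 \<and>
        (\<forall>x\<in>cell a 0.
           (\<tau> has_real_derivative \<tau>' x) (at x within cell a 0) \<and>
           (\<tau>' has_real_derivative \<tau>'' x) (at x within cell a 0) \<and>
           \<bar>\<tau>' x\<bar> \<ge> r \<and> \<bar>\<tau>'' x\<bar> \<le> C))"

text \<open>The values of \<open>T\<close> at the points of \<open>a\<int>\<close> are left arbitrary.\<close>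

definition quasi_lift :: "real \<Rightarrow> (real \<Rightarrow> real) \<Rightarrow> (real \<Rightarrow> real) \<Rightarrow> bool" where
  "quasi_lift a \<tau> T \<longleftrightarrow>
     (\<forall>j::int. \<forall>x\<in>interior (cell a j). T x = \<tau> (x - a * of_int j) + a * of_int j)"

definition circle_map :: "real \<Rightarrow> (real \<Rightarrow> real) \<Rightarrow> real \<Rightarrow> real" where
  "circle_map a T x = T x rmod a"

definition invariant_measure :: "'a measure \<Rightarrow> ('a \<Rightarrow> 'a) \<Rightarrow> bool" where
  "invariant_measure M f \<longleftrightarrow> f \<in> measurable M M \<and> distr M M f = M"

definition equivalent_measures :: "'a measure \<Rightarrow> 'a measure \<Rightarrow> bool" where
  "equivalent_measures M N \<longleftrightarrow>
     sets M = sets N \<and> absolutely_continuous M N \<and> absolutely_continuous N M"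

text \<open>A finite measure on the circle \<open>[0, a)\<close>, invariant under the circle map and equivalent to
  Lebesgue measure (on Borel sets). It is unique up to a positive factor, which is left free.\<close>

definition circle_invariant_measure ::
    "real \<Rightarrow> (real \<Rightarrow> real) \<Rightarrow> real measure \<Rightarrow> bool" where
  "circle_invariant_measure a T \<mu>\<^sub>a \<longleftrightarrow>
     finite_measure \<mu>\<^sub>a \<and>
     equivalent_measures \<mu>\<^sub>a (restrict_space lborel {0..<a}) \<and>
     invariant_measure \<mu>\<^sub>a (circle_map a T)"

definition shift_invariant_extension ::
    "real \<Rightarrow> real measure \<Rightarrow> real measure \<Rightarrow> bool" where
  "shift_invariant_extension a \<mu>\<^sub>a \<mu> \<longleftrightarrow>
     sets \<mu> = sets borel \<and> invariant_measure \<mu> (shift a) \<and> restrict_space \<mu> {0..<a} = \<mu>\<^sub>a"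

text \<open>The family of finite unions of consecutive cells. Adjacent cells share an endpoint, so the
  union is disjoint up to a null set.\<close>

definition volumes :: "real \<Rightarrow> real set set" where
  "volumes a = {\<Union>j\<in>{k..l}. cell a j | k l. k \<le> l}"

text \<open>Elements of \<open>L\<^sup>1\<close> and \<open>L\<^sup>\<infinity>\<close> are represented by Borel functions; all identities between them
  are imposed almost everywhere.\<close>

definition L1 :: "real measure \<Rightarrow> (real \<Rightarrow> complex) set" where
  "L1 \<mu> = {g. integrable \<mu> g}"

definition Linf_norm :: "real measure \<Rightarrow> (real \<Rightarrow> complex) \<Rightarrow> ennreal" where
  "Linf_norm \<mu> F = esssup \<mu> (\<lambda>x. ennreal (norm (F x)))"

definition Linf :: "real measure \<Rightarrow> (real \<Rightarrow> complex) set" where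
  "Linf \<mu> = {F \<in> borel_measurable \<mu>. Linf_norm \<mu> F < top}"

definition vol_avg :: "real measure \<Rightarrow> real set \<Rightarrow> (real \<Rightarrow> complex) \<Rightarrow> complex" where
  "vol_avg \<mu> V F = (LINT x:V|\<mu>. F x) / of_real (measure \<mu> V)"

definition has_inf_vol_avg ::
    "real \<Rightarrow> real measure \<Rightarrow> (real \<Rightarrow> complex) \<Rightarrow> complex \<Rightarrow> bool" where
  "has_inf_vol_avg a \<mu> F L \<longleftrightarrow>
     ((\<lambda>M::real. SUP V\<in>{V \<in> volumes a. measure \<mu> V \<ge> M}. ennreal (norm (vol_avg \<mu> V F - L)))
        \<longlongrightarrow> 0) at_top"

definition inf_vol_avg :: "real \<Rightarrow> real measure \<Rightarrow> (real \<Rightarrow> complex) \<Rightarrow> complex" where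
  "inf_vol_avg a \<mu> F = (THE L. has_inf_vol_avg a \<mu> F L)"

definition shift_avg :: "real \<Rightarrow> nat \<Rightarrow> (real \<Rightarrow> complex) \<Rightarrow> real \<Rightarrow> complex" where
  "shift_avg a k F x = (\<Sum>j<k. F ((shift a ^^ j) x)) / of_nat k"

definition G1 :: "real \<Rightarrow> real measure \<Rightarrow> (real \<Rightarrow> complex) set" where
  "G1 a \<mu> = {F \<in> Linf \<mu>. \<exists>F\<^sub>a\<in>Linf \<mu>.
     (AE x in \<mu>. F\<^sub>a (shift a x) = F\<^sub>a x) \<and>
     (\<lambda>k. Linf_norm \<mu> (\<lambda>x. shift_avg a k F x - F\<^sub>a x)) \<longlonglongrightarrow> 0}"

definition quasi_periodic :: "real \<Rightarrow> real measure \<Rightarrow> (real \<Rightarrow> complex) set" where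
  "quasi_periodic a \<mu> = {F \<in> Linf \<mu>. \<exists>\<beta>::real.
     AE x in \<mu>. F (shift a x) = exp (\<i> * of_real (a * \<beta>)) * F x}"

definition complex_span :: "(real \<Rightarrow> complex) set \<Rightarrow> (real \<Rightarrow> complex) set" where
  "complex_span S = {(\<lambda>x. \<Sum>E\<in>t. c E * E x) | t c. finite t \<and> t \<subseteq> S}"

definition Linf_closure ::
    "real measure \<Rightarrow> (real \<Rightarrow> complex) set \<Rightarrow> (real \<Rightarrow> complex) set" where
  "Linf_closure \<mu> S = {F \<in> Linf \<mu>. \<forall>\<epsilon>>0. \<exists>H\<in>S. Linf_norm \<mu> (\<lambda>x. F x - H x) < \<epsilon>}"

definition G2 :: "real \<Rightarrow> real measure \<Rightarrow> (real \<Rightarrow> complex) set" where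
  "G2 a \<mu> = Linf_closure \<mu> (complex_span (quasi_periodic a \<mu>))"

definition GLM1 :: "real measure \<Rightarrow> (real \<Rightarrow> real) \<Rightarrow>
    (real \<Rightarrow> complex) set \<Rightarrow> (real \<Rightarrow> complex) set \<Rightarrow> bool" where
  "GLM1 \<mu> T \<G> \<L> \<longleftrightarrow> (\<forall>F\<in>\<G>. \<forall>g\<in>\<L>. (LINT x|\<mu>. g x) = 0 \<longrightarrow>
     (\<lambda>n. LINT x|\<mu>. F ((T ^^ n) x) * g x) \<longlonglongrightarrow> 0)"

definition GLM2 :: "real \<Rightarrow> real measure \<Rightarrow> (real \<Rightarrow> real) \<Rightarrow>
    (real \<Rightarrow> complex) set \<Rightarrow> (real \<Rightarrow> complex) set \<Rightarrow> bool" where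
  "GLM2 a \<mu> T \<G> \<L> \<longleftrightarrow> (\<forall>F\<in>\<G>. \<forall>g\<in>\<L>.
     (\<lambda>n. LINT x|\<mu>. F ((T ^^ n) x) * g x) \<longlonglongrightarrow> inf_vol_avg a \<mu> F * (LINT x|\<mu>. g x))"

definition GGM1 :: "real \<Rightarrow> real measure \<Rightarrow> (real \<Rightarrow> real) \<Rightarrow> (real \<Rightarrow> complex) set \<Rightarrow> bool" where
  "GGM1 a \<mu> T \<G> \<longleftrightarrow> (\<forall>F\<in>\<G>. \<forall>G\<in>\<G>.
     (\<forall>\<^sub>F n in sequentially. \<exists>L. has_inf_vol_avg a \<mu> (\<lambda>x. F ((T ^^ n) x) * G x) L) \<and>
     (\<lambda>n. inf_vol_avg a \<mu> (\<lambda>x. F ((T ^^ n) x) * G x))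
       \<longlonglongrightarrow> inf_vol_avg a \<mu> F * inf_vol_avg a \<mu> G)"

definition GGM2 :: "real \<Rightarrow> real measure \<Rightarrow> (real \<Rightarrow> real) \<Rightarrow> (real \<Rightarrow> complex) set \<Rightarrow> bool" where
  "GGM2 a \<mu> T \<G> \<longleftrightarrow> (\<forall>F\<in>\<G>. \<forall>G\<in>\<G>.
     ((\<lambda>M::real. SUP (V, n)\<in>{(V, n). V \<in> volumes a \<and> measure \<mu> V \<ge> M \<and> real n \<ge> M}.
         ennreal (norm (vol_avg \<mu> V (\<lambda>x. F ((T ^^ n) x) * G x)
                         - inf_vol_avg a \<mu> F * inf_vol_avg a \<mu> G)))
        \<longlongrightarrow> 0) at_top)"

end

theory Submission
  imports Defs
begin

text \<open>
  Let \<open>P\<close> be the transfer operator of \<open>T\<close> with respect to Lebesgue measure, acting on densities that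
  are log-Lipschitz on each cell. Bounded distortion and the fact that an expanding branch covers
  at least two adjacent cells give \<open>P g = \<theta> A \<Pi> g + (1 - \<theta>) g'\<close>, where \<open>\<Pi>\<close> averages over cells, \<open>A\<close> is
  the mean of two consecutive translations, and \<open>g'\<close> is again such a density. As \<open>A\<close> commutes with \<open>P\<close>
  and \<open>\<Pi>\<close>, iterating applies arbitrarily high powers of \<open>A\<close>, and \<open>A^k (1 - \<sigma>)\<close> tends to zero in norm
  because binomial weights are almost shift invariant. Hence translates of a density become
  indistinguishable, and so do any two densities of equal mass: the parts \<open>A \<Pi> g\<close> are combinations of
  translates of one cell density, while the mass of the remainders decays geometrically. An
  approximation argument turns this into (a), in which \<open>\<mu>\<close> enters only through its density.

  For (b), (a) allows \<open>1_{[0, a)}\<close> to be replaced by averages of its translates, which replaces \<open>F\<close> by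
  \<open>A_k F\<close>, that is, by a periodic observable whose correlations are constant by invariance. Part (c)
  reduces by bilinearity and uniform approximation to quasi-periodic observables.
\<close>

section \<open>The expanding branch and its lift\<close>

text \<open>A general bounded observable comes with no average that its correlations could converge
  to, so statements about Lebesgue densities are comparative: each density is measured against the
  normalised indicator of cell \<open>0\<close>. \<open>\<Pi>\<close> is what makes translations
  appear: a branch distorts the density it carries, but the image still dominates a constant on
  every target cell, and constants on cells are merely translated. Two demands fix the constants.
  Removing a constant from a log-Lipschitz function worsens its constant, so the contraction by
  \<open>1 / r\<close> must leave a surplus, which determines \<open>K\<close>; then \<theta> is the
  lower bound \<open>2 exp (- K a) / B\<close> for the removable part, reduced by
  \<open>exp (- K a) / K\<close> so that the surplus covers the loss of regularity. Since
  translations commute with the dynamics, averaging is moved to the observable, and only sup norms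
  of averaged observables have to be tracked. As \<open>T\<close> is arbitrary on
  \<open>a \<int>\<close>, the argument runs with \<open>lift\<close>, a Borel function that
  commutes exactly with translations, and returns to \<open>T\<close> almost everywhere.\<close>

lemma rmod_pos_conv: "a > 0 \<Longrightarrow> x rmod a = x - a * of_int \<lfloor>x / a\<rfloor>"
  by (simp add: rmod_def)

locale expanding_cell =
  fixes a :: real and k1 k2 :: int and \<tau> \<tau>' \<tau>'' :: "real \<Rightarrow> real" and r C :: real
  assumes a_pos: "a > 0"
    and k1_le: "k1 \<le> 0" and k2_ge: "0 \<le> k2"
    and bij: "bij_betw \<tau> {0..a} {a * of_int k1 .. a * (of_int k2 + 1)}"
    and r_gt1: "r > 1"
    and deriv: "\<And>x. x \<in> {0..a} \<Longrightarrow> (\<tau> has_real_derivative \<tau>' x) (at x within {0..a})"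
    and deriv2: "\<And>x. x \<in> {0..a} \<Longrightarrow> (\<tau>' has_real_derivative \<tau>'' x) (at x within {0..a})"
    and expanding: "\<And>x. x \<in> {0..a} \<Longrightarrow> \<bar>\<tau>' x\<bar> \<ge> r"
    and deriv2_le: "\<And>x. x \<in> {0..a} \<Longrightarrow> \<bar>\<tau>'' x\<bar> \<le> C"
begin

text \<open>On open cells \<open>T\<close> is prescribed and the cells are disjoint; what they omit
  is countable, hence null.\<close>

definition open_cell :: "int \<Rightarrow> real set" where
  "open_cell j = {a * of_int j <..< a * (of_int j + 1)}"

definition J0 :: "real set" where
  "J0 = {a * of_int k1 <..< a * (of_int k2 + 1)}"

text \<open>The inverse branch, extended by clamping its argument to the range of
  \<open>\<tau>\<close>. This makes it continuous on the whole line, so measurability is immediate;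
  values off \<open>J0\<close> are discarded because \<open>weight\<close> vanishes there.\<close>

definition \<psi> :: "real \<Rightarrow> real" where
  "\<psi> z = inv_into {0..a} \<tau> (max (a * of_int k1) (min z (a * (of_int k2 + 1))))"

text \<open>A concrete Borel version of \<open>T\<close> that commutes with translations by
  \<open>a \<int>\<close> at every point, not merely almost everywhere.\<close>

definition lift :: "real \<Rightarrow> real" where
  "lift x = \<tau> (x - a * of_int \<lfloor>x / a\<rfloor>) + a * of_int \<lfloor>x / a\<rfloor>"

text \<open>Jacobian of the inverse branch. The extension by zero allows sums over source cells
  without asking which branches reach a point.\<close>

definition weight :: "real \<Rightarrow> real" where
  "weight z = (if z \<in> J0 then 1 / \<bar>\<tau>' (\<psi> z)\<bar> else 0)"

lemma floor_open_cell: "x \<in> open_cell l \<Longrightarrow> \<lfloor>x / a\<rfloor> = l"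
  using a_pos by (simp add: open_cell_def floor_unique field_simps)

lemma open_cell_disjoint: "x \<in> open_cell l \<Longrightarrow> x \<in> open_cell l' \<Longrightarrow> l = l'"
  using floor_open_cell by blast

lemma lift_open_cell: "x \<in> open_cell l \<Longrightarrow> lift x = \<tau> (x - a * of_int l) + a * of_int l"
  by (simp add: lift_def floor_open_cell)

lemma mem_open_cell_shift: "x \<in> open_cell l \<longleftrightarrow> x - a * of_int l \<in> {0<..<a}"
  by (auto simp: open_cell_def algebra_simps)

lemma pos_mem: "x - a * of_int \<lfloor>x / a\<rfloor> \<in> {0..<a}"
  using rmod_pos_conv[OF a_pos, of x] rmod_less[OF a_pos, of x] rmod_nonneg[of a x] a_pos by auto

lemma range_cell: "\<tau> ` {0..a} = {a * of_int k1 .. a * (of_int k2 + 1)}"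
  using bij by (simp add: bij_betw_def)

lemma inj: "inj_on \<tau> {0..a}"
  using bij by (simp add: bij_betw_def)

lemma cont: "continuous_on {0..a} \<tau>"
  by (rule DERIV_continuous_on[OF deriv])

lemma cont': "continuous_on {0..a} \<tau>'"
  by (rule DERIV_continuous_on[OF deriv2])

lemma J0_le: "a * of_int k1 < a * (of_int k2 + 1)"
  using a_pos k1_le k2_ge by (intro mult_strict_left_mono) linarith+

lemma \<psi>_mem: "\<psi> z \<in> {0..a}"
  unfolding \<psi>_def by (rule inv_into_into) (use range_cell J0_le in auto)

lemma \<tau>_\<psi>: "z \<in> {a * of_int k1 .. a * (of_int k2 + 1)} \<Longrightarrow> \<tau> (\<psi> z) = z"
  unfolding \<psi>_def using f_inv_into_f[of z \<tau> "{0..a}"] range_cell by (auto simp: min_absorb1 max_absorb2)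

lemma \<psi>_\<tau>: "x \<in> {0..a} \<Longrightarrow> \<psi> (\<tau> x) = x"
proof -
  assume x: "x \<in> {0..a}"
  then have "\<tau> x \<in> {a * of_int k1 .. a * (of_int k2 + 1)}" using range_cell by blast
  then have "\<tau> (\<psi> (\<tau> x)) = \<tau> x" by (rule \<tau>_\<psi>)
  then show ?thesis by (rule inj_onD[OF inj _ \<psi>_mem x])
qed

lemma expand:
  assumes "x \<in> {0..a}" "y \<in> {0..a}" shows "\<bar>\<tau> x - \<tau> y\<bar> \<ge> r * \<bar>x - y\<bar>"
proof -
  have *: "\<bar>\<tau> x - \<tau> y\<bar> \<ge> r * \<bar>x - y\<bar>" if "x < y" "x \<in> {0..a}" "y \<in> {0..a}" for x y
  proof -
    have "\<exists>z\<in>{x<..<y}. \<tau> y - \<tau> x = (\<lambda>h. \<tau>' z * h) (y - x)"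
    proof (rule mvt_simple[OF that(1)])
      fix z assume "x \<le> z" "z \<le> y"
      then have "(\<tau> has_real_derivative \<tau>' z) (at z within {x..y})"
        using deriv[of z] that by (auto intro: DERIV_subset)
      then show "(\<tau> has_derivative (\<lambda>h. \<tau>' z * h)) (at z within {x..y})"
        by (simp add: has_field_derivative_def)
    qed
    then obtain z where z: "z \<in> {x<..<y}" "\<tau> y - \<tau> x = \<tau>' z * (y - x)" by auto
    then have "\<bar>\<tau> x - \<tau> y\<bar> = \<bar>\<tau>' z\<bar> * \<bar>x - y\<bar>"
      by (simp only: abs_minus_commute[of "\<tau> x"] abs_minus_commute[of x] abs_mult)
    then show ?thesis using expanding[of z] z that by (simp add: mult_right_mono)
  qed
  consider "x < y" | "x = y" | "y < x" by linarith
  then show ?thesis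
    by cases (use *[of x y] *[of y x] assms in \<open>auto simp: abs_minus_commute\<close>)
qed

lemma deriv_lip:
  assumes "x \<in> {0..a}" "y \<in> {0..a}" shows "\<bar>\<tau>' x - \<tau>' y\<bar> \<le> C * \<bar>x - y\<bar>"
  using field_differentiable_bound[of "{0..a}" \<tau>' \<tau>'' C x y] assms deriv2 deriv2_le by auto

lemma C_nonneg: "C \<ge> 0"
  using deriv2_le[of 0] a_pos by auto

text \<open>The range consists of \<open>k2 - k1 + 1\<close> whole cells, and expansion makes it
  longer than one: its length is at least \<open>r * a > a\<close>.\<close>

lemma two_branches: "k1 + 1 \<le> k2"
proof -
  have "\<tau> 0 \<in> {a * of_int k1 .. a * (of_int k2 + 1)}" "\<tau> a \<in> {a * of_int k1 .. a * (of_int k2 + 1)}"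
    using range_cell a_pos by auto
  then have "\<bar>\<tau> a - \<tau> 0\<bar> \<le> a * (of_int k2 + 1) - a * of_int k1" by auto
  moreover have "r * a \<le> \<bar>\<tau> a - \<tau> 0\<bar>" using expand[of a 0] a_pos by simp
  moreover have "a < r * a" using r_gt1 a_pos by simp
  ultimately have "a * 1 < a * (of_int k2 + 1 - of_int k1)" by (simp add: algebra_simps)
  then have "1 < (of_int k2 + 1 - of_int k1 :: real)" using a_pos by (simp only: mult_less_cancel_left_pos)
  then show ?thesis by linarith
qed

lemma \<psi>_lip: assumes "z \<in> J0" "z' \<in> J0" shows "\<bar>\<psi> z - \<psi> z'\<bar> \<le> \<bar>z - z'\<bar> / r"
  using expand[OF \<psi>_mem \<psi>_mem, of z z'] \<tau>_\<psi>[of z] \<tau>_\<psi>[of z'] assms r_gt1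
  by (auto simp: J0_def field_simps)

text \<open>A continuous injection on an interval is monotone, so interior points miss both extreme
  values of the range, which must then be taken at \<open>0\<close> and \<open>a\<close>.\<close>

lemma endpoints: "\<tau> ` {0<..<a} = J0"
proof -
  have mono: "(\<tau> 0 < \<tau> x \<and> \<tau> x < \<tau> a) \<or> (\<tau> a < \<tau> x \<and> \<tau> x < \<tau> 0)" if "x \<in> {0<..<a}" for x
    using continuous_inj_imp_mono[of 0 x a \<tau>] that cont inj by auto
  have mem: "\<tau> x \<in> {a * of_int k1 .. a * (of_int k2 + 1)}" if "x \<in> {0..a}" for x
    using range_cell that by blast
  have sub: "\<tau> x \<in> J0" if "x \<in> {0<..<a}" for x
    using mono[OF that] mem[of 0] mem[of a] a_pos by (auto simp: J0_def)
  obtain u v where u: "u \<in> {0..a}" "\<tau> u = a * of_int k1" and v: "v \<in> {0..a}" "\<tau> v = a * (of_int k2 + 1)"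
  proof -
    have "a * of_int k1 \<in> \<tau> ` {0..a}" "a * (of_int k2 + 1) \<in> \<tau> ` {0..a}"
      unfolding range_cell using J0_le by auto
    then show ?thesis using that by (auto elim!: imageE dest: sym)
  qed
  have "u \<notin> {0<..<a}" "v \<notin> {0<..<a}" using sub[of u] sub[of v] u v by (auto simp: J0_def)
  then have "u = 0 \<or> u = a" "v = 0 \<or> v = a" using u v by auto
  moreover have "u \<noteq> v" using u v J0_le by auto
  ultimately have uv: "{0, a} = {u, v}" by auto
  have "z \<in> \<tau> ` {0<..<a}" if z: "z \<in> J0" for z
  proof -
    have zz: "\<tau> (\<psi> z) = z" using z by (intro \<tau>_\<psi>) (auto simp: J0_def)
    then have "\<tau> (\<psi> z) \<noteq> \<tau> u" "\<tau> (\<psi> z) \<noteq> \<tau> v" using u(2) v(2) z by (simp_all add: J0_def)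
    then have "\<psi> z \<notin> {u, v}" by blast
    then have "\<psi> z \<in> {0<..<a}" using \<psi>_mem[of z] unfolding uv[symmetric] by simp
    then show ?thesis using zz by (intro image_eqI[of z \<tau> "\<psi> z"]) simp_all
  qed
  then show ?thesis using sub by blast
qed

lemma \<psi>_J0: "z \<in> J0 \<Longrightarrow> \<psi> z \<in> {0<..<a}"
  unfolding endpoints[symmetric] by (auto simp: \<psi>_\<tau>)

lemma \<psi>_cont: "continuous_on UNIV \<psi>"
proof -
  have "continuous_on {a * of_int k1 .. a * (of_int k2 + 1)} (inv_into {0..a} \<tau>)"
    using continuous_on_inv[OF cont, of "inv_into {0..a} \<tau>"] inv_into_f_f[OF inj] range_cell by auto
  then have "continuous_on UNIV (\<lambda>z. inv_into {0..a} \<tau> (max (a * of_int k1) (min z (a * (of_int k2 + 1)))))"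
    by (rule continuous_on_compose2) (use J0_le in \<open>auto intro!: continuous_intros\<close>)
  then show ?thesis unfolding \<psi>_def .
qed

lemma \<psi>_measurable[measurable]: "\<psi> \<in> borel_measurable borel"
  using \<psi>_cont by (rule borel_measurable_continuous_onI)

lemma weight_measurable[measurable]: "weight \<in> borel_measurable borel"
proof -
  have "continuous_on UNIV (\<lambda>z. \<tau>' (\<psi> z))"
    by (rule continuous_on_compose2[OF cont' \<psi>_cont]) (use \<psi>_mem in auto)
  then have [measurable]: "(\<lambda>z. \<tau>' (\<psi> z)) \<in> borel_measurable borel"
    by (rule borel_measurable_continuous_onI)
  have [measurable]: "J0 \<in> sets borel" by (simp add: J0_def)
  show ?thesis unfolding weight_def by measurable
qed

lemma lift_measurable[measurable]: "lift \<in> borel_measurable borel"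
proof -
  \<comment> \<open>Nothing is known about \<open>\<tau>\<close> off the cell, so its argument is
    clamped; on positions in \<open>[0, a)\<close> the clamp does nothing.\<close>
  have "continuous_on UNIV (\<lambda>x. \<tau> (max 0 (min x a)))"
    by (rule continuous_on_compose2[OF cont]) (use a_pos in \<open>auto intro!: continuous_intros\<close>)
  then have [measurable]: "(\<lambda>x. \<tau> (max 0 (min x a))) \<in> borel_measurable borel"
    by (rule borel_measurable_continuous_onI)
  have "lift = (\<lambda>x. \<tau> (max 0 (min (x - a * of_int \<lfloor>x / a\<rfloor>) a)) + a * of_int \<lfloor>x / a\<rfloor>)"
    using pos_mem by (auto simp: lift_def fun_eq_iff max_absorb2 min_absorb1 less_imp_le)
  also have "\<dots> \<in> borel_measurable borel" by measurable
  finally show ?thesis .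
qed

lemma lift_pow_measurable[measurable]: "(lift ^^ n) \<in> borel_measurable borel"
  by (induction n) (auto intro: measurable_comp[OF _ lift_measurable])

lemma lift_shift: "lift (x + a * of_int j) = lift x + a * of_int j"
proof -
  have "(x + a * of_int j) / a = x / a + of_int j" using a_pos by (simp add: field_simps)
  then show ?thesis by (simp add: lift_def algebra_simps)
qed

lemma lift_pow_shift: "(lift ^^ n) (x + a * of_int j) = (lift ^^ n) x + a * of_int j"
  by (induction n) (auto simp: lift_shift)

lemma weight_nonneg: "weight z \<ge> 0" by (simp add: weight_def)

text \<open>An upper bound for \<open>\<bar>\<tau>'\<bar>\<close> on the cell, from the Lipschitz
  bound of \<open>\<tau>'\<close>; a branch therefore multiplies a density by at least
  \<open>1 / B\<close>.\<close>

definition B where "B = \<bar>\<tau>' 0\<bar> + C * a"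

lemma B_pos: "B > 0"
  using expanding[of 0] r_gt1 C_nonneg a_pos by (auto simp: B_def intro!: add_pos_nonneg)

lemma weight_ge: "z \<in> J0 \<Longrightarrow> weight z \<ge> 1 / B"
proof -
  assume z: "z \<in> J0"
  have "\<bar>\<tau>' (\<psi> z) - \<tau>' 0\<bar> \<le> C * \<bar>\<psi> z - 0\<bar>" using deriv_lip[of "\<psi> z" 0] \<psi>_mem a_pos by auto
  also have "\<dots> \<le> C * a" using \<psi>_mem[of z] C_nonneg by (intro mult_left_mono) auto
  finally have "\<bar>\<tau>' (\<psi> z)\<bar> \<le> B" by (auto simp: B_def)
  moreover have "\<bar>\<tau>' (\<psi> z)\<bar> > 0" using expanding[OF \<psi>_mem, of z] r_gt1 by linarith
  ultimately show ?thesis using z B_pos by (simp add: weight_def frac_le)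
qed

text \<open>Bounded distortion of one branch: \<open>C\<close> controls the variation of
  \<open>\<tau>'\<close>, \<open>\<psi>\<close> contracts, and
  \<open>\<bar>\<tau>'\<bar> \<ge> 1\<close> converts the additive error into a relative one,
  absorbed by \<open>1 + t \<le> exp t\<close>.\<close>

lemma weight_log_lip:
  assumes "z \<in> J0" "z' \<in> J0"
  shows "weight z \<le> exp (C * \<bar>z - z'\<bar>) * weight z'"
proof -
  let ?p = "\<bar>\<tau>' (\<psi> z)\<bar>" and ?p' = "\<bar>\<tau>' (\<psi> z')\<bar>"
  have p: "?p \<ge> r" "?p' \<ge> r" using expanding \<psi>_mem by auto
  have "?p' \<le> ?p + C * \<bar>\<psi> z' - \<psi> z\<bar>" using deriv_lip[OF \<psi>_mem \<psi>_mem, of z' z] by linarith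
  also have "C * \<bar>\<psi> z' - \<psi> z\<bar> \<le> C * (\<bar>z - z'\<bar> / r)"
    using \<psi>_lip[OF assms] C_nonneg by (intro mult_left_mono) (auto simp: abs_minus_commute)
  also have "\<dots> \<le> C * \<bar>z - z'\<bar>"
    using r_gt1 C_nonneg by (intro mult_left_mono) (auto simp: divide_le_eq mult_le_cancel_left1)
  also have "\<dots> \<le> ?p * (C * \<bar>z - z'\<bar>)"
    using mult_right_mono[of 1 ?p "C * \<bar>z - z'\<bar>"] p r_gt1 C_nonneg by auto
  finally have "?p' \<le> ?p * (1 + C * \<bar>z - z'\<bar>)" by (simp add: algebra_simps)
  also have "\<dots> \<le> ?p * exp (C * \<bar>z - z'\<bar>)"
    by (intro mult_left_mono exp_ge_add_one_self) auto
  finally show ?thesis using p r_gt1 assms by (simp add: weight_def field_simps)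
qed

end

section \<open>The transfer operator\<close>

lemma integrable_bdd_mult:
  fixes F :: "'a \<Rightarrow> 'b::{real_normed_algebra,banach,second_countable_topology}"
  assumes [measurable]: "F \<in> borel_measurable M" and "\<And>x. norm (F x) \<le> b" and g: "integrable M g"
  shows "integrable M (\<lambda>x. F x * g x)"
proof (rule Bochner_Integration.integrable_bound)
  show "integrable M (\<lambda>x. b * norm (g x))" using g by auto
  show "(\<lambda>x. F x * g x) \<in> borel_measurable M" using g by measurable
  have "norm (F x * g x) \<le> norm (b * norm (g x))" for x
    using norm_mult_ineq[of "F x" "g x"] mult_right_mono[OF assms(2), of "norm (g x)" x]
      abs_ge_self[of "b * norm (g x)"] by simp
  then show "AE x in M. norm (F x * g x) \<le> norm (b * norm (g x))" by simp
qed

lemma lborel_integral_translate: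
  fixes f :: "real \<Rightarrow> 'a::{banach,second_countable_topology}"
  shows "(\<integral>x. f (x + t) \<partial>lborel) = (\<integral>x. f x \<partial>lborel)"
  using lborel_integral_real_affine[of 1 f t] by (simp add: add.commute)

lemma lborel_integrable_translate:
  fixes f :: "real \<Rightarrow> 'a::{banach,second_countable_topology}"
  shows "integrable lborel f \<Longrightarrow> integrable lborel (\<lambda>x. f (x + t))"
  using lborel_integrable_real_affine[of f 1 t] by (simp add: add.commute)

text \<open>The bound holds everywhere, not almost everywhere, so that it survives composition with
  \<open>lift\<close> without an argument about null sets.\<close>

definition bdd_borel :: "(real \<Rightarrow> real) \<Rightarrow> real \<Rightarrow> bool" where
  "bdd_borel F b \<longleftrightarrow> F \<in> borel_measurable borel \<and> (\<forall>x. \<bar>F x\<bar> \<le> b)"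

lemma bdd_borelD:
  assumes "bdd_borel F b" shows "F \<in> borel_measurable borel" "\<bar>F x\<bar> \<le> b"
  using assms by (auto simp: bdd_borel_def)

lemma bdd_borel_integrable:
  assumes "bdd_borel F b" "integrable lborel g" shows "integrable lborel (\<lambda>x. F x * g x)"
  using integrable_bdd_mult[of F lborel b g] assms by (auto simp: bdd_borel_def)

context expanding_cell
begin

lemma open_cell_measurable[measurable, simp]: "open_cell l \<in> sets borel"
  by (simp add: open_cell_def)

lemma J0_measurable[measurable, simp]: "J0 \<in> sets borel"
  by (simp add: J0_def)

lemma emeasure_open_cell: "emeasure lborel (open_cell l) = ennreal a"
  using a_pos by (simp add: open_cell_def algebra_simps)

lemma measure_open_cell: "measure lborel (open_cell l) = a"
  using emeasure_open_cell a_pos by (simp add: measure_def)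

lemma integrable_indicator_open_cell: "integrable lborel (indicator (open_cell l) :: real \<Rightarrow> real)"
  by (simp add: emeasure_open_cell)

lemma bdd_borel_lift: "bdd_borel F b \<Longrightarrow> bdd_borel (\<lambda>x. F ((lift ^^ n) x)) b"
  unfolding bdd_borel_def using measurable_compose[OF lift_pow_measurable] by auto

lemma AE_open_cell: "AE x in lborel. x \<in> open_cell \<lfloor>x / a\<rfloor>"
proof -
  have "countable (range (\<lambda>j::int. a * of_int j))" by simp
  then have "range (\<lambda>j::int. a * of_int j) \<in> null_sets lborel"
    by (rule countable_imp_null_set_lborel)
  then show ?thesis
  proof (rule AE_I')
    show "{x \<in> space lborel. x \<notin> open_cell \<lfloor>x / a\<rfloor>} \<subseteq> range (\<lambda>j::int. a * of_int j)"
    proof clarify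
      fix x assume "x \<notin> open_cell \<lfloor>x / a\<rfloor>"
      then have "x = a * of_int \<lfloor>x / a\<rfloor>" using pos_mem[of x] by (auto simp: mem_open_cell_shift)
      then show "x \<in> range (\<lambda>j::int. a * of_int j)" by blast
    qed
  qed
qed

text \<open>Substitution along the single branch that leaves cell \<open>l\<close>. Summed over
  \<open>l\<close> it yields the duality between the transfer operator and composition with
  \<open>lift\<close>.\<close>

lemma branch_change:
  fixes g F :: "real \<Rightarrow> real" and l :: int
  assumes F: "bdd_borel F b" and g: "integrable lborel g"
  defines "f \<equiv> \<lambda>z. F z * (weight (z - a * of_int l) * g (\<psi> (z - a * of_int l) + a * of_int l))"
  shows "integrable lborel f"
    and "(\<integral>z. f z \<partial>lborel) = (\<integral>x. indicator (open_cell l) x * (F (lift x) * g x) \<partial>lborel)"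
proof -
  let ?t = "a * of_int l"
  define G where "G x = \<tau> (x - ?t) + ?t" for x
  have [measurable]: "F \<in> borel_measurable borel" "g \<in> borel_measurable borel"
    using F g by (auto simp: bdd_borel_def)
  have [measurable]: "f \<in> borel_measurable borel" unfolding f_def by measurable
  have der: "(G has_field_derivative \<tau>' (x - ?t)) (at x within open_cell l)" if "x \<in> open_cell l" for x
  proof -
    have "x - ?t \<in> {0..a}" using that by (auto simp: mem_open_cell_shift)
    then have "(\<tau> has_field_derivative \<tau>' (x - ?t)) (at (x - ?t) within {0..a})" by (rule deriv)
    then have "(\<tau> has_field_derivative \<tau>' (x - ?t)) (at (x - ?t) within (\<lambda>x. x - ?t) ` open_cell l)"
      by (rule DERIV_subset) (auto simp: mem_open_cell_shift)
    moreover have "((\<lambda>x. x - ?t) has_field_derivative 1) (at x within open_cell l)"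
      by (auto intro!: derivative_eq_intros)
    ultimately have "((\<lambda>x. \<tau> (x - ?t)) has_field_derivative \<tau>' (x - ?t) * 1) (at x within open_cell l)"
      by (rule DERIV_image_chain[unfolded o_def])
    from DERIV_add[OF this DERIV_const[of ?t]] show ?thesis unfolding G_def by simp
  qed
  have injG: "inj_on G (open_cell l)"
  proof (rule inj_onI)
    fix x y assume x: "x \<in> open_cell l" and y: "y \<in> open_cell l" and G: "G x = G y"
    have "x - ?t \<in> {0..a}" using x unfolding mem_open_cell_shift by auto
    moreover have "y - ?t \<in> {0..a}" using y unfolding mem_open_cell_shift by auto
    moreover have "\<tau> (x - ?t) = \<tau> (y - ?t)" using G unfolding G_def by (rule add_right_imp_eq)
    ultimately have "x - ?t = y - ?t" by - (rule inj_onD[OF inj])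
    then show "x = y" by simp
  qed
  have img: "G ` open_cell l = {z. z - ?t \<in> J0}"
  proof -
    have tr: "{z. z - ?t \<in> S} = (\<lambda>y. y + ?t) ` S" for S
      by (force simp: image_iff)
    have "open_cell l = {z. z - ?t \<in> {0<..<a}}"
      using mem_open_cell_shift by blast
    then have "open_cell l = (\<lambda>y. y + ?t) ` {0<..<a}" unfolding tr .
    then show ?thesis unfolding tr by (simp add: image_image G_def endpoints[symmetric])
  qed
  have eq: "\<bar>\<tau>' (x - ?t)\<bar> * f (G x) = F (lift x) * g x" if "x \<in> open_cell l" for x
  proof -
    have x: "x - ?t \<in> {0<..<a}" using that by (simp add: mem_open_cell_shift)
    then have "\<tau> (x - ?t) \<in> J0" using endpoints by blast
    moreover have "\<psi> (\<tau> (x - ?t)) = x - ?t" using x by (intro \<psi>_\<tau>) auto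
    moreover have "\<tau>' (x - ?t) \<noteq> 0" using expanding[of "x - ?t"] x r_gt1 by auto
    ultimately show ?thesis using that by (simp add: f_def G_def lift_open_cell weight_def)
  qed
  have int1: "integrable lborel (\<lambda>x. indicator (open_cell l) x * (F (lift x) * g x))"
    using bdd_borel_integrable[OF bdd_borel_lift[OF F, of 1] g]
    by (intro integrable_bdd_mult[where F="indicator (open_cell l)" and b=1]) (auto simp: indicator_def)
  \<comment> \<open>The change of variables theorem lives on \<open>lebesgue\<close>, so
    integrability and integrals are carried to the completion and back.\<close>
  have "set_integrable lebesgue (open_cell l) (\<lambda>x. F (lift x) * g x)"
    using int1 unfolding set_integrable_def by (simp add: integrable_completion)
  moreover have "set_integrable lebesgue (open_cell l) (\<lambda>x. F (lift x) * g x)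
      \<longleftrightarrow> set_integrable lebesgue (open_cell l) (\<lambda>x. \<bar>\<tau>' (x - ?t)\<bar> * f (G x))"
    by (intro set_integrable_cong) (simp_all add: eq)
  ultimately have si: "(\<lambda>x. \<bar>\<tau>' (x - ?t)\<bar> * f (G x)) absolutely_integrable_on open_cell l" by simp
  have "f absolutely_integrable_on (G ` open_cell l) \<and>
      integral (G ` open_cell l) f = integral (open_cell l) (\<lambda>x. \<bar>\<tau>' (x - ?t)\<bar> * f (G x))"
    by (rule has_absolute_integral_change_of_variables_1'[OF _ der injG, THEN iffD1]) (use si in auto)
  then have *: "f absolutely_integrable_on (G ` open_cell l)"
    "integral (G ` open_cell l) f = integral (open_cell l) (\<lambda>x. \<bar>\<tau>' (x - ?t)\<bar> * f (G x))" by blast+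
  \<comment> \<open>\<open>weight\<close> already vanishes off the image of the branch, so
    restricting to the image costs nothing.\<close>
  have f_ind: "indicator (G ` open_cell l) z *\<^sub>R f z = f z" for z
    by (auto simp: img f_def weight_def indicator_def)
  have il: "integrable lebesgue f" using *(1) unfolding set_integrable_def f_ind .
  then show "integrable lborel f" by (simp add: integrable_completion)
  have "(\<integral>z. f z \<partial>lborel) = (\<integral>z. f z \<partial>lebesgue)" by (simp add: integral_completion)
  also have "\<dots> = (LINT z:G ` open_cell l|lebesgue. f z)"
    unfolding set_lebesgue_integral_def f_ind ..
  also have "\<dots> = integral (G ` open_cell l) f" by (rule set_lebesgue_integral_eq_integral(2)[OF *(1)])
  also have "\<dots> = integral (open_cell l) (\<lambda>x. \<bar>\<tau>' (x - ?t)\<bar> * f (G x))" by (rule *(2))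
  also have "\<dots> = (LINT x:open_cell l|lebesgue. \<bar>\<tau>' (x - ?t)\<bar> * f (G x))"
    by (rule set_lebesgue_integral_eq_integral(2)[OF si, symmetric])
  also have "\<dots> = (LINT x:open_cell l|lebesgue. F (lift x) * g x)"
    by (intro set_lebesgue_integral_cong) (auto simp: eq)
  also have "\<dots> = (\<integral>x. indicator (open_cell l) x * (F (lift x) * g x) \<partial>lborel)"
    unfolding set_lebesgue_integral_def by (simp add: integral_completion)
  finally show "(\<integral>z. f z \<partial>lborel) = (\<integral>x. indicator (open_cell l) x * (F (lift x) * g x) \<partial>lborel)" .
qed

text \<open>Only source cells with index between \<open>-s\<close> and \<open>s\<close> are summed.
  For densities with \<open>supp_cells s\<close> this is the full transfer operator, and no infinite
  series of integrals arises.\<close>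

definition transfer :: "nat \<Rightarrow> (real \<Rightarrow> real) \<Rightarrow> real \<Rightarrow> real" where
  "transfer s g x = (\<Sum>l\<in>{-int s..int s}. weight (x - a * of_int l) * g (\<psi> (x - a * of_int l) + a * of_int l))"

text \<open>Requiring open cells also forces \<open>g\<close> to vanish on \<open>a \<int>\<close>,
  which makes the decomposition of \<open>g\<close> into its cells an identity at every
  point.\<close>

definition supp_cells :: "nat \<Rightarrow> (real \<Rightarrow> real) \<Rightarrow> bool" where
  "supp_cells s g \<longleftrightarrow> (\<forall>x. g x \<noteq> 0 \<longrightarrow> (\<exists>l\<in>{-int s..int s}. x \<in> open_cell l))"

text \<open>Multiplicative form of a Lipschitz bound for \<open>ln g\<close>: it is stable under
  sums and positive multiples, lets \<open>g\<close> vanish on whole cells, and says nothing across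
  cell boundaries.\<close>

definition log_lip :: "real \<Rightarrow> (real \<Rightarrow> real) \<Rightarrow> bool" where
  "log_lip K g \<longleftrightarrow> (\<forall>j. \<forall>x\<in>open_cell j. \<forall>y\<in>open_cell j. g x \<le> exp (K * \<bar>x - y\<bar>) * g y)"

lemma indicator_open_cell:
  assumes "x \<in> open_cell j" shows "indicator (open_cell l) x = (if l = j then 1 else 0 :: real)"
proof (cases "l = j")
  case False
  then have "x \<notin> open_cell l" using open_cell_disjoint assms by blast
  then show ?thesis using False by simp
qed (use assms in simp)

lemma sum_open_cell:
  fixes c :: "int \<Rightarrow> real"
  shows "x \<in> open_cell j \<Longrightarrow> (\<Sum>l\<in>{-int s..int s}. c l * indicator (open_cell l) x) = (if j \<in> {-int s..int s} then c j else 0)"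
proof -
  assume x: "x \<in> open_cell j"
  have "(\<Sum>l\<in>{-int s..int s}. c l * indicator (open_cell l) x) = (\<Sum>l\<in>{-int s..int s}. if l = j then c l else 0)"
    by (intro sum.cong refl) (simp add: indicator_open_cell[OF x])
  then show ?thesis by simp
qed

lemma supp_cells_sum:
  assumes "supp_cells s g" shows "(\<Sum>l\<in>{-int s..int s}. indicator (open_cell l) x * g x) = g x"
proof (cases "g x = 0")
  case False
  then obtain j where "j \<in> {-int s..int s}" "x \<in> open_cell j" using assms by (auto simp: supp_cells_def)
  then show ?thesis using sum_open_cell[of x j "\<lambda>_. g x" s] by (simp add: mult.commute)
qed simp

lemma transfer_dual:
  fixes g F :: "real \<Rightarrow> real"
  assumes F: "bdd_borel F b" and g: "integrable lborel g" and s: "supp_cells s g"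
  shows "integrable lborel (\<lambda>x. F x * transfer s g x)"
    and "(\<integral>x. F x * transfer s g x \<partial>lborel) = (\<integral>x. F (lift x) * g x \<partial>lborel)"
proof -
  note bc = branch_change[OF F g]
  show "integrable lborel (\<lambda>x. F x * transfer s g x)"
    unfolding transfer_def sum_distrib_left by (intro Bochner_Integration.integrable_sum bc)
  have int1: "integrable lborel (\<lambda>x. indicator (open_cell l) x * (F (lift x) * g x))" for l
    using bdd_borel_integrable[OF bdd_borel_lift[OF F, of 1] g]
    by (intro integrable_bdd_mult[where F="indicator (open_cell l)" and b=1]) (auto simp: indicator_def)
  have "(\<integral>x. F x * transfer s g x \<partial>lborel) =
      (\<Sum>l\<in>{-int s..int s}. \<integral>x. indicator (open_cell l) x * (F (lift x) * g x) \<partial>lborel)"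
    unfolding transfer_def sum_distrib_left
    by (subst Bochner_Integration.integral_sum) (simp_all add: bc)
  also have "\<dots> = (\<integral>x. (\<Sum>l\<in>{-int s..int s}. indicator (open_cell l) x * (F (lift x) * g x)) \<partial>lborel)"
    using int1 by (subst Bochner_Integration.integral_sum) simp_all
  also have "(\<lambda>x. \<Sum>l\<in>{-int s..int s}. indicator (open_cell l) x * (F (lift x) * g x)) = (\<lambda>x. F (lift x) * g x)"
  proof
    fix x
    have "(\<Sum>l\<in>{-int s..int s}. indicator (open_cell l) x * (F (lift x) * g x)) = 
        F (lift x) * (\<Sum>l\<in>{-int s..int s}. indicator (open_cell l) x * g x)"
      unfolding sum_distrib_left by (intro sum.cong) auto
    then show "(\<Sum>l\<in>{-int s..int s}. indicator (open_cell l) x * (F (lift x) * g x)) = F (lift x) * g x"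
      by (simp add: supp_cells_sum[OF s])
  qed
  finally show "(\<integral>x. F x * transfer s g x \<partial>lborel) = (\<integral>x. F (lift x) * g x \<partial>lborel)" .
qed

text \<open>Markov property: the ends of \<open>J0\<close> lie in \<open>a \<int>\<close>, so a
  translate of \<open>J0\<close> by whole cells contains an open cell entirely or misses it. Points
  of one cell therefore see the same branches.\<close>

lemma shift_J0:
  assumes "x \<in> open_cell j" shows "x - a * of_int l \<in> J0 \<longleftrightarrow> l + k1 \<le> j \<and> j \<le> l + k2"
proof -
  have x: "a * of_int j < x" "x < a * (of_int j + 1)" using assms by (auto simp: open_cell_def)
  have 1: "a * of_int k1 < x - a * of_int l \<longleftrightarrow> l + k1 \<le> j"
  proof
    assume "a * of_int k1 < x - a * of_int l"
    then have "a * (of_int k1 + of_int l) < a * (of_int j + 1)" using x by (simp add: algebra_simps)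
    then have "of_int k1 + of_int l < (of_int j + 1 :: real)" using a_pos by (simp only: mult_less_cancel_left_pos)
    then show "l + k1 \<le> j" by linarith
  next
    assume "l + k1 \<le> j"
    then have "a * of_int (l + k1) \<le> a * of_int j" using a_pos by (intro mult_left_mono) auto
    then show "a * of_int k1 < x - a * of_int l" using x by (simp add: algebra_simps)
  qed
  have 2: "x - a * of_int l < a * (of_int k2 + 1) \<longleftrightarrow> j \<le> l + k2"
  proof
    assume "x - a * of_int l < a * (of_int k2 + 1)"
    then have "a * of_int j < a * (of_int k2 + of_int l + 1)" using x by (simp add: algebra_simps)
    then have "of_int j < (of_int k2 + of_int l + 1 :: real)" using a_pos by (simp only: mult_less_cancel_left_pos)
    then show "j \<le> l + k2" by linarith
  next
    assume "j \<le> l + k2"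
    then have "a * of_int (j + 1) \<le> a * of_int (l + k2 + 1)" using a_pos by (intro mult_left_mono) auto
    then show "x - a * of_int l < a * (of_int k2 + 1)" using x by (simp add: algebra_simps)
  qed
  show ?thesis using 1 2 by (simp add: J0_def)
qed

lemma \<psi>_open_cell: "z \<in> J0 \<Longrightarrow> \<psi> z + a * of_int l \<in> open_cell l"
  using \<psi>_J0 by (simp add: mem_open_cell_shift)

text \<open>Inverse branches shrink distances by \<open>1 / r\<close>, which turns \<open>K\<close>
  into \<open>K / r\<close>, and the Jacobian adds \<open>C\<close>. The estimate holds branch by
  branch and is stable under summation.\<close>

lemma transfer_log_lip:
  assumes "log_lip K g" "K \<ge> 0" "\<And>x. g x \<ge> 0"
  shows "log_lip (K / r + C) (transfer s g)"
  unfolding log_lip_def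
proof (intro allI ballI)
  fix j x y assume x: "x \<in> open_cell j" and y: "y \<in> open_cell j"
  show "transfer s g x \<le> exp ((K / r + C) * \<bar>x - y\<bar>) * transfer s g y"
    unfolding transfer_def sum_distrib_left
  proof (rule sum_mono)
    fix l
    let ?x = "x - a * of_int l" and ?y = "y - a * of_int l"
    show "weight ?x * g (\<psi> ?x + a * of_int l) \<le>
        exp ((K / r + C) * \<bar>x - y\<bar>) * (weight ?y * g (\<psi> ?y + a * of_int l))"
    proof (cases "?x \<in> J0")
      case False
      then show ?thesis using assms(3) weight_nonneg by (simp add: weight_def)
    next
      case True
      then have y0: "?y \<in> J0" using shift_J0[OF x] shift_J0[OF y] by simp
      have w: "weight ?x \<le> exp (C * \<bar>x - y\<bar>) * weight ?y" using weight_log_lip[OF True y0] by simp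
      have "g (\<psi> ?x + a * of_int l) \<le> exp (K * \<bar>\<psi> ?x - \<psi> ?y\<bar>) * g (\<psi> ?y + a * of_int l)"
        using assms(1)[unfolded log_lip_def, rule_format, OF \<psi>_open_cell[OF True, of l] \<psi>_open_cell[OF y0, of l]]
        by simp
      also have "K * \<bar>\<psi> ?x - \<psi> ?y\<bar> \<le> K * (\<bar>x - y\<bar> / r)"
        using \<psi>_lip[OF True y0] assms(2) by (intro mult_left_mono) auto
      finally have "g (\<psi> ?x + a * of_int l) \<le> exp (K * (\<bar>x - y\<bar> / r)) * g (\<psi> ?y + a * of_int l)"
        using assms(3) by (simp add: mult_right_mono)
      then have "weight ?x * g (\<psi> ?x + a * of_int l) \<le>
         (exp (C * \<bar>x - y\<bar>) * weight ?y) * (exp (K * (\<bar>x - y\<bar> / r)) * g (\<psi> ?y + a * of_int l))"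
        using w assms(3) weight_nonneg by (intro mult_mono) auto
      also have "\<dots> = exp ((K / r + C) * \<bar>x - y\<bar>) * (weight ?y * g (\<psi> ?y + a * of_int l))"
        by (simp add: ring_distribs exp_add mult_ac)
      finally show ?thesis .
    qed
  qed
qed

text \<open>\<open>K\<close> is chosen such that the transfer operator improves the log-Lipschitz constant \<open>K\<close> to
  \<open>K / r + C = K - 1\<close>; the gap leaves room for subtracting a piecewise constant function.\<close>

definition K where "K = r * (C + 1) / (r - 1)"

text \<open>\<open>exp (- K * a) / B\<close> is what one branch guarantees, and the \<open>2\<close>
  reflects two branches; the last factor pays for keeping the constant \<open>K\<close> after
  subtraction. The cap \<open>1 / 2\<close> keeps \<theta> below \<open>1\<close>.\<close>

definition \<theta> where
  "\<theta> = min (1 / 2) (2 * exp (- K * a) / B * (exp (- K * a) / K))"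

text \<open>The densities on which redistribution can be iterated. Support in finitely many cells
  persists because each cell is mapped over finitely many others.\<close>

definition reg :: "(real \<Rightarrow> real) set" where
  "reg = {g. integrable lborel g \<and> (\<forall>x. 0 \<le> g x) \<and> (\<exists>s. supp_cells s g) \<and> log_lip K g}"

lemma K_pos: "K > 0"
  using r_gt1 C_nonneg by (auto simp: K_def intro!: divide_pos_pos mult_pos_pos)

lemma K_gap: "K - (K / r + C) = 1"
proof -
  have "K * (r - 1) = r * (C + 1)" using r_gt1 by (simp add: K_def)
  then have "K - K / r = C + 1" using r_gt1 by (simp add: field_simps)
  then show ?thesis by simp
qed

end

section \<open>Almost invariance of binomial averages\<close>

text \<open>Expectation of \<open>f\<close> under the symmetric binomial distribution, which is what
  \<open>k\<close>-fold averaging of two neighbouring translates produces.\<close>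

definition binom_mean :: "nat \<Rightarrow> (nat \<Rightarrow> real) \<Rightarrow> real" where
  "binom_mean k f = (\<Sum>i\<le>k. real (k choose i) * f i) / 2 ^ k"

lemma binom_mean_Suc: "binom_mean (Suc k) f = (binom_mean k f + binom_mean k (\<lambda>i. f (Suc i))) / 2"
proof -
  have "(\<Sum>i\<le>Suc k. real (Suc k choose i) * f i)
      = f 0 + (\<Sum>i\<le>k. real (k choose i) * f (Suc i)) + (\<Sum>i\<le>k. real (k choose Suc i) * f (Suc i))"
    by (subst sum.atMost_Suc_shift) (simp add: sum.distrib algebra_simps)
  also have "f 0 + (\<Sum>i\<le>k. real (k choose i) * f (Suc i)) + (\<Sum>i\<le>k. real (k choose Suc i) * f (Suc i))
      = (\<Sum>i\<le>k. real (k choose i) * f (Suc i)) + (\<Sum>i\<le>Suc k. real (k choose i) * f i)"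
    using sum.atMost_Suc_shift[of "\<lambda>i. real (k choose i) * f i" k] by simp
  also have "(\<Sum>i\<le>Suc k. real (k choose i) * f i) = (\<Sum>i\<le>k. real (k choose i) * f i)" by simp
  finally show ?thesis by (simp add: binom_mean_def field_simps)
qed

text \<open>Variance of the symmetric binomial distribution, read off from the moment identities of
  Bernstein polynomials at \<open>1 / 2\<close>.\<close>

lemma binomial_variance: "(\<Sum>i\<le>n. real (n choose i) * (real n - 2 * real i)\<^sup>2) = real n * 2 ^ n"
proof -
  have B: "Bernstein n i (1/2) = real (n choose i) / 2 ^ n" if "i \<le> n" for i
    using that by (simp add: Bernstein_def power_add[symmetric] field_simps)
  have "(\<Sum>i\<le>n. real (n choose i) * (real n - 2 * real i)\<^sup>2) / 2 ^ n
      = (\<Sum>i\<le>n. (real n - 2 * real i)\<^sup>2 * Bernstein n i (1/2))"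
    unfolding sum_divide_distrib by (intro sum.cong) (simp_all add: B)
  \<comment> \<open>The square is written in the falling factorials \<open>1\<close>,
    \<open>i\<close>, \<open>i (i - 1)\<close>, whose Bernstein sums are known.\<close>
  also have "\<dots> = (\<Sum>i\<le>n. (real n)\<^sup>2 * Bernstein n i (1/2) + 
      ((4 - 4 * real n) * (real i * Bernstein n i (1/2)) + 4 * (real i * (real i - 1) * Bernstein n i (1/2))))"
    by (intro sum.cong refl) (simp add: power2_eq_square algebra_simps)
  also have "\<dots> = (real n)\<^sup>2 + ((4 - 4 * real n) * (real n * (1/2)) + 4 * (real n * (real n - 1) * (1/2)\<^sup>2))"
    unfolding sum.distrib sum_distrib_left[symmetric] by simp
  also have "\<dots> = real n" by (simp add: power2_eq_square algebra_simps)
  finally show ?thesis by (simp add: field_simps)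
qed

text \<open>The mean deviation is at most the standard deviation. The inequality
  \<open>2 s \<bar>m\<bar> \<le> m^2 + s^2\<close> with \<open>s = sqrt n\<close> replaces
  Cauchy-Schwarz.\<close>

lemma binomial_abs_dev: "(\<Sum>i\<le>n. real (n choose i) * \<bar>real n - 2 * real i\<bar>) \<le> 2 ^ n * sqrt (real n)"
proof (cases "n = 0")
  case False
  define s where "s = sqrt (real n)"
  have s: "s > 0" "s * s = real n" using False by (auto simp: s_def)
  have am: "\<bar>m\<bar> \<le> (m\<^sup>2 / s + s) / 2" for m :: real
  proof -
    have "0 \<le> (\<bar>m\<bar> - s)\<^sup>2" by simp
    then have "2 * \<bar>m\<bar> * s \<le> m\<^sup>2 + s * s" by (simp add: power2_eq_square algebra_simps)
    then show ?thesis using s(1) by (simp add: field_simps)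
  qed
  have "(\<Sum>i\<le>n. real (n choose i) * \<bar>real n - 2 * real i\<bar>)
      \<le> (\<Sum>i\<le>n. real (n choose i) * (((real n - 2 * real i)\<^sup>2 / s + s) / 2))"
    by (intro sum_mono mult_left_mono am) simp
  also have "\<dots> = (\<Sum>i\<le>n. real (n choose i) * (real n - 2 * real i)\<^sup>2) / (2 * s) + 
      (\<Sum>i\<le>n. real (n choose i)) * (s / 2)"
    unfolding sum_divide_distrib sum_distrib_right sum.distrib[symmetric]
    by (intro sum.cong refl) (simp add: field_simps)
  also have "(\<Sum>i\<le>n. real (n choose i)) = 2 ^ n"
    using choose_row_sum[of n] by (metis of_nat_numeral of_nat_power of_nat_sum)
  also have "(\<Sum>i\<le>n. real (n choose i) * (real n - 2 * real i)\<^sup>2) / (2 * s) = 2 ^ n * (s / 2)"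
    unfolding binomial_variance using s by (simp add: field_simps)
  finally show ?thesis by (simp add: s_def mult.commute)
qed simp

text \<open>The binomial distribution is almost invariant under a unit shift, since
  \<open>(k + 1) ((k choose i) - (k choose (i - 1))) = (k + 1 - 2 i) ((k + 1) choose i)\<close> and the
  standard deviation is of order \<open>sqrt k\<close>.\<close>

lemma binom_mean_shift_diff:
  assumes "\<And>i. \<bar>f i\<bar> \<le> b"
  shows "\<bar>binom_mean k (\<lambda>i. f i - f (Suc i))\<bar> \<le> 2 * b / sqrt (real (Suc k))"
proof -
  let ?n = "Suc k"
  have 1: "(\<Sum>i\<le>k. real (Suc k) * real (k choose i) * f i) 
      = (\<Sum>i\<le>?n. (real ?n - real i) * real (?n choose i) * f i)"
  proof -
    have "real (Suc k) * real (k choose i) = (real ?n - real i) * real (?n choose i)" if "i \<le> k" for i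
    proof -
      have "(?n - i) * (?n choose i) = ?n * (k choose i)" using binomial_absorb_comp[of ?n i] by simp
      then have "real (?n - i) * real (?n choose i) = real ?n * real (k choose i)" by (metis of_nat_mult)
      then show ?thesis using that by (simp add: of_nat_diff)
    qed
    then show ?thesis by (simp only: sum.atMost_Suc) simp
  qed
  have 2: "(\<Sum>i\<le>k. real (Suc k) * real (k choose i) * f (Suc i)) = (\<Sum>i\<le>?n. real i * real (?n choose i) * f i)"
  proof -
    have "real (Suc k) * real (k choose i) = real (Suc i) * real (?n choose Suc i)" for i
      using Suc_times_binomial_eq[of k i] by (metis mult.commute of_nat_mult)
    then show ?thesis by (subst sum.atMost_Suc_shift) simp
  qed
  have "real ?n * (\<Sum>i\<le>k. real (k choose i) * (f i - f (Suc i))) =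
     (\<Sum>i\<le>k. real (Suc k) * real (k choose i) * f i) - (\<Sum>i\<le>k. real (Suc k) * real (k choose i) * f (Suc i))"
    unfolding sum_distrib_left sum_subtractf[symmetric] by (intro sum.cong refl) (simp add: algebra_simps)
  also have "\<dots> = (\<Sum>i\<le>?n. real (?n choose i) * (real ?n - 2 * real i) * f i)"
    unfolding 1 2 sum_subtractf[symmetric] by (intro sum.cong refl) (simp add: algebra_simps)
  finally have eq: "real ?n * (\<Sum>i\<le>k. real (k choose i) * (f i - f (Suc i))) =
    (\<Sum>i\<le>?n. real (?n choose i) * (real ?n - 2 * real i) * f i)" .
  have "\<bar>\<Sum>i\<le>?n. real (?n choose i) * (real ?n - 2 * real i) * f i\<bar>
     \<le> (\<Sum>i\<le>?n. (real (?n choose i) * \<bar>real ?n - 2 * real i\<bar>) * b)"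
    by (intro order_trans[OF sum_abs] sum_mono) (use assms in \<open>auto simp: abs_mult intro!: mult_left_mono\<close>)
  also have "\<dots> \<le> (2 ^ ?n * sqrt (real ?n)) * b"
    unfolding sum_distrib_right[symmetric]
    using assms[of 0] by (intro mult_right_mono binomial_abs_dev) linarith
  finally have "real ?n * \<bar>\<Sum>i\<le>k. real (k choose i) * (f i - f (Suc i))\<bar> \<le> 2 ^ ?n * sqrt (real ?n) * b"
    unfolding eq[symmetric] abs_mult by simp
  then have "real ?n * \<bar>binom_mean k (\<lambda>i. f i - f (Suc i))\<bar> \<le> 2 * sqrt (real ?n) * b"
    by (simp add: binom_mean_def field_simps)
  then have "sqrt (real ?n) * (sqrt (real ?n) * \<bar>binom_mean k (\<lambda>i. f i - f (Suc i))\<bar>) \<le> sqrt (real ?n) * (2 * b)"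
    unfolding mult.assoc[symmetric] real_sqrt_mult_self by (simp add: mult_ac)
  then have "sqrt (real ?n) * \<bar>binom_mean k (\<lambda>i. f i - f (Suc i))\<bar> \<le> 2 * b"
    by (rule mult_left_le_imp_le) simp
  then show ?thesis by (simp add: field_simps)
qed

text \<open>The recursion met by the error bounds below: in each time step a share \<open>t\<close>
  of the mass undergoes one more averaging. Equivalently, the expectation of \<open>c\<close> at
  \<open>k\<close> plus the number of successes in \<open>n\<close> trials of probability
  \<open>t\<close>.\<close>

primrec lazy_iter :: "real \<Rightarrow> (nat \<Rightarrow> real) \<Rightarrow> nat \<Rightarrow> nat \<Rightarrow> real" where
  "lazy_iter t c 0 k = c k"
| "lazy_iter t c (Suc n) k = t * lazy_iter t c n (Suc k) + (1 - t) * lazy_iter t c n k"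

text \<open>The limits \<open>e k\<close> satisfy \<open>e k = t e (k + 1) + (1 - t) e k\<close>, hence do not depend on \<open>k\<close>, and
  \<open>e k \<le> c k\<close>.\<close>

lemma lazy_iter_tendsto_0:
  assumes t: "0 < t" "t \<le> 1" and dec: "\<And>k. c (Suc k) \<le> c k" and nn: "\<And>k. 0 \<le> c k" and c: "c \<longlonglongrightarrow> 0"
  shows "(\<lambda>n. lazy_iter t c n k) \<longlonglongrightarrow> 0"
proof -
  have nonneg: "0 \<le> lazy_iter t c n k" for n k
    by (induction n arbitrary: k) (use nn t in auto)
  have deck: "lazy_iter t c n (Suc k) \<le> lazy_iter t c n k" for n k
    by (induction n arbitrary: k) (use dec t in \<open>auto intro!: add_mono mult_left_mono\<close>)
  have "t * lazy_iter t c n (Suc k) \<le> t * lazy_iter t c n k" for n k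
    using deck t by simp
  then have decn: "lazy_iter t c (Suc n) k \<le> lazy_iter t c n k" for n k
    by (simp add: algebra_simps)
  have dseq: "decseq (\<lambda>n. lazy_iter t c n k)" for k unfolding decseq_Suc_iff using decn by blast
  have conv: "convergent (\<lambda>n. lazy_iter t c n k)" for k
    using decseq_convergent[OF dseq[of k], of 0] nonneg unfolding convergent_def by metis
  define e where "e k = lim (\<lambda>n. lazy_iter t c n k)" for k
  have e: "(\<lambda>n. lazy_iter t c n k) \<longlonglongrightarrow> e k" for k
    using conv by (simp add: e_def convergent_LIMSEQ_iff)
  have "e k = t * e (Suc k) + (1 - t) * e k" for k
  proof (rule LIMSEQ_unique)
    show "(\<lambda>n. lazy_iter t c (Suc n) k) \<longlonglongrightarrow> e k" using e by (rule LIMSEQ_Suc)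
    show "(\<lambda>n. lazy_iter t c (Suc n) k) \<longlonglongrightarrow> t * e (Suc k) + (1 - t) * e k"
      by (simp, intro tendsto_intros e)
  qed
  then have "t * e k = t * e (Suc k)" for k by (simp add: algebra_simps)
  then have const: "e (Suc k) = e k" for k using t by simp
  have e0: "e m = e 0" for m by (induction m) (auto simp: const)
  have le: "e m \<le> c m" for m
    using decseq_ge[OF dseq e, of m 0] by simp
  have "e 0 \<le> 0" by (rule LIMSEQ_le_const[OF c]) (use le e0 in metis)
  moreover have "e 0 \<ge> 0" by (rule LIMSEQ_le_const[OF e]) (use nonneg in auto)
  ultimately show ?thesis using e[of k] e0[of k] by simp
qed

context expanding_cell
begin

text \<open>Acts on observables. The offsets \<open>k1\<close> and \<open>k1 + 1\<close> lead to two
  target cells of any source cell, since \<open>k1 + 1 \<le> k2\<close>.\<close>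

definition two_cell_avg :: "(real \<Rightarrow> real) \<Rightarrow> real \<Rightarrow> real" where
  "two_cell_avg F x = (F (x + a * of_int k1) + F (x + a * (of_int k1 + 1))) / 2"

definition mean :: "int \<Rightarrow> (real \<Rightarrow> real) \<Rightarrow> real" where
  "mean l g = (\<integral>x. indicator (open_cell l) x * g x \<partial>lborel) / a"

text \<open>The projection onto functions constant on cells; as for \<open>transfer\<close>, the
  truncation is harmless when \<open>supp_cells s g\<close>.\<close>

definition cell_avg :: "nat \<Rightarrow> (real \<Rightarrow> real) \<Rightarrow> real \<Rightarrow> real" where
  "cell_avg s g x = (\<Sum>l\<in>{-int s..int s}. mean l g * indicator (open_cell l) x)"

lemma bdd_borel_two_cell_avg: "bdd_borel F b \<Longrightarrow> bdd_borel (two_cell_avg F) b"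
proof -
  assume F: "bdd_borel F b"
  then have [measurable]: "F \<in> borel_measurable borel" by (simp add: bdd_borel_def)
  have "\<bar>two_cell_avg F x\<bar> \<le> b" for x
    unfolding two_cell_avg_def using bdd_borelD(2)[OF F, of "x + a * of_int k1"] bdd_borelD(2)[OF F, of "x + a * (of_int k1 + 1)"]
    by (simp add: abs_le_iff)
  then show ?thesis unfolding bdd_borel_def by (auto simp: two_cell_avg_def[abs_def])
qed

text \<open>Each application moves by \<open>k1\<close> or \<open>k1 + 1\<close> cells, so after
  \<open>k\<close> of them the displacement is \<open>k * k1\<close> plus a binomial
  variable.\<close>

lemma two_cell_avg_funpow:
  "(two_cell_avg ^^ k) F x = binom_mean k (\<lambda>i. F (x + a * of_int k1 * real k + a * real i))"
proof (induction k arbitrary: x)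
  case (Suc k)
  have "(two_cell_avg ^^ Suc k) F x = ((two_cell_avg ^^ k) F (x + a * of_int k1) + (two_cell_avg ^^ k) F (x + a * (of_int k1 + 1))) / 2"
    by (simp add: two_cell_avg_def[of "(two_cell_avg ^^ k) F" x])
  then show ?case
    unfolding binom_mean_Suc Suc.IH by (simp add: algebra_simps)
qed (simp add: binom_mean_def)

text \<open>This commutation, due to the exact equivariance of \<open>lift\<close>, lets averaging
  performed at an early time act on the observable at the final time.\<close>

lemma two_cell_avg_lift: "two_cell_avg (\<lambda>x. F ((lift ^^ n) x)) x = two_cell_avg F ((lift ^^ n) x)"
  using lift_pow_shift[of n x k1] lift_pow_shift[of n x "k1 + 1"] by (simp add: two_cell_avg_def)

section \<open>Regular densities and their cell averages\<close>

lemma regD: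
  assumes "g \<in> reg"
  shows "integrable lborel g" "0 \<le> g x" "\<exists>s. supp_cells s g" "log_lip K g"
  using assms by (auto simp: reg_def)

lemma int_cell: "integrable lborel g \<Longrightarrow> integrable lborel (\<lambda>x. indicator (open_cell l) x * g x :: real)"
  by (intro integrable_bdd_mult[where F="indicator (open_cell l)" and b=1]) (auto simp: indicator_def)

lemma mean_nonneg: "g \<in> reg \<Longrightarrow> 0 \<le> mean l g"
  unfolding mean_def using a_pos regD(2) by (intro divide_nonneg_pos integral_nonneg_AE) auto

text \<open>Over a cell of width \<open>a\<close> a regular density varies by a factor of at most
  \<open>exp (K * a)\<close>.\<close>

lemma mean_le:
  assumes "g \<in> reg" "y \<in> open_cell l" shows "exp (- K * a) * mean l g \<le> g y"
proof -
  have "(\<integral>x. indicator (open_cell l) x * g x \<partial>lborel) \<le> (\<integral>x. indicator (open_cell l) x * (exp (K * a) * g y) \<partial>lborel)"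
  proof (rule integral_mono)
    show "integrable lborel (\<lambda>x. indicator (open_cell l) x * g x)" using int_cell regD assms by blast
    show "integrable lborel (\<lambda>x. indicator (open_cell l) x * (exp (K * a) * g y))"
      by (intro integrable_mult_left integrable_indicator_open_cell)
    fix x
    show "indicator (open_cell l) x * g x \<le> indicator (open_cell l) x * (exp (K * a) * g y)"
    proof (cases "x \<in> open_cell l")
      case True
      have "g x \<le> exp (K * \<bar>x - y\<bar>) * g y" using regD(4)[OF assms(1)] True assms(2) by (simp add: log_lip_def)
      also have "\<dots> \<le> exp (K * a) * g y"
        using True assms K_pos regD(2)[OF assms(1)] by (intro mult_right_mono) (auto simp: open_cell_def algebra_simps)
      finally show ?thesis using True by simp
    qed simp
  qed
  also have "\<dots> = a * (exp (K * a) * g y)" by (simp add: measure_open_cell)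
  finally have "mean l g \<le> exp (K * a) * g y" using a_pos by (simp add: mean_def field_simps)
  then show ?thesis by (simp add: exp_minus field_simps)
qed

lemma mean_outside:
  assumes "supp_cells s g" "l \<notin> {-int s..int s}" shows "mean l g = 0"
proof -
  have "indicator (open_cell l) x * g x = 0" for x
  proof (cases "x \<in> open_cell l \<and> g x \<noteq> 0")
    case True
    then obtain j where "j \<in> {-int s..int s}" "x \<in> open_cell j" using assms(1) unfolding supp_cells_def by blast
    then show ?thesis using assms(2) open_cell_disjoint True by blast
  qed auto
  then show ?thesis unfolding mean_def by (simp only:) simp
qed

lemma cell_avg_open_cell: "supp_cells s g \<Longrightarrow> x \<in> open_cell j \<Longrightarrow> cell_avg s g x = mean j g"
  using sum_open_cell[of x j "\<lambda>l. mean l g" s] mean_outside[of s g j] by (auto simp: cell_avg_def)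

lemma supp_cell_avg: "supp_cells s (cell_avg s g)"
  unfolding supp_cells_def
proof (intro allI impI)
  fix x assume "cell_avg s g x \<noteq> 0"
  then obtain l where "l \<in> {-int s..int s}" "mean l g * indicator (open_cell l) x \<noteq> 0"
    unfolding cell_avg_def by (meson sum.neutral)
  then show "\<exists>l\<in>{-int s..int s}. x \<in> open_cell l" by (auto simp: indicator_def split: if_splits)
qed

lemma integrable_cell_avg: "integrable lborel (cell_avg s g)"
  unfolding cell_avg_def by (intro Bochner_Integration.integrable_sum integrable_mult_right integrable_indicator_open_cell)

lemma cell_avg_reg:
  assumes g: "g \<in> reg" and s: "supp_cells s g" shows "cell_avg s g \<in> reg"
proof -
  have nn: "0 \<le> cell_avg s g x" for x
    unfolding cell_avg_def using mean_nonneg[OF g] by (auto intro!: sum_nonneg)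
  have "cell_avg s g x \<le> exp (K * \<bar>x - y\<bar>) * cell_avg s g y" if "x \<in> open_cell j" "y \<in> open_cell j" for x y j
  proof -
    have "1 * mean j g \<le> exp (K * \<bar>x - y\<bar>) * mean j g"
      using K_pos mean_nonneg[OF g] by (intro mult_right_mono) auto
    then show ?thesis using cell_avg_open_cell[OF s that(1)] cell_avg_open_cell[OF s that(2)] by simp
  qed
  then have "log_lip K (cell_avg s g)" by (simp add: log_lip_def)
  then show ?thesis using nn supp_cell_avg integrable_cell_avg unfolding reg_def by blast
qed

lemma sum_mean:
  assumes g: "g \<in> reg" and s: "supp_cells s g"
  shows "(\<Sum>l\<in>{-int s..int s}. mean l g * a) = (\<integral>x. g x \<partial>lborel)"
proof -
  have "(\<Sum>l\<in>{-int s..int s}. mean l g * a) = (\<Sum>l\<in>{-int s..int s}. \<integral>x. indicator (open_cell l) x * g x \<partial>lborel)"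
    using a_pos by (simp add: mean_def)
  also have "\<dots> = (\<integral>x. (\<Sum>l\<in>{-int s..int s}. indicator (open_cell l) x * g x) \<partial>lborel)"
    using int_cell[OF regD(1)[OF g]] by (subst Bochner_Integration.integral_sum) simp_all
  finally show ?thesis unfolding supp_cells_sum[OF s] .
qed

lemma integral_cell_avg:
  assumes g: "g \<in> reg" and s: "supp_cells s g"
  shows "(\<integral>x. cell_avg s g x \<partial>lborel) = (\<integral>x. g x \<partial>lborel)"
proof -
  have "(\<integral>x. cell_avg s g x \<partial>lborel) = (\<Sum>l\<in>{-int s..int s}. mean l g * a)"
    unfolding cell_avg_def using integrable_indicator_open_cell
    by (subst Bochner_Integration.integral_sum) (simp_all add: measure_open_cell)
  then show ?thesis using sum_mean[OF assms] by simp
qed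

section \<open>Redistribution of mass\<close>

lemma K_ge1: "K \<ge> 1"
proof -
  have "r - 1 \<le> r * (C + 1)" using r_gt1 C_nonneg by (simp add: algebra_simps add_increasing)
  then show ?thesis using r_gt1 by (simp add: K_def field_simps)
qed

lemma \<theta>_bounds: "0 < \<theta>" "\<theta> < 1"
  using B_pos K_pos by (auto simp: \<theta>_def)

lemma \<theta>_le: "\<theta> \<le> 2 * exp (- K * a) / B * (exp (- K * a) / K)"
  by (simp add: \<theta>_def)

text \<open>\<open>K \<ge> 1\<close> makes the last factor of \<theta> at most \<open>1\<close>, so
  the same \<theta> also secures nonnegativity of the remainder.\<close>

lemma \<theta>_le': "\<theta> \<le> 2 * exp (- K * a) / B"
proof -
  have "exp (- K * a) \<le> 1" using K_pos a_pos by simp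
  then have "exp (- K * a) \<le> K" using K_ge1 by linarith
  then have "2 * exp (- K * a) / B * (exp (- K * a) / K) \<le> 2 * exp (- K * a) / B * 1"
    using K_pos B_pos by (intro mult_left_mono) auto
  then show ?thesis using \<theta>_le by simp
qed

text \<open>With \<open>K1 = K / r + C\<close> the claim comes down to \<open>\<theta> v (exp (K t)
  - 1) \<le> u y (exp (K t) - exp (K1 t))\<close>. Both sides are compared with a multiple of
  \<open>t\<close>: the left from above by convexity, the right from below because
  \<open>K1 = K - 1\<close>.\<close>

lemma log_lip_subtract:
  assumes "u x \<le> exp ((K / r + C) * t) * u y" "0 \<le> t" "t \<le> a" "0 \<le> v"
    and "2 * exp (- K * a) / B * v \<le> (u y :: real)"
  shows "u x - \<theta> * v \<le> exp (K * t) * (u y - \<theta> * v)"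
proof -
  let ?c = "2 * exp (- K * a) / B" and ?K1 = "K / r + C"
  have c: "?c \<ge> 0" using B_pos by simp
  have uy: "0 \<le> u y" using assms(4,5) c by (meson mult_nonneg_nonneg order_trans)
  have e1: "exp (K * t) - 1 \<le> K * t * exp (K * a)"
  proof -
    have "1 + (- (K * t)) \<le> exp (- (K * t))" by (rule exp_ge_add_one_self)
    then have "exp (K * t) * (1 - K * t) \<le> exp (K * t) * exp (- (K * t))" by (intro mult_left_mono) auto
    also have "\<dots> = 1" by (simp add: exp_add[symmetric])
    finally have "exp (K * t) - 1 \<le> K * t * exp (K * t)" by (simp add: algebra_simps)
    also have "\<dots> \<le> K * t * exp (K * a)" using K_pos assms by (intro mult_left_mono) auto
    finally show ?thesis .
  qed
  have e2: "t \<le> exp (K * t) - exp (?K1 * t)"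
  proof -
    have K: "K = ?K1 + 1" using K_gap by simp
    have "exp (K * t) = exp (?K1 * t) * exp t"
      by (subst K) (simp only: distrib_right exp_add mult_1)
    then have "exp (K * t) - exp (?K1 * t) = exp (?K1 * t) * (exp t - 1)" by (simp add: algebra_simps)
    moreover have "t \<le> exp t - 1" using exp_ge_add_one_self[of t] by linarith
    then have "1 * t \<le> exp (?K1 * t) * (exp t - 1)"
      using assms(2) K_pos r_gt1 C_nonneg
      by (intro mult_mono) (auto intro!: add_nonneg_nonneg mult_nonneg_nonneg)
    ultimately show ?thesis by simp
  qed
  \<comment> \<open>Here the factor \<open>exp (- K * a) / K\<close> in \<theta> cancels
    \<open>K * exp (K * a)\<close>.\<close>
  have "\<theta> * v * (exp (K * t) - 1) \<le> (?c * (exp (- K * a) / K)) * v * (K * t * exp (K * a))"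
    using e1 \<theta>_le assms \<theta>_bounds K_pos B_pos by (intro mult_mono) auto
  also have "\<dots> = ?c * v * t * (exp (- K * a) * exp (K * a))" using K_pos by simp
  also have "\<dots> = ?c * v * t" by (simp add: exp_add[symmetric])
  also have "\<dots> \<le> u y * t" using assms by (intro mult_right_mono) auto
  also have "\<dots> \<le> u y * (exp (K * t) - exp (?K1 * t))" using e2 uy by (intro mult_left_mono)
  finally have "\<theta> * v * (exp (K * t) - 1) \<le> u y * (exp (K * t) - exp (?K1 * t))" .
  then show ?thesis using assms(1) by (simp add: algebra_simps)
qed

text \<open>Cell \<open>j\<close> is a target of the source cells \<open>j - k1\<close> and
  \<open>j - k1 - 1\<close>; each of these branches contributes at least
  \<open>exp (- K * a) / B\<close> times the mean over its source cell, and the other branches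
  contribute nonnegative terms.\<close>

lemma transfer_ge:
  assumes g: "g \<in> reg" and s: "supp_cells s g" and x: "x \<in> open_cell j"
  shows "2 * exp (- K * a) / B * ((mean (j - k1) g + mean (j - k1 - 1) g) / 2) \<le> transfer s g x"
proof -
  let ?term = "\<lambda>l. weight (x - a * of_int l) * g (\<psi> (x - a * of_int l) + a * of_int l)"
  let ?d = "\<lambda>l. if l = j - k1 \<or> l = j - k1 - 1 then exp (- K * a) / B * mean l g else 0"
  have nn: "0 \<le> ?term l" for l using weight_nonneg regD(2)[OF g] by simp
  have le: "?d l \<le> ?term l" for l
  proof (cases "l = j - k1 \<or> l = j - k1 - 1")
    case True
    then have J: "x - a * of_int l \<in> J0" using two_branches by (auto simp: shift_J0[OF x])
    have "1 / B * (exp (- K * a) * mean l g) \<le> ?term l"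
      using weight_ge[OF J] mean_le[OF g \<psi>_open_cell[OF J, of l]] mean_nonneg[OF g] B_pos weight_nonneg by (intro mult_mono) auto
    then show ?thesis using True by simp
  next
    case False
    then show ?thesis using nn by (simp only: if_False)
  qed
  have "(\<Sum>l\<in>{-int s..int s}. ?d l) = (\<Sum>l\<in>{-int s..int s} \<inter> {j - k1, j - k1 - 1}. ?d l)"
    by (intro sum.mono_neutral_right) auto
  \<comment> \<open>A source cell outside the truncated range carries no mass, so it may be added
    back.\<close>
  also have "\<dots> = (\<Sum>l\<in>{j - k1, j - k1 - 1}. ?d l)"
  proof (intro sum.mono_neutral_left ballI)
    fix l assume "l \<in> {j - k1, j - k1 - 1} - {-int s..int s} \<inter> {j - k1, j - k1 - 1}"
    then have "l \<notin> {-int s..int s}" by blast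
    then have "mean l g = 0" by (rule mean_outside[OF s])
    then show "?d l = 0" by simp
  qed auto
  also have "\<dots> = exp (- K * a) / B * mean (j - k1) g + exp (- K * a) / B * mean (j - k1 - 1) g" by simp
  finally have "exp (- K * a) / B * mean (j - k1) g + exp (- K * a) / B * mean (j - k1 - 1) g \<le> transfer s g x"
    unfolding transfer_def using sum_mono[of "{-int s..int s}" ?d ?term] le by simp
  then show ?thesis by (simp add: algebra_simps add_divide_distrib)
qed

text \<open>By bounded distortion, the transferred density dominates a fixed multiple of the cell averages
  of \<open>g\<close> moved to two adjacent target cells, and removing such a part keeps it regular.\<close>

lemma step:
  assumes g: "g \<in> reg"
  obtains s g' where "supp_cells s g" "g' \<in> reg" "(\<integral>x. g' x \<partial>lborel) = (\<integral>x. g x \<partial>lborel)"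
    "\<And>F b. bdd_borel F b \<Longrightarrow> (\<integral>x. F (lift x) * g x \<partial>lborel) =
       \<theta> * (\<integral>x. two_cell_avg F x * cell_avg s g x \<partial>lborel) + (1 - \<theta>) * (\<integral>x. F x * g' x \<partial>lborel)"
proof -
  obtain s where s: "supp_cells s g" using regD(3)[OF g] by blast
  note [measurable] = borel_measurable_integrable[OF regD(1)[OF g], simplified]
  let ?u = "transfer s g" and ?h = "cell_avg s g" and ?c = "2 * exp (- K * a) / B"
  let ?t1 = "a * of_int k1" and ?t2 = "a * (of_int k1 + 1)"
  \<comment> \<open>The cell averages under the dual of \<open>two_cell_avg\<close>; constant on
    each open cell.\<close>
  define v where "v x = (?h (x - ?t1) + ?h (x - ?t2)) / 2" for x
  \<comment> \<open>Divided by \<open>1 - \<theta>\<close> to keep the mass of \<open>g\<close>, and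
    set to zero on \<open>a \<int>\<close> as \<open>supp_cells\<close> demands.\<close>
  define g' where "g' x = (if x \<in> open_cell \<lfloor>x / a\<rfloor> then (?u x - \<theta> * v x) / (1 - \<theta>) else 0)" for x
  have c: "?c > 0" using B_pos by simp
  have bh: "bdd_borel (\<lambda>_. 1) 1" by (simp add: bdd_borel_def)
  have int_h: "integrable lborel ?h" by (rule integrable_cell_avg)
  have int_u: "integrable lborel ?u"
    using transfer_dual(1)[OF bh regD(1)[OF g] s] by simp
  have int_v: "integrable lborel v"
    unfolding v_def using lborel_integrable_translate[OF int_h, of "- ?t1"] lborel_integrable_translate[OF int_h, of "- ?t2"]
    by simp
  have v_open_cell: "v x = (mean (j - k1) g + mean (j - k1 - 1) g) / 2" if "x \<in> open_cell j" for x j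
  proof -
    have "x - ?t1 \<in> open_cell (j - k1)" "x - ?t2 \<in> open_cell (j - k1 - 1)" using that by (auto simp: open_cell_def algebra_simps)
    then show ?thesis unfolding v_def using cell_avg_open_cell[OF s] by simp
  qed
  have v_nn: "v x \<ge> 0" for x
    unfolding v_def using regD(2)[OF cell_avg_reg[OF g s]] by simp
  have u_ge: "?c * v x \<le> ?u x" if "x \<in> open_cell j" for x j
    using transfer_ge[OF g s that] unfolding v_open_cell[OF that] .
  have u_ge': "\<theta> * v x \<le> ?u x" if "x \<in> open_cell j" for x j
    using u_ge[OF that] mult_right_mono[OF \<theta>_le' v_nn, of x] by linarith
  have AE_g': "AE x in lborel. (1 - \<theta>) * g' x = ?u x - \<theta> * v x"
    using AE_open_cell by eventually_elim (use \<theta>_bounds in \<open>simp add: g'_def\<close>)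
  have meas_set[measurable]: "{x. x \<in> open_cell \<lfloor>x / a\<rfloor>} \<in> sets borel"
  proof -
    have "{x. x \<in> open_cell \<lfloor>x / a\<rfloor>} = {x. x - a * of_int \<lfloor>x / a\<rfloor> \<in> {0<..<a}}" by (simp add: mem_open_cell_shift)
    also have "\<dots> \<in> sets borel" by measurable
    finally show ?thesis .
  qed
  have [measurable]: "?u \<in> borel_measurable borel" "v \<in> borel_measurable borel"
    using int_u int_v by auto
  have g'_meas[measurable]: "g' \<in> borel_measurable borel"
    unfolding g'_def by measurable
  have int_g': "integrable lborel g'"
  proof (rule integrable_cong_AE_imp)
    show "integrable lborel (\<lambda>x. (?u x - \<theta> * v x) / (1 - \<theta>))" using int_u int_v by auto
    show "AE x in lborel. (?u x - \<theta> * v x) / (1 - \<theta>) = g' x"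
      using AE_open_cell by eventually_elim (simp add: g'_def)
  qed simp
  have id: "(\<integral>x. F (lift x) * g x \<partial>lborel) =
       \<theta> * (\<integral>x. two_cell_avg F x * ?h x \<partial>lborel) + (1 - \<theta>) * (\<integral>x. F x * g' x \<partial>lborel)" if F: "bdd_borel F b" for F b
  proof -
    note [measurable] = bdd_borelD(1)[OF F]
    have t: "bdd_borel (\<lambda>x. F (x + t)) b" for t using F by (auto simp: bdd_borel_def)
    have i: "integrable lborel (\<lambda>x. F x * ?u x)" "integrable lborel (\<lambda>x. F x * v x)" "integrable lborel (\<lambda>x. F x * g' x)"
      using bdd_borel_integrable[OF F] int_u int_v int_g' by auto
    have ih: "integrable lborel (\<lambda>x. F (x + t) * ?h x)" for t using bdd_borel_integrable[OF t int_h] .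
    have ih': "integrable lborel (\<lambda>x. F x * ?h (x - t))" for t
      using lborel_integrable_translate[OF ih[of t], of "- t"] by simp
    have "(\<integral>x. F (lift x) * g x \<partial>lborel) = (\<integral>x. F x * ?u x \<partial>lborel)"
      using transfer_dual(2)[OF F regD(1)[OF g] s] by simp
    also have "\<dots> = (\<integral>x. \<theta> * (F x * v x) + (1 - \<theta>) * (F x * g' x) \<partial>lborel)"
    proof (rule integral_cong_AE)
      show "AE x in lborel. F x * ?u x = \<theta> * (F x * v x) + (1 - \<theta>) * (F x * g' x)"
        using AE_g'
      proof eventually_elim
        fix x assume "(1 - \<theta>) * g' x = ?u x - \<theta> * v x"
        then have "?u x = \<theta> * v x + (1 - \<theta>) * g' x" by simp
        then show "F x * ?u x = \<theta> * (F x * v x) + (1 - \<theta>) * (F x * g' x)" by (simp only:) (simp add: algebra_simps)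
      qed
    qed (simp_all)
    also have "\<dots> = \<theta> * (\<integral>x. F x * v x \<partial>lborel) + (1 - \<theta>) * (\<integral>x. F x * g' x \<partial>lborel)"
      using i by simp
    also have "(\<integral>x. F x * v x \<partial>lborel) = (\<integral>x. (F x * ?h (x - ?t1) + F x * ?h (x - ?t2)) / 2 \<partial>lborel)"
      by (intro Bochner_Integration.integral_cong) (auto simp: v_def algebra_simps)
    also have "\<dots> = ((\<integral>x. F x * ?h (x - ?t1) \<partial>lborel) + (\<integral>x. F x * ?h (x - ?t2) \<partial>lborel)) / 2"
      using ih' by simp
    also have "\<dots> = ((\<integral>x. F (x + ?t1) * ?h x \<partial>lborel) + (\<integral>x. F (x + ?t2) * ?h x \<partial>lborel)) / 2"
      using lborel_integral_translate[of "\<lambda>x. F x * ?h (x - ?t1)" ?t1]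
        lborel_integral_translate[of "\<lambda>x. F x * ?h (x - ?t2)" ?t2] by simp
    also have "\<dots> = (\<integral>x. (F (x + ?t1) * ?h x + F (x + ?t2) * ?h x) / 2 \<partial>lborel)"
      using ih by simp
    also have "\<dots> = (\<integral>x. two_cell_avg F x * ?h x \<partial>lborel)"
      by (intro Bochner_Integration.integral_cong) (auto simp: two_cell_avg_def algebra_simps)
    finally show ?thesis .
  qed
  have mass: "(\<integral>x. g' x \<partial>lborel) = (\<integral>x. g x \<partial>lborel)"
  proof -
    \<comment> \<open>Equality of masses comes from testing the decomposition with the observable
      \<open>1\<close>.\<close>
    have "(1 - \<theta>) * (\<integral>x. g x \<partial>lborel) = (1 - \<theta>) * (\<integral>x. g' x \<partial>lborel)"
      using id[OF bh] integral_cell_avg[OF g s] by (simp add: two_cell_avg_def algebra_simps)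
    then show ?thesis using \<theta>_bounds by simp
  qed
  have g'_nn: "0 \<le> g' x" for x
    unfolding g'_def using u_ge' \<theta>_bounds by (auto intro!: divide_nonneg_pos)
  have g'_supp: "supp_cells (s + nat \<bar>k1\<bar> + nat \<bar>k2\<bar>) g'"
    unfolding supp_cells_def
  proof (intro allI impI)
    fix x assume nz: "g' x \<noteq> 0"
    define j where "j = \<lfloor>x / a\<rfloor>"
    have x: "x \<in> open_cell j" using nz by (auto simp: g'_def j_def split: if_splits)
    \<comment> \<open>Where the transferred density vanishes, the removed part vanishes too, since
      \<open>?u\<close> dominates a positive multiple of \<open>v\<close>. So no support is
      created.\<close>
    have "?u x \<noteq> 0"
    proof
      assume "?u x = 0"
      then have "?c * v x \<le> 0" using u_ge[OF x] by simp
      then have "v x = 0" using v_nn[of x] mult_pos_pos[OF c, of "v x"] by linarith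
      then show False using nz \<open>?u x = 0\<close> by (simp add: g'_def split: if_splits)
    qed
    then obtain l where l: "l \<in> {-int s..int s}" "weight (x - a * of_int l) \<noteq> 0"
      unfolding transfer_def by (metis (no_types, lifting) mult_zero_left sum.neutral)
    then have "x - a * of_int l \<in> J0" by (auto simp: weight_def split: if_splits)
    then have "l + k1 \<le> j" "j \<le> l + k2" by (auto simp: shift_J0[OF x])
    then have "j \<in> {- int (s + nat \<bar>k1\<bar> + nat \<bar>k2\<bar>)..int (s + nat \<bar>k1\<bar> + nat \<bar>k2\<bar>)}" using l(1) by auto
    then show "\<exists>l\<in>{- int (s + nat \<bar>k1\<bar> + nat \<bar>k2\<bar>)..int (s + nat \<bar>k1\<bar> + nat \<bar>k2\<bar>)}. x \<in> open_cell l"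
      using x by blast
  qed
  have u_lip: "log_lip (K / r + C) ?u"
    using transfer_log_lip[OF regD(4)[OF g]] K_pos regD(2)[OF g] by simp
  have g'_lip: "log_lip K g'"
    unfolding log_lip_def
  proof (intro allI ballI)
    fix j x y assume x: "x \<in> open_cell j" and y: "y \<in> open_cell j"
    \<comment> \<open>\<open>v\<close> is constant on the cell, so its value at \<open>x\<close>
      serves for both points.\<close>
    have g': "g' z = (?u z - \<theta> * v x) / (1 - \<theta>)" if "z \<in> open_cell j" for z
      using that v_open_cell[OF x] v_open_cell[OF that] by (simp add: g'_def floor_open_cell)
    have "?u x - \<theta> * v x \<le> exp (K * \<bar>x - y\<bar>) * (?u y - \<theta> * v x)"
    proof (rule log_lip_subtract)
      show "?u x \<le> exp ((K / r + C) * \<bar>x - y\<bar>) * ?u y" using u_lip x y by (simp add: log_lip_def)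
      show "\<bar>x - y\<bar> \<le> a" using x y by (auto simp: open_cell_def algebra_simps)
      show "?c * v x \<le> ?u y" using u_ge[OF y] unfolding v_open_cell[OF x] v_open_cell[OF y] .
    qed (use v_nn in auto)
    then show "g' x \<le> exp (K * \<bar>x - y\<bar>) * g' y"
      unfolding g'[OF x] g'[OF y] times_divide_eq_right using \<theta>_bounds by (intro divide_right_mono) auto
  qed
  have "g' \<in> reg" using int_g' g'_nn g'_supp g'_lip unfolding reg_def by blast
  from that[OF s this mass id] show thesis .
qed

section \<open>Global-local mixing for Lebesgue measure\<close>

definition corr :: "(real \<Rightarrow> real) \<Rightarrow> nat \<Rightarrow> (real \<Rightarrow> real) \<Rightarrow> real" where
  "corr F n g = (\<integral>x. F ((lift ^^ n) x) * g x \<partial>lborel)"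

lemma corr_integrable:
  "bdd_borel F b \<Longrightarrow> integrable lborel g \<Longrightarrow> integrable lborel (\<lambda>x. F ((lift ^^ n) x) * g x)"
  using bdd_borel_integrable[OF bdd_borel_lift] .

lemma corr_le:
  assumes F: "bdd_borel F b" and g: "integrable lborel g"
  shows "\<bar>corr F n g\<bar> \<le> b * (\<integral>x. \<bar>g x\<bar> \<partial>lborel)"
proof -
  have "\<bar>corr F n g\<bar> \<le> (\<integral>x. \<bar>F ((lift ^^ n) x) * g x\<bar> \<partial>lborel)"
    unfolding corr_def by (rule integral_abs_bound)
  also have "\<dots> \<le> (\<integral>x. b * \<bar>g x\<bar> \<partial>lborel)"
  proof (rule integral_mono)
    show "integrable lborel (\<lambda>x. \<bar>F ((lift ^^ n) x) * g x\<bar>)"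
      by (rule integrable_abs[OF corr_integrable[OF F g]])
    show "integrable lborel (\<lambda>x. b * \<bar>g x\<bar>)" using g by auto
    show "\<bar>F ((lift ^^ n) x) * g x\<bar> \<le> b * \<bar>g x\<bar>" for x
      unfolding abs_mult by (intro mult_right_mono bdd_borelD(2)[OF F]) auto
  qed
  finally show ?thesis by simp
qed

lemma corr_le_reg:
  assumes F: "bdd_borel F b" and g: "g \<in> reg"
  shows "\<bar>corr F n g\<bar> \<le> b * (\<integral>x. g x \<partial>lborel)"
  using corr_le[OF F regD(1)[OF g]] regD(2)[OF g] by simp

lemma corr_diff:
  "bdd_borel F b \<Longrightarrow> integrable lborel g \<Longrightarrow> integrable lborel h \<Longrightarrow>
    corr F n (\<lambda>x. g x - h x) = corr F n g - corr F n h"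
  using corr_integrable[of F b g n] corr_integrable[of F b h n] by (simp add: corr_def right_diff_distrib)

lemma corr_cmult: "corr F n (\<lambda>x. c * g x) = c * corr F n g"
  by (simp add: corr_def mult.left_commute)

lemma corr_sum:
  assumes "bdd_borel F b" "\<And>i. i \<in> I \<Longrightarrow> integrable lborel (g i)"
  shows "corr F n (\<lambda>x. \<Sum>i\<in>I. g i x) = (\<Sum>i\<in>I. corr F n (g i))"
  unfolding corr_def sum_distrib_left
  using corr_integrable[OF assms(1) assms(2)] by (intro Bochner_Integration.integral_sum) auto

text \<open>\<open>s\<close> and \<open>g'\<close> are chosen before the observable and the time, so
  one decomposition serves all of them.\<close>

lemma corr_Suc:
  assumes g: "g \<in> reg"
  obtains s g' where "supp_cells s g" "g' \<in> reg" "(\<integral>x. g' x \<partial>lborel) = (\<integral>x. g x \<partial>lborel)"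
    "\<And>F b n. bdd_borel F b \<Longrightarrow>
       corr F (Suc n) g = \<theta> * corr (two_cell_avg F) n (cell_avg s g) + (1 - \<theta>) * corr F n g'"
proof -
  obtain s g' where *: "supp_cells s g" "g' \<in> reg" "(\<integral>x. g' x \<partial>lborel) = (\<integral>x. g x \<partial>lborel)"
    "\<And>F b. bdd_borel F b \<Longrightarrow> (\<integral>x. F (lift x) * g x \<partial>lborel) =
       \<theta> * (\<integral>x. two_cell_avg F x * cell_avg s g x \<partial>lborel) + (1 - \<theta>) * (\<integral>x. F x * g' x \<partial>lborel)"
    using step[OF g] by blast
  have "corr F (Suc n) g = \<theta> * corr (two_cell_avg F) n (cell_avg s g) + (1 - \<theta>) * corr F n g'"
    if F: "bdd_borel F b" for F b n
    using *(4)[OF bdd_borel_lift[OF F, of n]] unfolding corr_def two_cell_avg_lift funpow_Suc_right o_apply .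
  with * that show thesis by blast
qed

text \<open>Induction on time with \<open>k\<close> arbitrary. Each step sends the share \<theta> of
  the mass to level \<open>k + 1\<close> and leaves the rest at level \<open>k\<close>, which is the
  recursion of \<open>lazy_iter\<close>; positivity of the densities turns sup norms into bounds by
  mass.\<close>

lemma corr_small:
  assumes "bdd_borel D b" and "\<And>k x. \<bar>(two_cell_avg ^^ k) D x\<bar> \<le> c k" and "g \<in> reg"
  shows "\<bar>corr ((two_cell_avg ^^ k) D) n g\<bar> \<le> lazy_iter \<theta> c n k * (\<integral>x. g x \<partial>lborel)"
proof -
  have b: "bdd_borel ((two_cell_avg ^^ k) D) (c k)" for k
  proof -
    have "bdd_borel ((two_cell_avg ^^ k) D) b" by (induction k) (auto simp: assms(1) bdd_borel_two_cell_avg)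
    then show ?thesis using assms(2) by (simp add: bdd_borel_def)
  qed
  show ?thesis using assms(3)
  proof (induction n arbitrary: k g)
    case 0
    then show ?case using corr_le_reg[OF b] by simp
  next
    case (Suc n)
    obtain s g' where *: "supp_cells s g" "g' \<in> reg" "(\<integral>x. g' x \<partial>lborel) = (\<integral>x. g x \<partial>lborel)"
      "\<And>F b n. bdd_borel F b \<Longrightarrow>
         corr F (Suc n) g = \<theta> * corr (two_cell_avg F) n (cell_avg s g) + (1 - \<theta>) * corr F n g'"
      using corr_Suc[OF Suc.prems] by blast
    let ?m = "\<integral>x. g x \<partial>lborel"
    have "corr ((two_cell_avg ^^ k) D) (Suc n) g =
        \<theta> * corr ((two_cell_avg ^^ Suc k) D) n (cell_avg s g) + (1 - \<theta>) * corr ((two_cell_avg ^^ k) D) n g'"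
      using *(4)[OF b] by simp
    moreover have "\<bar>corr ((two_cell_avg ^^ Suc k) D) n (cell_avg s g)\<bar> \<le> lazy_iter \<theta> c n (Suc k) * ?m"
      using Suc.IH[OF cell_avg_reg[OF Suc.prems *(1)], of "Suc k"] integral_cell_avg[OF Suc.prems *(1)] by simp
    moreover have "\<bar>corr ((two_cell_avg ^^ k) D) n g'\<bar> \<le> lazy_iter \<theta> c n k * ?m"
      using Suc.IH[OF *(2), of k] *(3) by simp
    ultimately have "\<bar>corr ((two_cell_avg ^^ k) D) (Suc n) g\<bar> \<le>
        \<theta> * (lazy_iter \<theta> c n (Suc k) * ?m) + (1 - \<theta>) * (lazy_iter \<theta> c n k * ?m)"
      using \<theta>_bounds
      by (simp only:, intro order_trans[OF abs_triangle_ineq] add_mono) (auto simp: abs_mult intro!: mult_left_mono)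
    then show ?case by (simp add: algebra_simps)
  qed
qed

text \<open>\<open>two_cell_avg\<close> commutes with the dynamics, so the redistribution of mass may be applied to the
  observable instead; iterating it flattens every coboundary \<open>F - F \<circ> \<sigma>\<close>.\<close>

lemma corr_shift_diff:
  assumes F: "bdd_borel F b" and g: "g \<in> reg"
  shows "(\<lambda>n. corr (\<lambda>x. F x - F (x + a)) n g) \<longlonglongrightarrow> 0"
proof -
  let ?D = "\<lambda>x. F x - F (x + a)" and ?c = "\<lambda>k. 2 * b / sqrt (real (Suc k))"
  have b: "b \<ge> 0" using bdd_borelD(2)[OF F, of 0] by linarith
  have D: "bdd_borel ?D (2 * b)"
  proof -
    note [measurable] = bdd_borelD(1)[OF F]
    have "\<bar>?D x\<bar> \<le> 2 * b" for x using bdd_borelD(2)[OF F, of x] bdd_borelD(2)[OF F, of "x + a"] by linarith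
    then show ?thesis unfolding bdd_borel_def by auto
  qed
  \<comment> \<open>For fixed \<open>x\<close> the averaged coboundary is a binomial mean of
    \<open>f i - f (i + 1)\<close>, with \<open>f\<close> the values of \<open>F\<close> along an
    arithmetic progression of step \<open>a\<close>.\<close>
  have c: "\<bar>(two_cell_avg ^^ k) ?D x\<bar> \<le> ?c k" for k x
    using binom_mean_shift_diff[of "\<lambda>i. F (x + a * of_int k1 * real k + a * real i)" b k] bdd_borelD(2)[OF F]
    unfolding two_cell_avg_funpow by (simp add: algebra_simps)
  have "(\<lambda>n. lazy_iter \<theta> ?c n 0) \<longlonglongrightarrow> 0"
  proof (rule lazy_iter_tendsto_0)
    show "?c \<longlonglongrightarrow> 0" by real_asymp
    show "?c (Suc k) \<le> ?c k" for k using b by (intro divide_left_mono) auto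
  qed (use \<theta>_bounds b in auto)
  then have "(\<lambda>n. lazy_iter \<theta> ?c n 0 * (\<integral>x. g x \<partial>lborel)) \<longlonglongrightarrow> 0" by (rule tendsto_mult_left_zero)
  then show ?thesis
    by (rule Lim_null_comparison[rotated]) (use corr_small[OF D c g, of 0] in simp)
qed

section \<open>Asymptotic equality of densities of equal mass\<close>

definition unit_cell :: "int \<Rightarrow> real \<Rightarrow> real" where
  "unit_cell j x = indicator (open_cell j) x / a"

lemma unit_cell_integral: "(\<integral>x. unit_cell j x \<partial>lborel) = 1"
  using a_pos by (simp add: unit_cell_def measure_open_cell)

lemma unit_cell_reg: "unit_cell j \<in> reg"
proof -
  have "integrable lborel (unit_cell j)" unfolding unit_cell_def using integrable_indicator_open_cell by auto
  moreover have "supp_cells (nat \<bar>j\<bar>) (unit_cell j)"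
    by (auto simp: supp_cells_def unit_cell_def indicator_def intro!: bexI[of _ j])
  moreover have "log_lip K (unit_cell j)"
    unfolding log_lip_def
  proof (intro allI ballI)
    fix i x y assume "x \<in> open_cell i" "y \<in> open_cell i"
    then have "unit_cell j x = (if j = i then 1 / a else 0)" "unit_cell j y = (if j = i then 1 / a else 0)"
      by (simp_all add: unit_cell_def indicator_open_cell)
    then show "unit_cell j x \<le> exp (K * \<bar>x - y\<bar>) * unit_cell j y"
      using K_pos a_pos by (simp add: divide_right_mono)
  qed
  ultimately show ?thesis using a_pos by (auto simp: reg_def unit_cell_def)
qed

lemma corr_unit_cell_translate:
  "corr F n (unit_cell (j + i)) = corr (\<lambda>x. F (x + a * of_int i)) n (unit_cell j)"
proof -
  have "unit_cell (j + i) (x + a * of_int i) = unit_cell j x" for x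
    by (auto simp: unit_cell_def indicator_def open_cell_def algebra_simps)
  then show ?thesis
    unfolding corr_def
    by (subst lborel_integral_translate[symmetric, of _ "a * of_int i"]) (simp add: lift_pow_shift)
qed

text \<open>Neighbouring cells differ by the correlation of a coboundary, which vanishes
  asymptotically; finitely many such differences lead from cell \<open>0\<close> to cell
  \<open>j\<close>.\<close>

lemma corr_unit_cells:
  assumes F: "bdd_borel F b" shows "(\<lambda>n. corr F n (unit_cell j) - corr F n (unit_cell 0)) \<longlonglongrightarrow> 0"
proof -
  have Fs: "bdd_borel (\<lambda>x. F (x + a)) b"
  proof -
    note [measurable] = bdd_borelD(1)[OF F]
    show ?thesis using F unfolding bdd_borel_def by simp
  qed
  have step: "(\<lambda>n. corr F n (unit_cell j) - corr F n (unit_cell (j + 1))) \<longlonglongrightarrow> 0" for j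
  proof -
    have "corr F n (unit_cell j) - corr F n (unit_cell (j + 1)) = corr (\<lambda>x. F x - F (x + a)) n (unit_cell j)" for n
      unfolding corr_unit_cell_translate[of F n j 1]
      using corr_integrable[OF F regD(1)[OF unit_cell_reg], of n] corr_integrable[OF Fs regD(1)[OF unit_cell_reg], of n]
      by (simp add: corr_def left_diff_distrib)
    then show ?thesis using corr_shift_diff[OF F unit_cell_reg] by simp
  qed
  show ?thesis
  proof (induction j rule: int_induct[of _ 0])
    case base
    show ?case by simp
  next
    case (step1 i)
    show ?case using tendsto_diff[OF step1(2) step[of i]] by simp
  next
    case (step2 i)
    show ?case using tendsto_add[OF step2(2) step[of "i - 1"]] by simp
  qed
qed

text \<open>The cell averages form a finite combination of unit cells with total weight the mass of
  \<open>g\<close>, and averaging the observable only moves each of them to two other cells.\<close>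

lemma corr_two_cell_avg:
  assumes F: "bdd_borel F b" and g: "g \<in> reg" and s: "supp_cells s g"
  shows "(\<lambda>n. corr (two_cell_avg F) n (cell_avg s g) - (\<integral>x. g x \<partial>lborel) * corr F n (unit_cell 0)) \<longlonglongrightarrow> 0"
proof -
  let ?m = "\<lambda>l. mean l g * a"
  have h: "corr (two_cell_avg F) n (unit_cell l) = (corr F n (unit_cell (l + k1)) + corr F n (unit_cell (l + (k1 + 1)))) / 2" for n l
  proof -
    have F': "bdd_borel (\<lambda>x. F (x + t)) b" for t
    proof -
      note [measurable] = bdd_borelD(1)[OF F]
      show ?thesis using F unfolding bdd_borel_def by simp
    qed
    have i: "integrable lborel (\<lambda>x. F ((lift ^^ n) x + t) * unit_cell l x)" for t
      by (rule corr_integrable[OF F'[of t] regD(1)[OF unit_cell_reg]])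
    have "corr (two_cell_avg F) n (unit_cell l) =
      (\<integral>x. (F ((lift ^^ n) x + a * of_int k1) * unit_cell l x
        + F ((lift ^^ n) x + a * of_int (k1 + 1)) * unit_cell l x) / 2 \<partial>lborel)"
      by (simp add: corr_def two_cell_avg_def distrib_right)
    also have "\<dots> =
      (corr (\<lambda>x. F (x + a * of_int k1)) n (unit_cell l) + corr (\<lambda>x. F (x + a * of_int (k1 + 1))) n (unit_cell l)) / 2"
      unfolding corr_def integral_divide_zero by (subst Bochner_Integration.integral_add[OF i i]) (rule refl)
    finally show ?thesis unfolding corr_unit_cell_translate .
  qed
  have eq: "corr (two_cell_avg F) n (cell_avg s g) - (\<integral>x. g x \<partial>lborel) * corr F n (unit_cell 0) =
    (\<Sum>l\<in>{-int s..int s}. ?m l * ((corr F n (unit_cell (l + k1)) - corr F n (unit_cell 0)) / 2 + (corr F n (unit_cell (l + (k1 + 1))) - corr F n (unit_cell 0)) / 2))" for n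
  proof -
    have "cell_avg s g = (\<lambda>x. \<Sum>l\<in>{-int s..int s}. ?m l * unit_cell l x)"
      using a_pos by (simp add: cell_avg_def unit_cell_def fun_eq_iff)
    then have ca: "corr (two_cell_avg F) n (cell_avg s g) = (\<Sum>l\<in>{-int s..int s}. ?m l * corr (two_cell_avg F) n (unit_cell l))"
      using corr_sum[OF bdd_borel_two_cell_avg[OF F], of "{-int s..int s}" "\<lambda>l x. ?m l * unit_cell l x" n]
        regD(1)[OF unit_cell_reg] by (simp add: corr_cmult)
    show ?thesis
      unfolding ca sum_mean[OF g s, symmetric] h sum_distrib_right sum_subtractf[symmetric]
      by (intro sum.cong refl) (simp add: field_simps)
  qed
  show ?thesis unfolding eq
    by (intro tendsto_null_sum tendsto_mult_right_zero tendsto_add_zero tendsto_divide_zero corr_unit_cells[OF F])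
qed

text \<open>After one step the redistributed parts of both densities are asymptotically indistinguishable,
  and the remainders are compared again with total mass reduced by the factor \<open>1 - \<theta>\<close>.\<close>

lemma corr_reg_diff:
  assumes F: "bdd_borel F b" and "g1 \<in> reg" "g2 \<in> reg"
    and "(\<integral>x. g1 x \<partial>lborel) = M" "(\<integral>x. g2 x \<partial>lborel) = M" and "\<epsilon> > 0"
  shows "\<forall>\<^sub>F n in sequentially. \<bar>corr F n g1 - corr F n g2\<bar> \<le> 2 * b * M * (1 - \<theta>) ^ m + \<epsilon>"
  using assms(2-)
proof (induction m arbitrary: g1 g2 \<epsilon>)
  case 0
  have "\<bar>corr F n g1 - corr F n g2\<bar> \<le> 2 * b * M * (1 - \<theta>) ^ 0 + \<epsilon>" for n
    using corr_le_reg[OF F 0(1), of n] corr_le_reg[OF F 0(2), of n] 0 by simp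
  then show ?case by simp
next
  case (Suc m)
  obtain s1 h1 where 1: "supp_cells s1 g1" "h1 \<in> reg" "(\<integral>x. h1 x \<partial>lborel) = (\<integral>x. g1 x \<partial>lborel)"
    "\<And>F b n. bdd_borel F b \<Longrightarrow>
       corr F (Suc n) g1 = \<theta> * corr (two_cell_avg F) n (cell_avg s1 g1) + (1 - \<theta>) * corr F n h1"
    using corr_Suc[OF Suc.prems(1)] by blast
  obtain s2 h2 where 2: "supp_cells s2 g2" "h2 \<in> reg" "(\<integral>x. h2 x \<partial>lborel) = (\<integral>x. g2 x \<partial>lborel)"
    "\<And>F b n. bdd_borel F b \<Longrightarrow>
       corr F (Suc n) g2 = \<theta> * corr (two_cell_avg F) n (cell_avg s2 g2) + (1 - \<theta>) * corr F n h2"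
    using corr_Suc[OF Suc.prems(2)] by blast
  let ?A = "\<lambda>n. corr (two_cell_avg F) n (cell_avg s1 g1) - corr (two_cell_avg F) n (cell_avg s2 g2)"
  have "(\<lambda>n. ?A n) \<longlonglongrightarrow> 0"
    using tendsto_diff[OF corr_two_cell_avg[OF F Suc.prems(1) 1(1)] corr_two_cell_avg[OF F Suc.prems(2) 2(1)]]
      Suc.prems by simp
  then have "\<forall>\<^sub>F n in sequentially. \<bar>?A n\<bar> < \<epsilon> / 2"
    using Suc.prems(5) tendstoD[of ?A 0 sequentially "\<epsilon> / 2"] by (simp add: dist_real_def)
  moreover have "\<forall>\<^sub>F n in sequentially. \<bar>corr F n h1 - corr F n h2\<bar> \<le> 2 * b * M * (1 - \<theta>) ^ m + \<epsilon> / 2"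
    by (rule Suc.IH) (use 1 2 Suc.prems in auto)
  ultimately have "\<forall>\<^sub>F n in sequentially. \<bar>corr F (Suc n) g1 - corr F (Suc n) g2\<bar> \<le> 2 * b * M * (1 - \<theta>) ^ Suc m + \<epsilon>"
  proof eventually_elim
    fix n assume A: "\<bar>?A n\<bar> < \<epsilon> / 2" and B: "\<bar>corr F n h1 - corr F n h2\<bar> \<le> 2 * b * M * (1 - \<theta>) ^ m + \<epsilon> / 2"
    have "corr F (Suc n) g1 - corr F (Suc n) g2 = \<theta> * ?A n + (1 - \<theta>) * (corr F n h1 - corr F n h2)"
      unfolding 1(4)[OF F] 2(4)[OF F] by (simp add: algebra_simps)
    then have "\<bar>corr F (Suc n) g1 - corr F (Suc n) g2\<bar> \<le> \<theta> * \<bar>?A n\<bar> + (1 - \<theta>) * \<bar>corr F n h1 - corr F n h2\<bar>"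
      using abs_triangle_ineq[of "\<theta> * ?A n" "(1 - \<theta>) * (corr F n h1 - corr F n h2)"] \<theta>_bounds
      by (simp add: abs_mult)
    also have "\<dots> \<le> 1 * (\<epsilon> / 2) + (1 - \<theta>) * (2 * b * M * (1 - \<theta>) ^ m + \<epsilon> / 2)"
      using A B \<theta>_bounds by (intro add_mono mult_mono) auto
    also have "\<dots> \<le> 2 * b * M * (1 - \<theta>) ^ Suc m + \<epsilon>"
      using \<theta>_bounds Suc.prems(5) by (simp add: algebra_simps)
    finally show "\<bar>corr F (Suc n) g1 - corr F (Suc n) g2\<bar> \<le> 2 * b * M * (1 - \<theta>) ^ Suc m + \<epsilon>" .
  qed
  then show ?case by (rule eventually_sequentially_Suc[THEN iffD1])
qed

text \<open>No limit of \<open>corr F n g\<close> is claimed; \<open>g\<close> is compared with its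
  mass times the unit density on cell \<open>0\<close>. In this form the property is linear in
  \<open>g\<close> and closed under \<open>L^1\<close> limits.\<close>

definition mixes :: "(real \<Rightarrow> real) \<Rightarrow> (real \<Rightarrow> real) \<Rightarrow> bool" where
  "mixes F g \<longleftrightarrow> integrable lborel g \<and>
     (\<lambda>n. corr F n g - (\<integral>x. g x \<partial>lborel) * corr F n (unit_cell 0)) \<longlonglongrightarrow> 0"

lemma reg_cmult: "g \<in> reg \<Longrightarrow> c \<ge> 0 \<Longrightarrow> (\<lambda>x. c * g x) \<in> reg"
proof -
  assume g: "g \<in> reg" and c: "c \<ge> 0"
  obtain s where "supp_cells s g" using regD(3)[OF g] by blast
  then have "supp_cells s (\<lambda>x. c * g x)" by (simp add: supp_cells_def)
  moreover have "log_lip K (\<lambda>x. c * g x)"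
    using regD(4)[OF g] c unfolding log_lip_def by (auto simp: mult.left_commute intro!: mult_left_mono)
  ultimately show ?thesis using regD(1,2)[OF g] c unfolding reg_def by auto
qed

lemma mixes_reg:
  assumes F: "bdd_borel F b" and g: "g \<in> reg" shows "mixes F g"
proof -
  let ?M = "\<integral>x. g x \<partial>lborel"
  have M: "?M \<ge> 0" using regD(2)[OF g] by simp
  have b: "b \<ge> 0" using bdd_borelD(2)[OF F, of 0] by linarith
  let ?g2 = "\<lambda>x. ?M * unit_cell 0 x"
  have g2: "?g2 \<in> reg" "(\<integral>x. ?g2 x \<partial>lborel) = ?M"
    using reg_cmult[OF unit_cell_reg M] unit_cell_integral by simp_all
  have "(\<lambda>n. corr F n g - corr F n ?g2) \<longlonglongrightarrow> 0"
  proof (rule LIMSEQ_I)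
    fix e :: real assume e: "e > 0"
    have "(\<lambda>m. 2 * b * ?M * (1 - \<theta>) ^ m) \<longlonglongrightarrow> 0"
      using \<theta>_bounds by (intro tendsto_mult_right_zero LIMSEQ_power_zero) auto
    then have "\<forall>\<^sub>F m in sequentially. \<bar>2 * b * ?M * (1 - \<theta>) ^ m\<bar> < e / 2"
      using e by (auto dest!: tendstoD[where e="e/2"] simp: dist_real_def)
    then obtain m where "\<bar>2 * b * ?M * (1 - \<theta>) ^ m\<bar> < e / 2"
      unfolding eventually_sequentially by blast
    then have m: "2 * b * ?M * (1 - \<theta>) ^ m < e / 2" by linarith
    have "\<forall>\<^sub>F n in sequentially. \<bar>corr F n g - corr F n ?g2\<bar> \<le> 2 * b * ?M * (1 - \<theta>) ^ m + e / 4"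
      by (rule corr_reg_diff[OF F g g2(1) refl g2(2)]) (use e in simp)
    then have "\<forall>\<^sub>F n in sequentially. norm (corr F n g - corr F n ?g2 - 0) < e"
      by eventually_elim (use m e in simp)
    then show "\<exists>no. \<forall>n\<ge>no. norm (corr F n g - corr F n ?g2 - 0) < e" by (simp add: eventually_sequentially)
  qed
  then show ?thesis using regD(1)[OF g] by (simp add: mixes_def corr_cmult)
qed

lemma mixes_cmult: "mixes F g \<Longrightarrow> mixes F (\<lambda>x. c * g x)"
proof -
  assume g: "mixes F g"
  then have "(\<lambda>n. c * (corr F n g - (\<integral>x. g x \<partial>lborel) * corr F n (unit_cell 0))) \<longlonglongrightarrow> 0"
    unfolding mixes_def by (intro tendsto_mult_right_zero) simp
  then show ?thesis using g by (simp add: mixes_def corr_cmult algebra_simps)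
qed

lemma mixes_diff:
  assumes F: "bdd_borel F b" and g: "mixes F g" and h: "mixes F h" shows "mixes F (\<lambda>x. g x - h x)"
proof -
  have i: "integrable lborel g" "integrable lborel h" using g h by (auto simp: mixes_def)
  have "(\<lambda>n. (corr F n g - (\<integral>x. g x \<partial>lborel) * corr F n (unit_cell 0)) - 
      (corr F n h - (\<integral>x. h x \<partial>lborel) * corr F n (unit_cell 0))) \<longlonglongrightarrow> 0"
    using tendsto_diff[of _ 0 sequentially _ 0] g h by (auto simp: mixes_def)
  then show ?thesis using i by (simp add: mixes_def corr_diff[OF F i] algebra_simps)
qed

lemma mixes_add:
  assumes F: "bdd_borel F b" and g: "mixes F g" and h: "mixes F h" shows "mixes F (\<lambda>x. g x + h x)"
  using mixes_diff[OF F g mixes_cmult[OF h, of "-1"]] by simp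

text \<open>Changing \<open>g\<close> by \<open>d\<close> alters the compared quantity by at most
  \<open>2 * b\<close> times the \<open>L^1\<close> norm of \<open>d\<close>, uniformly in
  \<open>n\<close>, so the limits may be interchanged.\<close>

lemma mixes_limit:
  assumes F: "bdd_borel F b" and g: "integrable lborel g"
    and s: "\<And>i. mixes F (s i)" and lim: "(\<lambda>i. \<integral>x. \<bar>s i x - g x\<bar> \<partial>lborel) \<longlonglongrightarrow> 0"
  shows "mixes F g"
proof -
  have b: "b \<ge> 0" using bdd_borelD(2)[OF F, of 0] by linarith
  have si: "integrable lborel (s i)" for i using s by (simp add: mixes_def)
  let ?E = "\<lambda>n g. corr F n g - (\<integral>x. g x \<partial>lborel) * corr F n (unit_cell 0)"
  have bnd: "\<bar>?E n g - ?E n (s i)\<bar> \<le> 2 * b * (\<integral>x. \<bar>s i x - g x\<bar> \<partial>lborel)" for n i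
  proof -
    let ?d = "\<lambda>x. s i x - g x"
    have d: "integrable lborel ?d" using si g by simp
    have "?E n g - ?E n (s i) = (\<integral>x. ?d x \<partial>lborel) * corr F n (unit_cell 0) - corr F n ?d"
      using si g by (simp add: corr_diff[OF F si g] algebra_simps)
    moreover have "\<bar>corr F n ?d\<bar> \<le> b * (\<integral>x. \<bar>?d x\<bar> \<partial>lborel)" by (rule corr_le[OF F d])
    moreover have "\<bar>(\<integral>x. ?d x \<partial>lborel) * corr F n (unit_cell 0)\<bar> \<le> (\<integral>x. \<bar>?d x\<bar> \<partial>lborel) * b"
      unfolding abs_mult using corr_le_reg[OF F unit_cell_reg, of n 0] unit_cell_integral[of 0]
      by (intro mult_mono integral_abs_bound) auto
    ultimately show ?thesis by (simp add: algebra_simps)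
  qed
  have "(\<lambda>n. ?E n g) \<longlonglongrightarrow> 0"
  proof (rule LIMSEQ_I)
    fix e :: real assume e: "e > 0"
    have "(\<lambda>i. 2 * b * (\<integral>x. \<bar>s i x - g x\<bar> \<partial>lborel)) \<longlonglongrightarrow> 0" by (rule tendsto_mult_right_zero[OF lim])
    from LIMSEQ_D[OF this, of "e/2"] e
    obtain i where "norm (2 * b * (\<integral>x. \<bar>s i x - g x\<bar> \<partial>lborel) - 0) < e / 2" by auto
    then have i: "2 * b * (\<integral>x. \<bar>s i x - g x\<bar> \<partial>lborel) < e / 2"
      unfolding real_norm_def by linarith
    have "(\<lambda>n. ?E n (s i)) \<longlonglongrightarrow> 0" using s by (simp add: mixes_def)
    then obtain N where N: "\<And>n. n \<ge> N \<Longrightarrow> \<bar>?E n (s i)\<bar> < e / 2"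
      using LIMSEQ_D[of "\<lambda>n. ?E n (s i)" 0 "e/2"] e by auto
    have "norm (?E n g - 0) < e" if "n \<ge> N" for n
      using N[OF that] bnd[of n i] i unfolding diff_zero real_norm_def by linarith
    then show "\<exists>N. \<forall>n\<ge>N. norm (?E n g - 0) < e" by blast
  qed
  then show ?thesis using g by (simp add: mixes_def)
qed

lemma mixes_dominated:
  assumes F: "bdd_borel F b" and s: "\<And>i. mixes F (s i)" and g[measurable]: "g \<in> borel_measurable borel"
    and w: "integrable lborel w" and dom: "\<And>i. AE x in lborel. \<bar>s i x\<bar> \<le> w x"
    and lim: "AE x in lborel. (\<lambda>i. s i x) \<longlonglongrightarrow> g x"
  shows "mixes F g"
proof -
  have si: "integrable lborel (s i)" for i using s by (simp add: mixes_def)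
  have [measurable]: "s i \<in> borel_measurable borel" for i using si by auto
  have ig: "integrable lborel g"
    by (rule integrable_dominated_convergence[of _ _ s w]) (use dom lim w in auto)
  have g_le: "AE x in lborel. \<bar>g x\<bar> \<le> w x"
  proof -
    have "AE x in lborel. \<forall>i. \<bar>s i x\<bar> \<le> w x" using dom by (simp add: AE_all_countable)
    then show ?thesis using lim
    proof eventually_elim
      fix x assume "\<forall>i. \<bar>s i x\<bar> \<le> w x" and l: "(\<lambda>i. s i x) \<longlonglongrightarrow> g x"
      then show "\<bar>g x\<bar> \<le> w x" by (intro LIMSEQ_le_const2[OF tendsto_rabs[OF l]]) auto
    qed
  qed
  have "(\<lambda>i. \<integral>x. \<bar>s i x - g x\<bar> \<partial>lborel) \<longlonglongrightarrow> (\<integral>x. 0 \<partial>(lborel :: real measure))"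
  proof (rule integral_dominated_convergence[where w="\<lambda>x. 2 * w x" and s="\<lambda>i x. \<bar>s i x - g x\<bar>"])
    show "AE x in lborel. (\<lambda>i. \<bar>s i x - g x\<bar>) \<longlonglongrightarrow> 0"
      using lim
    proof eventually_elim
      fix x assume "(\<lambda>i. s i x) \<longlonglongrightarrow> g x"
      then show "(\<lambda>i. \<bar>s i x - g x\<bar>) \<longlonglongrightarrow> 0"
        by (intro tendsto_rabs_zero) (simp add: LIM_zero)
    qed
    show "AE x in lborel. norm \<bar>s i x - g x\<bar> \<le> 2 * w x" for i
      using dom[of i] g_le by eventually_elim simp
  qed (use w in auto)
  then show ?thesis using mixes_limit[OF F ig s] by simp
qed

section \<open>Passage from regular densities to all of \<open>L^1\<close>\<close>

definition window :: "nat \<Rightarrow> real set" where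
  "window s = (\<Union>l\<in>{-int s..int s}. open_cell l)"

lemma window_measurable[measurable, simp]: "window s \<in> sets borel"
  unfolding window_def by (intro sets.finite_UN) auto

lemma window_open_cell: "x \<in> open_cell j \<Longrightarrow> x \<in> window s \<longleftrightarrow> j \<in> {-int s..int s}"
  unfolding window_def using open_cell_disjoint by blast

lemma integrable_window: "integrable lborel (indicator (window s) :: real \<Rightarrow> real)"
proof -
  have "emeasure lborel (window s) \<le> (\<Sum>l\<in>{-int s..int s}. emeasure lborel (open_cell l))"
    unfolding window_def by (intro emeasure_subadditive_finite) auto
  also have "\<dots> < \<infinity>" by (simp add: emeasure_open_cell ennreal_mult_less_top of_nat_less_top)
  finally show ?thesis by simp
qed

text \<open>A Lipschitz function bounded away from zero is log-Lipschitz: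
  \<open>f x \<le> f y + L t \<le> (1 + K t) f y\<close> as soon as
  \<open>f y \<ge> L / K\<close>.\<close>

lemma lipschitz_reg:
  assumes lip: "\<And>x y. \<bar>f x - f y\<bar> \<le> L * \<bar>x - y\<bar>" and L: "L \<ge> 0"
    and lower: "\<And>x. L / K \<le> f x" and upper: "\<And>x. f x \<le> M"
  shows "(\<lambda>x. f x * indicator (window s) x) \<in> reg"
proof -
  have "L-lipschitz_on UNIV f" using lip L by (simp add: lipschitz_on_def dist_real_def)
  then have "continuous_on UNIV f" by (rule lipschitz_on_continuous_on)
  then have [measurable]: "f \<in> borel_measurable borel" by (rule borel_measurable_continuous_onI)
  have nn: "0 \<le> f x" for x using lower[of x] L K_pos by (meson divide_nonneg_pos order_trans)
  have "integrable lborel (\<lambda>x. f x * indicator (window s) x)"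
    using nn upper by (intro integrable_bdd_mult[where b=M] integrable_window) auto
  moreover have "supp_cells s (\<lambda>x. f x * indicator (window s) x)"
    by (auto simp: supp_cells_def window_def indicator_def split: if_splits)
  moreover have "log_lip K (\<lambda>x. f x * indicator (window s) x)"
    unfolding log_lip_def
  proof (intro allI ballI)
    fix j x y assume x: "x \<in> open_cell j" and y: "y \<in> open_cell j"
    have "L * \<bar>x - y\<bar> \<le> (K * f y) * \<bar>x - y\<bar>"
      using lower[of y] K_pos by (intro mult_right_mono) (auto simp: field_simps)
    then have "f x \<le> (1 + K * \<bar>x - y\<bar>) * f y" using lip[of x y] by (simp add: algebra_simps)
    also have "\<dots> \<le> exp (K * \<bar>x - y\<bar>) * f y" using nn by (intro mult_right_mono exp_ge_add_one_self)
    finally show "f x * indicator (window s) x \<le> exp (K * \<bar>x - y\<bar>) * (f y * indicator (window s) y)"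
      using window_open_cell[OF x, of s] window_open_cell[OF y, of s] by (simp add: indicator_def)
  qed
  ultimately show ?thesis using nn unfolding reg_def by auto
qed

text \<open>Adding the constant \<open>M + L / K\<close> brings \<open>f\<close> into the regular
  class on the window, where the constant itself is regular, so linearity removes it again.\<close>

lemma mixes_lipschitz:
  assumes F: "bdd_borel F b" and lip: "\<And>x y. \<bar>f x - f y\<bar> \<le> L * \<bar>x - y\<bar>" and L: "L \<ge> 0"
    and bound: "\<And>x. \<bar>f x\<bar> \<le> M"
  shows "mixes F (\<lambda>x. f x * indicator (window s) x)"
proof -
  let ?M = "M + L / K"
  have lower: "L / K \<le> f x + ?M" and upper: "f x + ?M \<le> 2 * M + L / K" for x
    using bound[of x] by linarith+
  have "M \<ge> 0" using bound[of 0] by linarith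
  have "mixes F (\<lambda>x. (f x + ?M) * indicator (window s) x)"
    by (rule mixes_reg[OF F lipschitz_reg[OF _ L lower upper]]) (use lip in simp)
  moreover have "mixes F (\<lambda>x. ?M * indicator (window s) x)"
    by (rule mixes_reg[OF F lipschitz_reg[of "\<lambda>_. ?M" L ?M]]) (use L K_pos \<open>M \<ge> 0\<close> in auto)
  ultimately have "mixes F (\<lambda>x. (f x + ?M) * indicator (window s) x - ?M * indicator (window s) x)"
    by (rule mixes_diff[OF F])
  then show ?thesis by (simp add: algebra_simps)
qed

text \<open>Dynkin argument over half-lines. The window keeps everything integrable, so that
  complements can be taken inside it.\<close>

lemma mixes_indicator_window:
  assumes F: "bdd_borel F b" and A: "A \<in> sets borel"
  shows "mixes F (indicator (A \<inter> window s))"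
proof -
  have W: "mixes F (indicator (window s))"
    using mixes_lipschitz[OF F, of "\<lambda>_. 1" 0 1 s] by simp
  have A': "A \<in> sigma_sets UNIV (range atMost)"
    using A unfolding borel_eq_atMost by (simp add: sets_measure_of)
  have "Int_stable (range atMost :: real set set)"
  proof (rule Int_stableI_image)
    show "\<exists>k\<in>UNIV. {..i} \<inter> {..j} = {..k}" for i j :: real by (intro bexI[of _ "min i j"]) auto
  qed
  moreover have "range (atMost :: real \<Rightarrow> _) \<subseteq> Pow UNIV" by simp
  ultimately show ?thesis using A'
  proof (induction A rule: sigma_sets_induct_disjoint)
    case (basic A)
    then obtain c where A: "A = {..c}" by auto
    \<comment> \<open>For positive \<open>N\<close> a ramp of slope \<open>-N\<close> from
      \<open>1\<close> at \<open>c\<close> to \<open>0\<close> at \<open>c + 1 / N\<close>; it is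
      Lipschitz and tends to the indicator of the half-line.\<close>
    define f where "f N x = max 0 (min 1 (1 - real N * (x - c)))" for N x
    show ?case
    proof (rule mixes_dominated[OF F _ _ integrable_window])
      show "mixes F (\<lambda>x. f N x * indicator (window s) x)" for N
      proof (rule mixes_lipschitz[OF F, of "f N" "real N" 1])
        fix x y
        have "\<bar>f N x - f N y\<bar> \<le> \<bar>(1 - real N * (x - c)) - (1 - real N * (y - c))\<bar>"
          by (auto simp: f_def max_def min_def)
        also have "(1 - real N * (x - c)) - (1 - real N * (y - c)) = - (real N * (x - y))"
          by (simp add: algebra_simps)
        also have "\<bar>- (real N * (x - y))\<bar> = real N * \<bar>x - y\<bar>" by (simp add: abs_mult)
        finally show "\<bar>f N x - f N y\<bar> \<le> real N * \<bar>x - y\<bar>" .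
      qed (auto simp: f_def)
      have "(\<lambda>N. f N x) \<longlonglongrightarrow> indicator {..c} x" for x
      proof (cases "x \<le> c")
        case True
        then have "f N x = 1" for N by (simp add: f_def mult_nonneg_nonpos)
        then show ?thesis using True by simp
      next
        case False
        obtain N0 where N0: "1 / (x - c) < real N0" using reals_Archimedean2 by blast
        have "f N x = 0" if "N \<ge> N0" for N
        proof -
          have "1 / (x - c) < real N" using that N0 by simp
          then show ?thesis using False by (simp add: f_def field_simps)
        qed
        then have "\<forall>\<^sub>F N in sequentially. f N x = 0" by (auto simp: eventually_sequentially)
        then show ?thesis using False by (simp add: tendsto_eventually)
      qed
      then have "(\<lambda>N. f N x * indicator (window s) x) \<longlonglongrightarrow> indicator {..c} x * indicator (window s) x" for x
        by (intro tendsto_intros)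
      then show "AE x in lborel. (\<lambda>N. f N x * indicator (window s) x) \<longlonglongrightarrow> indicator (A \<inter> window s) x"
        by (simp add: A indicator_inter_arith)
    qed (auto simp: A f_def indicator_def)
  next
    case empty
    show ?case using mixes_diff[OF F W W] by simp
  next
    case (compl A)
    have "(\<lambda>x. indicator (window s) x - indicator (A \<inter> window s) x :: real) = indicator ((UNIV - A) \<inter> window s)"
      by (auto simp: fun_eq_iff indicator_def)
    then show ?case using mixes_diff[OF F W compl(2)] by simp
  next
    case (union A)
    have meas: "A i \<in> sets borel" for i
      using union(2) unfolding borel_eq_atMost by auto
    let ?s = "\<lambda>n x. indicator ((\<Union>i<n. A i) \<inter> window s) x :: real"
    show ?case
    proof (rule mixes_dominated[OF F _ _ integrable_window, of ?s])
      show "mixes F (?s n)" for n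
      proof (induction n)
        case 0
        show ?case using mixes_diff[OF F W W] by simp
      next
        case (Suc n)
        have e: "(\<lambda>x. ?s n x + indicator (A n \<inter> window s) x) = ?s (Suc n)"
        proof
          fix x
          have "x \<notin> (\<Union>i<n. A i)" if "x \<in> A n"
          proof
            assume "x \<in> (\<Union>i<n. A i)"
            then obtain i where "i < n" "x \<in> A i" by blast
            then show False using disjoint_family_onD[OF union(1), of i n] that by auto
          qed
          moreover have "(\<Union>i<Suc n. A i) = A n \<union> (\<Union>i<n. A i)" by (simp add: lessThan_Suc)
          ultimately show "?s n x + indicator (A n \<inter> window s) x = ?s (Suc n) x"
            by (cases "x \<in> A n") (simp_all add: indicator_def)
        qed
        show ?case using mixes_add[OF F Suc union(3)[of n]] unfolding e .
      qed
      show "indicator ((\<Union> (range A)) \<inter> window s) \<in> borel_measurable borel" using meas by auto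
      show "AE x in lborel. (\<lambda>n. ?s n x) \<longlonglongrightarrow> indicator ((\<Union> (range A)) \<inter> window s) x"
      proof (rule AE_I2)
        fix x
        show "(\<lambda>n. ?s n x) \<longlonglongrightarrow> indicator ((\<Union> (range A)) \<inter> window s) x"
        proof (cases "x \<in> (\<Union> (range A)) \<inter> window s")
          case True
          then obtain m where "x \<in> A m" by auto
          then have "?s n x = 1" if "n \<ge> Suc m" for n using that True by (auto simp: indicator_def)
          then have "\<forall>\<^sub>F n in sequentially. ?s n x = 1" by (auto simp: eventually_sequentially)
          then show ?thesis using True by (simp add: tendsto_eventually)
        next
          case False
          then have "?s n x = 0" for n by (auto simp: indicator_def)
          then show ?thesis using False by simp
        qed
      qed
    qed (auto simp: indicator_def)
  qed
qed

text \<open>Indicators of sets of finite measure are limits of their restrictions to windows; sums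
  and dominated limits then reach all integrable functions.\<close>

lemma mixes_all:
  assumes F: "bdd_borel F b" and g: "integrable lborel g" shows "mixes F g"
  using g
proof (induction g rule: integrable_induct)
  case (base A c)
  then have A: "A \<in> sets borel" by simp
  have "mixes F (indicator A)"
  proof (rule mixes_dominated[OF F, of "\<lambda>s. indicator (A \<inter> window s)" _ "indicator A"])
    show "mixes F (indicator (A \<inter> window s))" for s using mixes_indicator_window[OF F A] .
    show "AE x in lborel. (\<lambda>s. indicator (A \<inter> window s) x) \<longlonglongrightarrow> (indicator A x :: real)"
      using AE_open_cell
    proof eventually_elim
      fix x assume x: "x \<in> open_cell \<lfloor>x / a\<rfloor>"
      have "x \<in> window s" if "s \<ge> nat \<bar>\<lfloor>x / a\<rfloor>\<bar>" for s using window_open_cell[OF x, of s] that by auto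
      then have "\<forall>\<^sub>F s in sequentially. indicator (A \<inter> window s) x = (indicator A x :: real)"
        unfolding eventually_sequentially by (auto simp: indicator_def intro!: exI[of _ "nat \<bar>\<lfloor>x / a\<rfloor>\<bar>"])
      then show "(\<lambda>s. indicator (A \<inter> window s) x) \<longlonglongrightarrow> (indicator A x :: real)" by (rule tendsto_eventually)
    qed
    show "integrable lborel (indicator A :: real \<Rightarrow> real)" using base by simp
  qed (use A in \<open>auto simp: indicator_def\<close>)
  from mixes_cmult[OF this, of c] show ?case by (simp add: mult.commute)
next
  case (add f g)
  then show ?case using mixes_add[OF F] by blast
next
  case (lim f s)
  show ?case
    by (rule mixes_dominated[OF F, of s _ "\<lambda>x. 2 * \<bar>f x\<bar>"]) (use lim in auto)
qed

end

section \<open>The invariant measure\<close>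

locale quasi_lift_measure = expanding_cell +
  fixes T :: "real \<Rightarrow> real" and \<mu>\<^sub>a \<mu> :: "real measure"
  assumes quasi_lift: "quasi_lift a \<tau> T"
    and circle_inv: "circle_invariant_measure a T \<mu>\<^sub>a"
    and extension: "shift_invariant_extension a \<mu>\<^sub>a \<mu>"
begin

lemma sets_\<mu>[measurable_cong, simp]: "sets \<mu> = sets borel"
  using extension by (simp add: shift_invariant_extension_def)

lemma space_\<mu>[simp]: "space \<mu> = UNIV"
  using sets_eq_imp_space_eq[OF sets_\<mu>] by simp

lemma restrict_\<mu>: "restrict_space \<mu> {0..<a} = \<mu>\<^sub>a"
  using extension by (simp add: shift_invariant_extension_def)

lemma measurable_translate[measurable]: "(\<lambda>x. x + t) \<in> measurable \<mu> \<mu>" for t :: real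
  by (simp add: measurable_cong_sets[OF sets_\<mu> sets_\<mu>])

lemma distr_translate: "distr \<mu> \<mu> (\<lambda>x. x + a * of_int j) = \<mu>"
proof -
  have 1: "distr \<mu> \<mu> (\<lambda>x. x + a) = \<mu>"
    using extension by (simp add: shift_invariant_extension_def invariant_measure_def shift_def[abs_def])
  have nat: "distr \<mu> \<mu> (\<lambda>x. x + a * real n) = \<mu>" for n
  proof (induction n)
    case 0
    show ?case using distr_id[of \<mu>] by (simp add: id_def)
  next
    case (Suc n)
    have "distr \<mu> \<mu> (\<lambda>x. x + a * real (Suc n)) = distr (distr \<mu> \<mu> (\<lambda>x. x + a)) \<mu> (\<lambda>x. x + a * real n)"
      by (subst distr_distr) (auto simp: o_def algebra_simps)
    then show ?case using 1 Suc by simp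
  qed
  show ?thesis
  proof (cases "j \<ge> 0")
    case True
    then show ?thesis using nat[of "nat j"] by simp
  next
    case False
    then have j: "real_of_int j = - real (nat (- j))" by simp
    have "distr \<mu> \<mu> (\<lambda>x. x + a * of_int j) = distr (distr \<mu> \<mu> (\<lambda>x. x + a * real (nat (- j)))) \<mu> (\<lambda>x. x + a * of_int j)"
      by (simp only: nat)
    also have "\<dots> = distr \<mu> \<mu> (\<lambda>x. x)"
      by (subst distr_distr) (auto simp: o_def j)
    also have "\<dots> = \<mu>" using distr_id[of \<mu>] by (simp add: id_def)
    finally show ?thesis .
  qed
qed

lemma integral_translate:
  fixes f :: "real \<Rightarrow> complex"
  assumes "f \<in> borel_measurable borel"
  shows "(\<integral>x. f (x + a * of_int j) \<partial>\<mu>) = (\<integral>x. f x \<partial>\<mu>)"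
  using integral_distr[OF measurable_translate, of f "a * of_int j"] assms
  by (simp add: distr_translate measurable_cong_sets[OF sets_\<mu> refl])

lemma emeasure_translate:
  assumes [measurable]: "A \<in> sets borel"
  shows "emeasure \<mu> {x. x + a * of_int j \<in> A} = emeasure \<mu> A"
  using emeasure_distr[OF measurable_translate, of A "a * of_int j"]
  by (simp add: distr_translate vimage_def)

text \<open>Half-open cells partition the line exactly and match the fundamental domain that carries
  \<open>\<mu>\<^sub>a\<close>.\<close>

definition hcell :: "int \<Rightarrow> real set" where
  "hcell j = {a * of_int j ..< a * (of_int j + 1)}"

lemma hcell_measurable[measurable, simp]: "hcell j \<in> sets borel" by (simp add: hcell_def)

lemma hcell_0: "hcell 0 = {0..<a}" by (simp add: hcell_def)

lemma mem_hcell: "x \<in> hcell j \<longleftrightarrow> x - a * of_int j \<in> hcell 0"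
  by (auto simp: hcell_def algebra_simps)

lemma UN_hcell: "(\<Union>j. hcell j) = UNIV"
proof -
  have "x \<in> hcell \<lfloor>x / a\<rfloor>" for x using pos_mem[of x] by (simp add: mem_hcell[of x] hcell_0)
  then show ?thesis by blast
qed

lemma null_hcell0:
  assumes [measurable]: "N \<in> sets borel" and sub: "N \<subseteq> hcell 0"
  shows "emeasure \<mu> N = 0 \<longleftrightarrow> emeasure lborel N = 0"
proof -
  have ac: "absolutely_continuous \<mu>\<^sub>a (restrict_space lborel {0..<a})"
    "absolutely_continuous (restrict_space lborel {0..<a}) \<mu>\<^sub>a"
    using circle_inv by (auto simp: circle_invariant_measure_def equivalent_measures_def)
  have e1: "emeasure \<mu>\<^sub>a N = emeasure \<mu> N"
    unfolding restrict_\<mu>[symmetric] using sub by (intro emeasure_restrict_space) (auto simp: hcell_0)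
  have e2: "emeasure (restrict_space lborel {0..<a}) N = emeasure lborel N"
    using sub by (intro emeasure_restrict_space) (auto simp: hcell_0)
  have m: "N \<in> sets \<mu>\<^sub>a" "N \<in> sets (restrict_space lborel {0..<a})"
    using sub unfolding restrict_\<mu>[symmetric] by (auto simp: sets_restrict_space hcell_0 image_iff intro!: bexI[of _ N])
  have "N \<in> null_sets \<mu>\<^sub>a \<longleftrightarrow> N \<in> null_sets (restrict_space lborel {0..<a})"
    using ac unfolding absolutely_continuous_def by blast
  then show ?thesis using m e1 e2 by (simp add: null_sets_def)
qed

text \<open>Both measures are invariant under translations by \<open>a \<int>\<close>, so the
  equivalence assumed on one cell spreads to the countably many others.\<close>

lemma null_sets_\<mu>: "null_sets \<mu> = null_sets lborel"
proof -
  have "emeasure \<mu> N = 0 \<longleftrightarrow> emeasure lborel N = 0" if N[measurable]: "N \<in> sets borel" for N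
  proof -
    let ?P = "\<lambda>j. {x. x + a * of_int j \<in> N \<inter> hcell j}"
    have U: "N = (\<Union>j. N \<inter> hcell j)" using UN_hcell by blast
    have meas: "N \<inter> hcell j \<in> sets borel" "?P j \<in> sets borel" for j
      by simp_all measurable
    have sub: "?P j \<subseteq> hcell 0" for j by (auto simp: hcell_def algebra_simps)
    have 1: "emeasure \<mu> (N \<inter> hcell j) = 0 \<longleftrightarrow> emeasure lborel (N \<inter> hcell j) = 0" for j
    proof -
      have "emeasure \<mu> (N \<inter> hcell j) = emeasure \<mu> (?P j)" using emeasure_translate[OF meas(1)] by simp
      moreover have "emeasure lborel (N \<inter> hcell j) = emeasure lborel (?P j)"
      proof -
        have "emeasure lborel (N \<inter> hcell j) = emeasure (distr lborel borel ((+) (a * of_int j))) (N \<inter> hcell j)"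
          by (simp add: lborel_distr_plus)
        also have "\<dots> = emeasure lborel (?P j)"
          by (subst emeasure_distr) (simp_all add: vimage_def add.commute)
        finally show ?thesis .
      qed
      ultimately show ?thesis using null_hcell0[OF meas(2) sub] by simp
    qed
    have un: "emeasure M N = 0 \<longleftrightarrow> (\<forall>j. emeasure M (N \<inter> hcell j) = 0)" if "sets M = sets borel" for M :: "real measure"
    proof
      assume "emeasure M N = 0"
      then show "\<forall>j. emeasure M (N \<inter> hcell j) = 0"
        using emeasure_mono[of "N \<inter> hcell _" N M] that N by (metis inf_le1 le_zero_eq)
    next
      assume "\<forall>j. emeasure M (N \<inter> hcell j) = 0"
      then have "N \<inter> hcell j \<in> null_sets M" for j using that by (auto simp: null_sets_def)
      then have "(\<Union>j. N \<inter> hcell j) \<in> null_sets M" by (rule null_sets_UN)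
      then show "emeasure M N = 0" using U by (auto simp: null_sets_def)
    qed
    show ?thesis using un[OF sets_\<mu>] un[of lborel] 1 by simp
  qed
  then show ?thesis by (auto simp: null_sets_def)
qed

lemma AE_\<mu>: "(AE x in \<mu>. P x) \<longleftrightarrow> (AE x in lborel. P x)"
  unfolding eventually_ae_filter null_sets_\<mu> by simp

lemma AE_translate:
  assumes "AE x in \<mu>. P x" shows "AE x in \<mu>. P (x + a * of_int j)"
proof -
  have "AE x in distr \<mu> \<mu> (\<lambda>x. x + a * of_int j). P x" using assms by (subst distr_translate)
  then show ?thesis by (rule AE_distrD[OF measurable_translate])
qed

text \<open>Nonsingularity of the dynamics: by substitution along each branch, the part of the
  preimage of a null set within a cell has integral zero.\<close>

lemma AE_lift:
  assumes "AE x in \<mu>. P x" shows "AE x in \<mu>. P (lift x)"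
proof -
  obtain N where N: "N \<in> null_sets lborel" "{x. \<not> P x} \<subseteq> N"
    using assms unfolding eventually_ae_filter null_sets_\<mu> by auto
  have [measurable]: "N \<in> sets borel" using N by auto
  have F: "bdd_borel (indicator N) 1" by (auto simp: bdd_borel_def indicator_def)
  have one: "AE x in lborel. \<not> (x \<in> open_cell l \<and> lift x \<in> N)" for l
  proof -
    let ?f = "\<lambda>x. indicator (open_cell l) x * (indicator N (lift x) * indicator (open_cell l) x) :: real"
    have i: "integrable lborel ?f"
      by (rule int_cell) (use bdd_borel_integrable[OF bdd_borel_lift[OF F, of 1] integrable_indicator_open_cell] in simp)
    have "(\<integral>x. ?f x \<partial>lborel) = (\<integral>z. indicator N z * (weight (z - a * of_int l) * indicator (open_cell l) (\<psi> (z - a * of_int l) + a * of_int l)) \<partial>lborel)"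
      by (rule branch_change(2)[OF F integrable_indicator_open_cell, symmetric])
    also have "\<dots> = 0"
    proof (rule integral_eq_zero_AE)
      have "AE z in lborel. z \<notin> N" using N(1) by (rule AE_not_in)
      then show "AE z in lborel. indicator N z * (weight (z - a * of_int l) * indicator (open_cell l) (\<psi> (z - a * of_int l) + a * of_int l)) = 0"
        by eventually_elim simp
    qed
    finally have "AE x in lborel. ?f x = 0"
      by (subst (asm) integral_nonneg_eq_0_iff_AE[OF i]) auto
    then show ?thesis by eventually_elim (auto simp: indicator_def split: if_splits)
  qed
  have "AE x in lborel. \<forall>l. \<not> (x \<in> open_cell l \<and> lift x \<in> N)"
    unfolding AE_all_countable using one by blast
  then show ?thesis unfolding AE_\<mu> using AE_open_cell
    by eventually_elim (use N(2) in blast)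
qed

lemma AE_lift_pow: "AE x in \<mu>. P x \<Longrightarrow> AE x in \<mu>. P ((lift ^^ n) x)"
proof (induction n)
  case (Suc n)
  show ?case using AE_lift[OF Suc.IH[OF Suc.prems]] by (simp add: funpow_swap1)
qed simp

lemma T_open_cell: "x \<in> open_cell j \<Longrightarrow> T x = lift x"
proof -
  assume x: "x \<in> open_cell j"
  then have "x \<in> interior (cell a j)" by (simp add: cell_def open_cell_def)
  then show ?thesis using quasi_lift x by (simp add: quasi_lift_def lift_open_cell)
qed

text \<open>\<open>T\<close> and \<open>lift\<close> agree off the null set \<open>a \<int>\<close>;
  nonsingularity ensures that almost every orbit meets no point of disagreement at any time.\<close>

lemma T_pow_AE: "AE x in \<mu>. \<forall>n. (T ^^ n) x = (lift ^^ n) x"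
proof -
  have T: "AE x in \<mu>. T x = lift x"
    using AE_open_cell unfolding AE_\<mu> by eventually_elim (rule T_open_cell)
  have "AE x in \<mu>. \<forall>n. T ((lift ^^ n) x) = lift ((lift ^^ n) x)"
    unfolding AE_all_countable using AE_lift_pow[OF T] by blast
  then show ?thesis
  proof eventually_elim
    fix x assume *: "\<forall>n. T ((lift ^^ n) x) = lift ((lift ^^ n) x)"
    have "(T ^^ n) x = (lift ^^ n) x" for n by (induction n) (use * in auto)
    then show "\<forall>n. (T ^^ n) x = (lift ^^ n) x" by blast
  qed
qed

lemma T_measurable[measurable]: "T \<in> borel_measurable borel"
proof (rule measurable_discrete_difference[where X="range (\<lambda>j::int. a * of_int j)"])
  show "lift \<in> borel_measurable borel" by simp
  show "countable (range (\<lambda>j::int. a * of_int j))" by simp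
  fix x assume "x \<notin> range (\<lambda>j::int. a * of_int j)"
  then have "x \<noteq> a * of_int \<lfloor>x / a\<rfloor>" by (metis rangeI)
  then have "x \<in> open_cell \<lfloor>x / a\<rfloor>" using pos_mem[of x] by (auto simp: mem_open_cell_shift)
  then show "lift x = T x" by (simp add: T_open_cell)
qed auto

lemma T_pow_measurable[measurable]: "(T ^^ n) \<in> borel_measurable borel"
  by (induction n) (auto intro: measurable_comp[OF _ T_measurable])

lemma emeasure_hcell0: "emeasure \<mu> (hcell 0) < \<infinity>"
proof -
  have "emeasure \<mu> (hcell 0) = emeasure \<mu>\<^sub>a (space \<mu>\<^sub>a)"
    unfolding restrict_\<mu>[symmetric]
    by (subst emeasure_restrict_space) (auto simp: hcell_0 space_restrict_space)
  also have "\<dots> < \<infinity>"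
  proof -
    interpret finite_measure \<mu>\<^sub>a using circle_inv by (simp add: circle_invariant_measure_def)
    show ?thesis using emeasure_finite[of "space \<mu>\<^sub>a"] by (metis infinity_ennreal_def top.not_eq_extremum)
  qed
  finally show ?thesis .
qed

lemma emeasure_hcell: "emeasure \<mu> (hcell j) = emeasure \<mu> (hcell 0)"
proof -
  have "{x. x + a * of_int j \<in> hcell j} = hcell 0" by (auto simp: mem_hcell[of _ j])
  then show ?thesis using emeasure_translate[OF hcell_measurable[of j], of j] by simp
qed

text \<open>Radon-Nikodym; sigma-finiteness comes from the cells, which have equal finite mass. The
  density serves to turn \<open>\<mu>\<close>-integrable functions into Lebesgue-integrable
  ones.\<close>

lemma density_exists:
  obtains h where "h \<in> borel_measurable borel" "\<And>x. 0 \<le> h x" "\<mu> = density lborel (\<lambda>x. ennreal (h x))"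
proof -
  have sf: "sigma_finite_measure \<mu>"
  proof
    have "countable (range hcell)" "range hcell \<subseteq> sets \<mu>" "\<Union> (range hcell) = space \<mu>"
      using UN_hcell by auto
    moreover have "\<forall>A\<in>range hcell. emeasure \<mu> A \<noteq> \<infinity>"
    proof
      fix A assume "A \<in> range hcell"
      then obtain j where "A = hcell j" by blast
      then show "emeasure \<mu> A \<noteq> \<infinity>" using emeasure_hcell0 emeasure_hcell[of j] by (metis less_irrefl)
    qed
    ultimately show "\<exists>A. countable A \<and> A \<subseteq> sets \<mu> \<and> \<Union> A = space \<mu> \<and> (\<forall>a\<in>A. emeasure \<mu> a \<noteq> \<infinity>)"
      by blast
  qed
  have ac: "absolutely_continuous lborel \<mu>" by (simp add: absolutely_continuous_def null_sets_\<mu>)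
  have fin: "AE x in lborel. RN_deriv lborel \<mu> x \<noteq> \<infinity>"
    by (rule sigma_finite_measure.RN_deriv_finite[OF lborel.sigma_finite_measure_axioms sf ac]) simp
  have "density lborel (\<lambda>x. ennreal (enn2real (RN_deriv lborel \<mu> x))) = density lborel (RN_deriv lborel \<mu>)"
    by (rule density_cong) (use fin in \<open>auto simp: less_top\<close>)
  also have "\<dots> = \<mu>" by (rule sigma_finite_measure.density_RN_deriv[OF lborel.sigma_finite_measure_axioms ac]) simp
  finally show thesis using that[of "\<lambda>x. enn2real (RN_deriv lborel \<mu> x)"] by simp
qed

section \<open>Essentially bounded observables and their correlations\<close>

lemma LinfD:
  assumes "F \<in> Linf \<mu>"
  shows "F \<in> borel_measurable borel" and "\<exists>M>0. AE x in \<mu>. norm (F x) \<le> M"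
proof -
  show F: "F \<in> borel_measurable borel" using assms by (auto simp: Linf_def)
  obtain e where e: "Linf_norm \<mu> F = ennreal e" "e \<ge> 0" using assms by (cases "Linf_norm \<mu> F") (auto simp: Linf_def)
  have "AE x in \<mu>. ennreal (norm (F x)) \<le> ennreal e"
    using esssup_AE[of "\<lambda>x. ennreal (norm (F x))" \<mu>] e by (simp add: Linf_norm_def)
  \<comment> \<open>The added \<open>1\<close> makes the bound strictly positive.\<close>
  then have "AE x in \<mu>. norm (F x) \<le> e + 1" by eventually_elim (use e in simp)
  then show "\<exists>M>0. AE x in \<mu>. norm (F x) \<le> M" using e by (intro exI[of _ "e + 1"]) auto
qed

lemma LinfI:
  assumes "F \<in> borel_measurable borel" "AE x in \<mu>. norm (F x) \<le> M" shows "F \<in> Linf \<mu>"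
proof -
  have "Linf_norm \<mu> F \<le> ennreal M"
    unfolding Linf_norm_def using assms by (intro esssup_I) (auto simp: measurable_cong_sets[OF sets_\<mu> refl] intro: ennreal_leI)
  then show ?thesis using assms by (auto simp: Linf_def measurable_cong_sets[OF sets_\<mu> refl] intro: le_less_trans)
qed

lemma Linf_norm_AE:
  assumes "Linf_norm \<mu> F \<le> ennreal e" "e \<ge> 0" shows "AE x in \<mu>. norm (F x) \<le> e"
proof -
  have "AE x in \<mu>. ennreal (norm (F x)) \<le> ennreal e"
    using esssup_AE[of "\<lambda>x. ennreal (norm (F x))" \<mu>] assms(1) unfolding Linf_norm_def
    by (auto elim!: eventually_mono)
  then show ?thesis using assms(2) by simp
qed

lemma Linf_mult_integrable:
  assumes F: "F \<in> Linf \<mu>" and g: "integrable \<mu> g" shows "integrable \<mu> (\<lambda>x. F x * g x)"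
proof -
  obtain M where M: "M > 0" "AE x in \<mu>. norm (F x) \<le> M" using LinfD(2)[OF F] by blast
  note [measurable] = LinfD(1)[OF F]
  show ?thesis
  proof (rule Bochner_Integration.integrable_bound)
    show "integrable \<mu> (\<lambda>x. M * norm (g x))" using g by auto
    show "(\<lambda>x. F x * g x) \<in> borel_measurable \<mu>"
      using borel_measurable_integrable[OF g] by measurable
    show "AE x in \<mu>. norm (F x * g x) \<le> norm (M * norm (g x))"
      using M(2) by eventually_elim (use M(1) in \<open>auto simp: norm_mult abs_mult intro!: mult_right_mono\<close>)
  qed
qed

lemma Linf_lift:
  assumes F: "F \<in> Linf \<mu>" shows "(\<lambda>x. F ((lift ^^ n) x)) \<in> Linf \<mu>"
proof -
  obtain M where M: "AE x in \<mu>. norm (F x) \<le> M" using LinfD(2)[OF F] by blast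
  note [measurable] = LinfD(1)[OF F]
  show ?thesis by (rule LinfI[OF _ AE_lift_pow[OF M]]) measurable
qed

lemma Linf_T:
  assumes F: "F \<in> Linf \<mu>" shows "(\<lambda>x. F ((T ^^ n) x)) \<in> Linf \<mu>"
proof -
  obtain M where M: "AE x in \<mu>. norm (F x) \<le> M" using LinfD(2)[OF F] by blast
  note [measurable] = LinfD(1)[OF F]
  show ?thesis
  proof (rule LinfI)
    show "AE x in \<mu>. norm (F ((T ^^ n) x)) \<le> M" using AE_lift_pow[OF M, of n] T_pow_AE by eventually_elim simp
  qed measurable
qed

definition mu_corr :: "(real \<Rightarrow> complex) \<Rightarrow> nat \<Rightarrow> (real \<Rightarrow> complex) \<Rightarrow> complex" where
  "mu_corr F n g = (\<integral>x. F ((T ^^ n) x) * g x \<partial>\<mu>)"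

lemma mu_corr_lift:
  assumes "F \<in> Linf \<mu>" "g \<in> borel_measurable borel"
  shows "mu_corr F n g = (\<integral>x. F ((lift ^^ n) x) * g x \<partial>\<mu>)"
  unfolding mu_corr_def
proof (rule integral_cong_AE)
  note [measurable] = LinfD(1)[OF assms(1)] assms(2)
  show "(\<lambda>x. F ((T ^^ n) x) * g x) \<in> borel_measurable \<mu>" by measurable
  show "(\<lambda>x. F ((lift ^^ n) x) * g x) \<in> borel_measurable \<mu>" by measurable
  show "AE x in \<mu>. F ((T ^^ n) x) * g x = F ((lift ^^ n) x) * g x"
    using T_pow_AE by eventually_elim simp
qed

text \<open>With \<open>h\<close> the density of \<open>\<mu>\<close>, the function
  \<open>h g\<close> has Lebesgue mean zero, so the reference term in \<open>mixes\<close> vanishes.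
  Complex values are handled through four real correlations.\<close>

lemma mean_zero_mixing:
  assumes F: "F \<in> Linf \<mu>" and g: "integrable \<mu> g" and g0: "(\<integral>x. g x \<partial>\<mu>) = 0"
  shows "(\<lambda>n. mu_corr F n g) \<longlonglongrightarrow> 0"
proof -
  obtain M where M: "M > 0" "AE x in \<mu>. norm (F x) \<le> M" using LinfD(2)[OF F] by blast
  note [measurable] = LinfD(1)[OF F]
  have gm[measurable]: "g \<in> borel_measurable borel" using borel_measurable_integrable[OF g] by simp
  obtain h where h[measurable]: "h \<in> borel_measurable borel" and h0: "\<And>x. 0 \<le> h x"
    and dens: "\<mu> = density lborel (\<lambda>x. ennreal (h x))" using density_exists by blast
  \<comment> \<open>Alters \<open>F\<close> on a null set only, to obtain the pointwise bound
    required by \<open>bdd_borel\<close>.\<close>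
  define F' where "F' x = (if norm (F x) \<le> M then F x else 0)" for x
  have [measurable]: "F' \<in> borel_measurable borel" unfolding F'_def by measurable
  have F'_le: "norm (F' x) \<le> M" for x using M(1) by (simp add: F'_def)
  define P Q u w where "P x = Re (F' x)" and "Q x = Im (F' x)" and "u x = Re (h x *\<^sub>R g x)" and "w x = Im (h x *\<^sub>R g x)" for x
  have PQ: "bdd_borel P M" "bdd_borel Q M"
    unfolding bdd_borel_def P_def Q_def
    using abs_Re_le_cmod[of "F' _"] abs_Im_le_cmod[of "F' _"] F'_le by (auto intro: order_trans)
  have ig: "integrable lborel (\<lambda>x. h x *\<^sub>R g x)"
    using g unfolding dens by (subst (asm) integrable_density) (use h0 in auto)
  have uw: "integrable lborel u" "integrable lborel w"
    unfolding u_def[abs_def] w_def[abs_def] by (rule integrable_Re[OF ig], rule integrable_Im[OF ig])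
  have "(\<integral>x. h x *\<^sub>R g x \<partial>lborel) = 0"
    using g0 unfolding dens by (subst (asm) integral_density) (use h0 in auto)
  then have uw0: "(\<integral>x. u x \<partial>lborel) = 0" "(\<integral>x. w x \<partial>lborel) = 0"
    unfolding u_def w_def integral_Re[OF ig] integral_Im[OF ig] by simp_all
  have "mu_corr F n g = Complex (corr P n u - corr Q n w) (corr P n w + corr Q n u)" for n
  proof -
    have "mu_corr F n g = (\<integral>x. F' ((lift ^^ n) x) * g x \<partial>\<mu>)"
      unfolding mu_corr_lift[OF F gm]
    proof (rule integral_cong_AE)
      show "AE x in \<mu>. F ((lift ^^ n) x) * g x = F' ((lift ^^ n) x) * g x"
        using AE_lift_pow[OF M(2), of n] by eventually_elim (simp add: F'_def)
    qed measurable
    also have "\<dots> = (\<integral>x. h x *\<^sub>R (F' ((lift ^^ n) x) * g x) \<partial>lborel)"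
      unfolding dens by (subst integral_density) (use h0 in auto)
    also have "\<dots> = (\<integral>x. F' ((lift ^^ n) x) * (h x *\<^sub>R g x) \<partial>lborel)" by simp
    finally have eq: "mu_corr F n g = (\<integral>x. F' ((lift ^^ n) x) * (h x *\<^sub>R g x) \<partial>lborel)" .
    have i: "integrable lborel (\<lambda>x. F' ((lift ^^ n) x) * (h x *\<^sub>R g x))"
      by (rule integrable_bdd_mult[OF _ _ ig, of _ M]) (use F'_le in auto)
    note ci = corr_integrable[OF PQ(1) uw(1), of n] corr_integrable[OF PQ(2) uw(2), of n]
      corr_integrable[OF PQ(1) uw(2), of n] corr_integrable[OF PQ(2) uw(1), of n]
    show ?thesis
    proof (rule complex_eqI)
      have "Re (mu_corr F n g) = (\<integral>x. P ((lift ^^ n) x) * u x - Q ((lift ^^ n) x) * w x \<partial>lborel)"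
        unfolding eq integral_Re[OF i, symmetric] by (simp only: P_def Q_def u_def w_def times_complex.sel)
      then show "Re (mu_corr F n g) = Re (Complex (corr P n u - corr Q n w) (corr P n w + corr Q n u))"
        using ci by (simp add: corr_def)
      have "Im (mu_corr F n g) = (\<integral>x. P ((lift ^^ n) x) * w x + Q ((lift ^^ n) x) * u x \<partial>lborel)"
        unfolding eq integral_Im[OF i, symmetric] by (simp only: P_def Q_def u_def w_def times_complex.sel)
      then show "Im (mu_corr F n g) = Im (Complex (corr P n u - corr Q n w) (corr P n w + corr Q n u))"
        using ci by (simp add: corr_def)
    qed
  qed
  moreover have "(\<lambda>n. Complex (corr P n u - corr Q n w) (corr P n w + corr Q n u)) \<longlonglongrightarrow> Complex (0 - 0) (0 + 0)"
    using mixes_all[OF PQ(1) uw(1)] mixes_all[OF PQ(1) uw(2)] mixes_all[OF PQ(2) uw(1)] mixes_all[OF PQ(2) uw(2)] uw0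
    by (intro tendsto_Complex tendsto_diff tendsto_add) (auto simp: mixes_def)
  ultimately show ?thesis by (simp add: zero_complex.code)
qed

end

section \<open>Infinite-volume averages\<close>

text \<open>Turns suprema in \<open>ennreal\<close> into an \<epsilon>-statement once and for all;
  the index type is general so that volumes alone and pairs of a volume and a time are both
  covered.\<close>

lemma SUP_ennreal_tendsto_0_iff:
  fixes S :: "real \<Rightarrow> 'v set" and f :: "'v \<Rightarrow> real"
  assumes f: "\<And>v. 0 \<le> f v"
  shows "((\<lambda>M. SUP v\<in>S M. ennreal (f v)) \<longlongrightarrow> 0) at_top \<longleftrightarrow> (\<forall>\<epsilon>>0. \<exists>M0. \<forall>M\<ge>M0. \<forall>v\<in>S M. f v \<le> \<epsilon>)"
proof
  assume lim: "((\<lambda>M. SUP v\<in>S M. ennreal (f v)) \<longlongrightarrow> 0) at_top"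
  show "\<forall>\<epsilon>>0. \<exists>M0. \<forall>M\<ge>M0. \<forall>v\<in>S M. f v \<le> \<epsilon>"
  proof (intro allI impI)
    fix \<epsilon> :: real assume e: "\<epsilon> > 0"
    then have "\<forall>\<^sub>F M in at_top. (SUP v\<in>S M. ennreal (f v)) < ennreal \<epsilon>"
      using order_tendstoD(2)[OF lim, of "ennreal \<epsilon>"] by simp
    then obtain M0 where M0: "\<And>M. M \<ge> M0 \<Longrightarrow> (SUP v\<in>S M. ennreal (f v)) < ennreal \<epsilon>"
      by (auto simp: eventually_at_top_linorder)
    have "f v \<le> \<epsilon>" if "M \<ge> M0" "v \<in> S M" for M v
    proof -
      have "ennreal (f v) \<le> (SUP v\<in>S M. ennreal (f v))" using that(2) by (rule SUP_upper)
      also have "\<dots> < ennreal \<epsilon>" using M0 that(1) by blast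
      finally show ?thesis using e f by (simp add: ennreal_less_iff)
    qed
    then show "\<exists>M0. \<forall>M\<ge>M0. \<forall>v\<in>S M. f v \<le> \<epsilon>" by blast
  qed
next
  assume *: "\<forall>\<epsilon>>0. \<exists>M0. \<forall>M\<ge>M0. \<forall>v\<in>S M. f v \<le> \<epsilon>"
  show "((\<lambda>M. SUP v\<in>S M. ennreal (f v)) \<longlongrightarrow> 0) at_top"
  proof (rule order_tendstoI)
    fix y :: ennreal assume "0 < y"
    then obtain z where z: "0 < z" "z < y" using dense by blast
    then obtain \<epsilon> where e: "z = ennreal \<epsilon>" "\<epsilon> > 0" by (cases z) auto
    then obtain M0 where M0: "\<forall>M\<ge>M0. \<forall>v\<in>S M. f v \<le> \<epsilon>" using * by blast
    have "(SUP v\<in>S M. ennreal (f v)) < y" if "M \<ge> M0" for M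
    proof -
      have "(SUP v\<in>S M. ennreal (f v)) \<le> z"
        unfolding e using M0 that by (intro SUP_least ennreal_leI) blast
      then show ?thesis using z by simp
    qed
    then show "\<forall>\<^sub>F M in at_top. (SUP v\<in>S M. ennreal (f v)) < y"
      by (auto simp: eventually_at_top_linorder)
  qed simp
qed

lemma norm_triangle_three:
  fixes x y z w :: "'a::real_normed_vector"
  shows "norm (x - w) \<le> norm (x - y) + norm (y - z) + norm (z - w)"
  using dist_triangle[of x w y] dist_triangle[of y w z] by (simp add: dist_norm)

context quasi_lift_measure
begin

section \<open>Cell integrals and averages over volumes\<close>

definition cell_mass where "cell_mass = measure \<mu> (open_cell 0)"

lemma AE_\<mu>_open_cell: "AE x in \<mu>. x \<in> open_cell \<lfloor>x / a\<rfloor>"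
  unfolding AE_\<mu> by (rule AE_open_cell)

lemma emeasure_open_cell_hcell: "emeasure \<mu> (open_cell j) = emeasure \<mu> (hcell j)"
proof (rule emeasure_eq_AE)
  show "AE x in \<mu>. x \<in> open_cell j \<longleftrightarrow> x \<in> hcell j"
    using AE_\<mu>_open_cell
  proof eventually_elim
    fix x assume x: "x \<in> open_cell \<lfloor>x / a\<rfloor>"
    show "x \<in> open_cell j \<longleftrightarrow> x \<in> hcell j"
    proof
      assume "x \<in> hcell j"
      then have "\<lfloor>x / a\<rfloor> = j" using a_pos by (intro floor_unique) (auto simp: hcell_def field_simps)
      then show "x \<in> open_cell j" using x by simp
    qed (auto simp: open_cell_def hcell_def)
  qed
qed simp_all

lemma emeasure_open_cell_\<mu>: "emeasure \<mu> (open_cell j) = ennreal cell_mass"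
proof -
  have "emeasure \<mu> (open_cell 0) \<noteq> top" using emeasure_hcell0 emeasure_open_cell_hcell[of 0] by auto
  then have "emeasure \<mu> (open_cell 0) = ennreal cell_mass" unfolding cell_mass_def by (rule emeasure_eq_ennreal_measure)
  then show ?thesis using emeasure_open_cell_hcell[of j] emeasure_open_cell_hcell[of 0] emeasure_hcell[of j] by simp
qed

lemma measure_open_cell_\<mu>: "measure \<mu> (open_cell j) = cell_mass"
  using emeasure_open_cell_\<mu>[of j] by (simp add: measure_def cell_mass_def)

lemma cell_mass_pos: "cell_mass > 0"
proof -
  have "emeasure lborel (open_cell 0) \<noteq> 0" using a_pos by (simp add: emeasure_open_cell)
  then have "open_cell 0 \<notin> null_sets \<mu>" unfolding null_sets_\<mu> by auto
  then have "emeasure \<mu> (open_cell 0) \<noteq> 0" by (auto simp: null_sets_def)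
  then show ?thesis unfolding emeasure_open_cell_\<mu> by (metis ennreal_eq_0_iff not_le)
qed

lemma integrable_open_cell: "integrable \<mu> (indicator (open_cell j) :: real \<Rightarrow> complex)"
  by (rule integrable_real_indicator[THEN integrable_of_real[where 'a=complex], unfolded of_real_indicator])
    (simp_all add: emeasure_open_cell_\<mu>)

lemma integral_open_cell: "(\<integral>x. indicator (open_cell j) x \<partial>\<mu>) = (of_real cell_mass :: complex)"
proof -
  have "integrable \<mu> (indicator (open_cell j) :: real \<Rightarrow> real)" by (simp add: emeasure_open_cell_\<mu>)
  from integral_of_real[OF this, where 'a=complex] show ?thesis
    by (simp add: of_real_indicator measure_open_cell_\<mu>)
qed

lemma Linf_open_cell: "X \<in> Linf \<mu> \<Longrightarrow> integrable \<mu> (\<lambda>x. X x * indicator (open_cell j) x)"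
  by (rule Linf_mult_integrable[OF _ integrable_open_cell])

definition cint :: "(real \<Rightarrow> complex) \<Rightarrow> complex" where
  "cint X = (\<integral>x. X x * indicator (open_cell 0) x \<partial>\<mu>)"

lemma cint_add: "X \<in> Linf \<mu> \<Longrightarrow> Y \<in> Linf \<mu> \<Longrightarrow> cint (\<lambda>x. X x + Y x) = cint X + cint Y"
  using Linf_open_cell[of X 0] Linf_open_cell[of Y 0] by (simp add: cint_def distrib_right)

lemma cint_cmult: "cint (\<lambda>x. c * X x) = c * cint X"
  by (simp add: cint_def mult.assoc)

lemma cint_bound:
  assumes X: "X \<in> Linf \<mu>" and M: "AE x in \<mu>. norm (X x) \<le> M" shows "norm (cint X) \<le> M * cell_mass"
proof -
  have "norm (cint X) \<le> (\<integral>x. norm (X x * indicator (open_cell 0) x) \<partial>\<mu>)"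
    unfolding cint_def by (rule integral_norm_bound)
  also have "\<dots> \<le> (\<integral>x. M * indicator (open_cell 0) x \<partial>\<mu>)"
  proof (rule integral_mono_AE)
    show "integrable \<mu> (\<lambda>x. norm (X x * indicator (open_cell 0) x))" using Linf_open_cell[OF X] by (rule integrable_norm)
    show "integrable \<mu> (\<lambda>x. M * indicator (open_cell 0) x)"
      by (intro integrable_mult_right) (simp add: emeasure_open_cell_\<mu>)
    show "AE x in \<mu>. norm (X x * indicator (open_cell 0) x) \<le> M * indicator (open_cell 0) x"
      using M by eventually_elim (simp add: indicator_def)
  qed
  also have "\<dots> = M * cell_mass" by (simp add: measure_open_cell_\<mu>)
  finally show ?thesis .
qed

lemma cint_cong_AE:
  assumes [measurable]: "X \<in> borel_measurable borel" "Y \<in> borel_measurable borel"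
    and "AE x in \<mu>. X x = Y x"
  shows "cint X = cint Y"
  unfolding cint_def
proof (rule integral_cong_AE)
  show "AE x in \<mu>. X x * indicator (open_cell 0) x = Y x * indicator (open_cell 0) x"
    using assms(3) by eventually_elim simp
qed measurable

lemma Linf_translate:
  assumes X: "X \<in> Linf \<mu>" shows "(\<lambda>x. X (x + a * of_int j)) \<in> Linf \<mu>"
proof -
  obtain M where M: "AE x in \<mu>. norm (X x) \<le> M" using LinfD(2)[OF X] by blast
  note [measurable] = LinfD(1)[OF X]
  show ?thesis by (rule LinfI[OF _ AE_translate[OF M]]) measurable
qed

lemma Linf_add:
  assumes "X \<in> Linf \<mu>" "Y \<in> Linf \<mu>" shows "(\<lambda>x. X x + Y x) \<in> Linf \<mu>"
proof -
  note [measurable] = LinfD(1)[OF assms(1)] LinfD(1)[OF assms(2)]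
  obtain M N where MN: "AE x in \<mu>. norm (X x) \<le> M" "AE x in \<mu>. norm (Y x) \<le> N"
    using LinfD(2)[OF assms(1)] LinfD(2)[OF assms(2)] by blast
  show ?thesis
  proof (rule LinfI[of _ "M + N"])
    show "AE x in \<mu>. norm (X x + Y x) \<le> M + N"
      using MN by eventually_elim (meson add_mono norm_triangle_ineq order_trans)
  qed measurable
qed

lemma Linf_mult:
  assumes "X \<in> Linf \<mu>" "Y \<in> Linf \<mu>" shows "(\<lambda>x. X x * Y x) \<in> Linf \<mu>"
proof -
  note [measurable] = LinfD(1)[OF assms(1)] LinfD(1)[OF assms(2)]
  obtain M N where MN: "M > 0" "AE x in \<mu>. norm (X x) \<le> M" "AE x in \<mu>. norm (Y x) \<le> N"
    using LinfD(2)[OF assms(1)] LinfD(2)[OF assms(2)] by blast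
  show ?thesis
  proof (rule LinfI[of _ "M * N"])
    show "AE x in \<mu>. norm (X x * Y x) \<le> M * N"
      using MN(2,3) by eventually_elim (use MN(1) in \<open>auto simp: norm_mult intro!: mult_mono\<close>)
  qed measurable
qed

lemma Linf_const: "(\<lambda>x. c) \<in> Linf \<mu>"
  by (rule LinfI[of _ "norm c"]) auto

lemma Linf_cmult: "X \<in> Linf \<mu> \<Longrightarrow> (\<lambda>x. c * X x) \<in> Linf \<mu>"
  using Linf_mult[OF Linf_const] .

lemma Linf_diff: "X \<in> Linf \<mu> \<Longrightarrow> Y \<in> Linf \<mu> \<Longrightarrow> (\<lambda>x. X x - Y x) \<in> Linf \<mu>"
  using Linf_add[OF _ Linf_cmult[of Y "-1"], of X] by simp

lemma Linf_sum: "(\<And>i. i \<in> I \<Longrightarrow> X i \<in> Linf \<mu>) \<Longrightarrow> (\<lambda>x. \<Sum>i\<in>I. X i x) \<in> Linf \<mu>"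
  by (induction I rule: infinite_finite_induct) (auto intro: Linf_const Linf_add)

text \<open>Neighbouring closed cells overlap in a null set, so the indicator of the volume is
  almost everywhere a sum over open cells; invariance then moves each cell integral to cell
  \<open>0\<close>.\<close>

lemma volume_kl:
  assumes "k \<le> l"
  defines "V \<equiv> \<Union>j\<in>{k..l}. cell a j" and "N \<equiv> nat (l - k + 1)"
  shows "measure \<mu> V = real N * cell_mass"
    and "X \<in> Linf \<mu> \<Longrightarrow> (LINT x:V|\<mu>. X x) = (\<Sum>j<N. cint (\<lambda>x. X (x + a * of_int (k + int j))))"
proof -
  have mem: "x \<in> V \<longleftrightarrow> i \<in> {k..l}" if x: "x \<in> open_cell i" for x i
  proof -
    have "x \<in> cell a j \<longleftrightarrow> j = i" for j
    proof
      assume c: "x \<in> cell a j"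
      have "a * of_int i < a * (of_int j + 1)" "a * of_int j < a * (of_int i + 1)"
        using x c by (auto simp: open_cell_def cell_def)
      then have "real_of_int i < of_int j + 1" "real_of_int j < of_int i + 1"
        using a_pos by (simp_all only: mult_less_cancel_left_pos)
      then show "j = i" by linarith
    qed (use x in \<open>auto simp: open_cell_def cell_def\<close>)
    then show ?thesis unfolding V_def by auto
  qed
  have [measurable]: "V \<in> sets borel" unfolding V_def by (intro sets.finite_UN) (auto simp: cell_def)
  have ind: "AE x in \<mu>. indicator V x = (\<Sum>j\<in>{k..l}. indicator (open_cell j) x :: real)"
    using AE_\<mu>_open_cell
  proof eventually_elim
    fix x assume x: "x \<in> open_cell \<lfloor>x / a\<rfloor>"
    show "indicator V x = (\<Sum>j\<in>{k..l}. indicator (open_cell j) x :: real)"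
    proof -
      have "(\<Sum>j\<in>{k..l}. indicator (open_cell j) x :: real) = (\<Sum>j\<in>{k..l}. if j = \<lfloor>x / a\<rfloor> then 1 else 0)"
        by (intro sum.cong refl indicator_open_cell[OF x])
      then show ?thesis using mem[OF x] by (simp add: indicator_def)
    qed
  qed
  have reindex: "(\<Sum>j\<in>{k..l}. f j) = (\<Sum>j<N. f (k + int j))" for f :: "int \<Rightarrow> 'b::comm_monoid_add"
    by (rule sum.reindex_bij_witness[of _ "\<lambda>i. k + int i" "\<lambda>j. nat (j - k)"]) (use assms(1) in \<open>auto simp: N_def\<close>)
  have "measure \<mu> V = (\<integral>x. indicator V x \<partial>\<mu>)" by simp
  also have "\<dots> = (\<integral>x. (\<Sum>j\<in>{k..l}. indicator (open_cell j) x) \<partial>\<mu>)"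
    by (rule integral_cong_AE) (use ind in auto)
  also have "\<dots> = (\<Sum>j\<in>{k..l}. cell_mass)"
    by (subst Bochner_Integration.integral_sum) (auto simp: emeasure_open_cell_\<mu> measure_open_cell_\<mu>)
  also have "\<dots> = real N * cell_mass" unfolding reindex by simp
  finally show "measure \<mu> V = real N * cell_mass" .
  assume X: "X \<in> Linf \<mu>"
  note [measurable] = LinfD(1)[OF X]
  have "(LINT x:V|\<mu>. X x) = (\<integral>x. (\<Sum>j\<in>{k..l}. X x * indicator (open_cell j) x) \<partial>\<mu>)"
    unfolding set_lebesgue_integral_def
  proof (rule integral_cong_AE)
    show "AE x in \<mu>. indicator V x *\<^sub>R X x = (\<Sum>j\<in>{k..l}. X x * indicator (open_cell j) x)"
      using ind
    proof eventually_elim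
      fix x assume "indicator V x = (\<Sum>j\<in>{k..l}. indicator (open_cell j) x :: real)"
      then have "indicator V x *\<^sub>R X x = (\<Sum>j\<in>{k..l}. (indicator (open_cell j) x :: real) *\<^sub>R X x)"
        by (simp only: scaleR_sum_left)
      also have "\<dots> = (\<Sum>j\<in>{k..l}. X x * indicator (open_cell j) x)"
        by (intro sum.cong refl) (simp add: indicator_def)
      finally show "indicator V x *\<^sub>R X x = (\<Sum>j\<in>{k..l}. X x * indicator (open_cell j) x)" .
    qed
  qed measurable
  also have "\<dots> = (\<Sum>j\<in>{k..l}. \<integral>x. X x * indicator (open_cell j) x \<partial>\<mu>)"
    using Linf_open_cell[OF X] by (intro Bochner_Integration.integral_sum) auto
  also have "\<dots> = (\<Sum>j\<in>{k..l}. cint (\<lambda>x. X (x + a * of_int j)))"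
  proof (intro sum.cong refl)
    fix j
    have "indicator (open_cell j) (x + a * of_int j) = (indicator (open_cell 0) x :: complex)" for x
      by (auto simp: indicator_def open_cell_def algebra_simps)
    then show "(\<integral>x. X x * indicator (open_cell j) x \<partial>\<mu>) = cint (\<lambda>x. X (x + a * of_int j))"
      unfolding cint_def by (subst integral_translate[symmetric, of _ j]) simp_all
  qed
  finally show "(LINT x:V|\<mu>. X x) = (\<Sum>j<N. cint (\<lambda>x. X (x + a * of_int (k + int j))))"
    unfolding reindex .
qed

lemma volume_form:
  assumes "V \<in> volumes a"
  obtains k N where "N \<ge> 1" "measure \<mu> V = real N * cell_mass"
    "\<And>X. X \<in> Linf \<mu> \<Longrightarrow> vol_avg \<mu> V X = (\<Sum>j<N. cint (\<lambda>x. X (x + a * of_int (k + int j)))) / of_real (real N * cell_mass)"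
proof -
  obtain k l where kl: "k \<le> l" "V = (\<Union>j\<in>{k..l}. cell a j)" using assms by (auto simp: volumes_def)
  show thesis
    by (rule that[of "nat (l - k + 1)" k]) (use kl volume_kl[OF kl(1)] in \<open>auto simp: vol_avg_def\<close>)
qed

text \<open>Without arbitrarily large volumes the suprema would run over empty sets and
  infinite-volume averages would not be unique.\<close>

lemma volume_large: "\<exists>V\<in>volumes a. measure \<mu> V \<ge> M"
proof -
  obtain N :: nat where N: "M / cell_mass < real N" using reals_Archimedean2 by blast
  let ?V = "\<Union>j\<in>{0..int N}. cell a j"
  have "?V \<in> volumes a" unfolding volumes_def by (intro CollectI exI[of _ 0] exI[of _ "int N"]) simp
  moreover have "measure \<mu> ?V = real (Suc N) * cell_mass" using volume_kl(1)[of 0 "int N"] by (simp add: nat_add_distrib)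
  moreover have "M \<le> real (Suc N) * cell_mass" using N cell_mass_pos by (simp add: field_simps)
  ultimately show ?thesis by metis
qed

lemma vol_avg_bound:
  assumes V: "V \<in> volumes a" and X: "X \<in> Linf \<mu>" and M: "AE x in \<mu>. norm (X x) \<le> M"
  shows "norm (vol_avg \<mu> V X) \<le> M"
proof -
  obtain k N where kN: "N \<ge> 1" "vol_avg \<mu> V X = (\<Sum>j<N. cint (\<lambda>x. X (x + a * of_int (k + int j)))) / of_real (real N * cell_mass)"
    using volume_form[OF V] X by metis
  have "norm (\<Sum>j<N. cint (\<lambda>x. X (x + a * of_int (k + int j)))) \<le> (\<Sum>j<N. M * cell_mass)"
    by (intro sum_norm_le cint_bound Linf_translate[OF X] AE_translate[OF M])
  then have "norm (\<Sum>j<N. cint (\<lambda>x. X (x + a * of_int (k + int j)))) \<le> real N * (M * cell_mass)" by simp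
  moreover have "norm (of_real (real N * cell_mass) :: complex) = real N * cell_mass"
    using cell_mass_pos by (simp only: norm_of_real) simp
  moreover have "real N * cell_mass > 0" using cell_mass_pos kN(1) by simp
  ultimately show ?thesis unfolding kN(2) norm_divide by (simp add: divide_le_eq mult_ac)
qed

lemma vol_avg_add:
  assumes V: "V \<in> volumes a" and X: "X \<in> Linf \<mu>" and Y: "Y \<in> Linf \<mu>"
  shows "vol_avg \<mu> V (\<lambda>x. X x + Y x) = vol_avg \<mu> V X + vol_avg \<mu> V Y"
proof -
  obtain k N where f: "\<And>X. X \<in> Linf \<mu> \<Longrightarrow> vol_avg \<mu> V X = (\<Sum>j<N. cint (\<lambda>x. X (x + a * of_int (k + int j)))) / of_real (real N * cell_mass)"
    using volume_form[OF V] by metis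
  show ?thesis unfolding f[OF X] f[OF Y] f[OF Linf_add[OF X Y]]
    by (simp only: cint_add[OF Linf_translate[OF X] Linf_translate[OF Y]] sum.distrib add_divide_distrib)
qed

lemma vol_avg_cmult: "vol_avg \<mu> V (\<lambda>x. c * X x) = c * vol_avg \<mu> V X"
  by (simp add: vol_avg_def set_lebesgue_integral_def mult_scaleR_right[symmetric] del: mult_scaleR_right)

lemma vol_avg_diff:
  assumes "V \<in> volumes a" "X \<in> Linf \<mu>" "Y \<in> Linf \<mu>"
  shows "vol_avg \<mu> V (\<lambda>x. X x - Y x) = vol_avg \<mu> V X - vol_avg \<mu> V Y"
  using vol_avg_add[OF assms(1,2) Linf_cmult[OF assms(3), of "-1"]] vol_avg_cmult[of V "-1" Y] by simp

text \<open>Joint uniformity in volume and time. A constant sequence \<open>X\<close> recovers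
  infinite-volume averages, a varying one expresses (GGM2), so the same lemmas handle both.\<close>

definition unif_avg :: "(nat \<Rightarrow> real \<Rightarrow> complex) \<Rightarrow> complex \<Rightarrow> bool" where
  "unif_avg X l \<longleftrightarrow> (\<forall>\<epsilon>>0. \<exists>M0. \<forall>V n. V \<in> volumes a \<longrightarrow> measure \<mu> V \<ge> M0 \<longrightarrow> real n \<ge> M0 \<longrightarrow>
      norm (vol_avg \<mu> V (X n) - l) \<le> \<epsilon>)"

lemma has_inf_vol_avg_iff: "has_inf_vol_avg a \<mu> F l \<longleftrightarrow> unif_avg (\<lambda>_. F) l"
proof
  assume "has_inf_vol_avg a \<mu> F l"
  then have *: "\<forall>\<epsilon>>0. \<exists>M0. \<forall>M\<ge>M0. \<forall>V\<in>{V \<in> volumes a. measure \<mu> V \<ge> M}. norm (vol_avg \<mu> V F - l) \<le> \<epsilon>"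
    unfolding has_inf_vol_avg_def by (subst (asm) SUP_ennreal_tendsto_0_iff) auto
  show "unif_avg (\<lambda>_. F) l"
    unfolding unif_avg_def
  proof (intro allI impI)
    fix \<epsilon> :: real assume "\<epsilon> > 0"
    then obtain M0 where "\<forall>M\<ge>M0. \<forall>V\<in>{V \<in> volumes a. measure \<mu> V \<ge> M}. norm (vol_avg \<mu> V F - l) \<le> \<epsilon>" using * by blast
    then show "\<exists>M0. \<forall>V n. V \<in> volumes a \<longrightarrow> measure \<mu> V \<ge> M0 \<longrightarrow> real n \<ge> M0 \<longrightarrow> norm (vol_avg \<mu> V F - l) \<le> \<epsilon>"
      by (intro exI[of _ M0]) auto
  qed
next
  assume u: "unif_avg (\<lambda>_. F) l"
  show "has_inf_vol_avg a \<mu> F l"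
    unfolding has_inf_vol_avg_def
  proof (subst SUP_ennreal_tendsto_0_iff, simp, intro allI impI)
    fix \<epsilon> :: real assume "\<epsilon> > 0"
    then obtain M0 where M0: "\<And>V n. V \<in> volumes a \<Longrightarrow> measure \<mu> V \<ge> M0 \<Longrightarrow> real n \<ge> M0 \<Longrightarrow> norm (vol_avg \<mu> V F - l) \<le> \<epsilon>"
      using u unfolding unif_avg_def by metis
    \<comment> \<open>The sequence is constant, so any large index may stand in for the
      time.\<close>
    obtain n :: nat where "real n \<ge> M0" using real_arch_simple by blast
    then show "\<exists>M0. \<forall>M\<ge>M0. \<forall>V\<in>{V \<in> volumes a. measure \<mu> V \<ge> M}. norm (vol_avg \<mu> V F - l) \<le> \<epsilon>"
      using M0 by (intro exI[of _ M0]) (auto intro: order_trans)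
  qed
qed

lemma unif_avg_unique: "unif_avg X l \<Longrightarrow> unif_avg X l' \<Longrightarrow> l = l'"
proof (rule ccontr)
  assume u: "unif_avg X l" "unif_avg X l'" and ne: "l \<noteq> l'"
  let ?e = "norm (l - l') / 3"
  have e: "?e > 0" using ne by simp
  obtain M1 where M1: "\<And>V n. V \<in> volumes a \<Longrightarrow> measure \<mu> V \<ge> M1 \<Longrightarrow> real n \<ge> M1 \<Longrightarrow> norm (vol_avg \<mu> V (X n) - l) \<le> ?e"
    using u(1) e unfolding unif_avg_def by metis
  obtain M2 where M2: "\<And>V n. V \<in> volumes a \<Longrightarrow> measure \<mu> V \<ge> M2 \<Longrightarrow> real n \<ge> M2 \<Longrightarrow> norm (vol_avg \<mu> V (X n) - l') \<le> ?e"
    using u(2) e unfolding unif_avg_def by metis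
  obtain n :: nat where n: "real n \<ge> max M1 M2" using real_arch_simple by blast
  obtain V where V: "V \<in> volumes a" "measure \<mu> V \<ge> max M1 M2" using volume_large by blast
  have "norm (vol_avg \<mu> V (X n) - l) \<le> ?e" "norm (vol_avg \<mu> V (X n) - l') \<le> ?e"
    using M1[OF V(1), of n] M2[OF V(1), of n] V n by auto
  moreover have "norm (l - l') \<le> norm (vol_avg \<mu> V (X n) - l) + norm (vol_avg \<mu> V (X n) - l')"
    using norm_triangle_ineq4[of "vol_avg \<mu> V (X n) - l'" "vol_avg \<mu> V (X n) - l"] by simp
  ultimately have "norm (l - l') \<le> 2 * ?e" by linarith
  then show False using ne by simp
qed

lemma inf_vol_avg_eq: "unif_avg (\<lambda>_. F) l \<Longrightarrow> inf_vol_avg a \<mu> F = l"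
  unfolding inf_vol_avg_def has_inf_vol_avg_iff by (rule the_equality) (auto intro: unif_avg_unique)

lemma unif_avg_approx:
  assumes X: "\<And>n. X n \<in> Linf \<mu>"
    and ex: "\<And>\<epsilon>. \<epsilon> > 0 \<Longrightarrow> \<exists>Y l'. (\<forall>n. Y n \<in> Linf \<mu>) \<and> unif_avg Y l' \<and> norm (l' - l) \<le> \<epsilon> \<and>
        (\<forall>n. AE x in \<mu>. norm (X n x - Y n x) \<le> \<epsilon>)"
  shows "unif_avg X l"
  unfolding unif_avg_def
proof (intro allI impI)
  fix \<epsilon> :: real assume "\<epsilon> > 0"
  then have e: "\<epsilon> / 3 > 0" by simp
  obtain Y l' where Y: "\<And>n. Y n \<in> Linf \<mu>" "unif_avg Y l'" "norm (l' - l) \<le> \<epsilon> / 3"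
    "\<And>n. AE x in \<mu>. norm (X n x - Y n x) \<le> \<epsilon> / 3" using ex[OF e] by blast
  obtain M0 where M0: "\<And>V n. V \<in> volumes a \<Longrightarrow> measure \<mu> V \<ge> M0 \<Longrightarrow> real n \<ge> M0 \<Longrightarrow> norm (vol_avg \<mu> V (Y n) - l') \<le> \<epsilon> / 3"
    using Y(2) e unfolding unif_avg_def by metis
  show "\<exists>M0. \<forall>V n. V \<in> volumes a \<longrightarrow> measure \<mu> V \<ge> M0 \<longrightarrow> real n \<ge> M0 \<longrightarrow> norm (vol_avg \<mu> V (X n) - l) \<le> \<epsilon>"
  proof (intro exI[of _ M0] allI impI)
    fix V n assume V: "V \<in> volumes a" "measure \<mu> V \<ge> M0" "real n \<ge> M0"
    have "norm (vol_avg \<mu> V (X n) - vol_avg \<mu> V (Y n)) \<le> \<epsilon> / 3"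
      using vol_avg_bound[OF V(1) Linf_diff[OF X Y(1)] Y(4)] by (simp add: vol_avg_diff[OF V(1) X Y(1)])
    moreover have "norm (vol_avg \<mu> V (Y n) - l') \<le> \<epsilon> / 3" by (rule M0[OF V])
    ultimately show "norm (vol_avg \<mu> V (X n) - l) \<le> \<epsilon>"
      using Y(3) norm_triangle_three[of "vol_avg \<mu> V (X n)" l "vol_avg \<mu> V (Y n)" l'] by linarith
  qed
qed

text \<open>Both averages are evaluated on one large volume at one large time, where they differ by
  at most the sup norm of \<open>X n - Y n\<close>.\<close>

lemma unif_avg_dist:
  assumes X: "\<And>n. X n \<in> Linf \<mu>" and Y: "\<And>n. Y n \<in> Linf \<mu>" and "unif_avg X l" "unif_avg Y l'"
    and d: "\<And>n. AE x in \<mu>. norm (X n x - Y n x) \<le> d"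
  shows "norm (l - l') \<le> d"
proof (rule field_le_epsilon)
  fix \<epsilon> :: real assume "\<epsilon> > 0"
  then have e: "\<epsilon> / 2 > 0" by simp
  obtain M1 where M1: "\<And>V n. V \<in> volumes a \<Longrightarrow> measure \<mu> V \<ge> M1 \<Longrightarrow> real n \<ge> M1 \<Longrightarrow> norm (vol_avg \<mu> V (X n) - l) \<le> \<epsilon> / 2"
    using assms(3) e unfolding unif_avg_def by metis
  obtain M2 where M2: "\<And>V n. V \<in> volumes a \<Longrightarrow> measure \<mu> V \<ge> M2 \<Longrightarrow> real n \<ge> M2 \<Longrightarrow> norm (vol_avg \<mu> V (Y n) - l') \<le> \<epsilon> / 2"
    using assms(4) e unfolding unif_avg_def by metis
  obtain n :: nat where n: "real n \<ge> max M1 M2" using real_arch_simple by blast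
  obtain V where V: "V \<in> volumes a" "measure \<mu> V \<ge> max M1 M2" using volume_large by blast
  let ?x = "vol_avg \<mu> V (X n)" and ?y = "vol_avg \<mu> V (Y n)"
  have "norm (?x - l) \<le> \<epsilon> / 2" "norm (?y - l') \<le> \<epsilon> / 2"
    using M1[OF V(1), of n] M2[OF V(1), of n] V n by auto
  moreover have "norm (?x - ?y) \<le> d"
    using vol_avg_bound[OF V(1) Linf_diff[OF X Y] d] by (simp add: vol_avg_diff[OF V(1) X Y])
  ultimately show "norm (l - l') \<le> d + \<epsilon>"
    using norm_triangle_three[of l l' ?x ?y] norm_minus_commute[of l ?x] by linarith
qed

text \<open>The averages of the approximants form a Cauchy sequence by \<open>unif_avg_dist\<close>,
  and completeness of the complex numbers supplies the limit.\<close>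

lemma unif_avg_closure:
  assumes X: "\<And>n. X n \<in> Linf \<mu>"
    and ex: "\<And>\<epsilon>. \<epsilon> > 0 \<Longrightarrow> \<exists>Y l'. (\<forall>n. Y n \<in> Linf \<mu>) \<and> unif_avg Y l' \<and>
        (\<forall>n. AE x in \<mu>. norm (X n x - Y n x) \<le> \<epsilon>)"
  shows "\<exists>l. unif_avg X l"
proof -
  have "\<forall>i. \<exists>Y l'. (\<forall>n. Y n \<in> Linf \<mu>) \<and> unif_avg Y l' \<and> (\<forall>n. AE x in \<mu>. norm (X n x - Y n x) \<le> inverse (real (Suc i)))"
    using ex by simp
  then obtain Y l' where Y: "\<And>i n. Y i n \<in> Linf \<mu>" "\<And>i. unif_avg (Y i) (l' i)"
    "\<And>i n. AE x in \<mu>. norm (X n x - Y i n x) \<le> inverse (real (Suc i))" by metis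
  have dist: "norm (l' i - l' j) \<le> inverse (real (Suc i)) + inverse (real (Suc j))" for i j
  proof (rule unif_avg_dist[OF Y(1) Y(1) Y(2) Y(2)])
    fix n
    show "AE x in \<mu>. norm (Y i n x - Y j n x) \<le> inverse (real (Suc i)) + inverse (real (Suc j))"
      using Y(3)[of n i] Y(3)[of n j]
    proof eventually_elim
      fix x assume "norm (X n x - Y i n x) \<le> inverse (real (Suc i))" "norm (X n x - Y j n x) \<le> inverse (real (Suc j))"
      then show "norm (Y i n x - Y j n x) \<le> inverse (real (Suc i)) + inverse (real (Suc j))"
        using norm_triangle_ineq4[of "X n x - Y j n x" "X n x - Y i n x"] by simp
    qed
  qed
  have small: "\<exists>N. \<forall>i\<ge>N. inverse (real (Suc i)) < e" if "e > 0" for e :: real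
    using LIMSEQ_D[OF LIMSEQ_inverse_real_of_nat that] by auto
  have "Cauchy l'"
  proof (rule CauchyI)
    fix e :: real assume "e > 0"
    then obtain N where N: "\<And>i. i \<ge> N \<Longrightarrow> inverse (real (Suc i)) < e / 2" using small[of "e/2"] by auto
    have "norm (l' i - l' j) < e" if "i \<ge> N" "j \<ge> N" for i j
      using dist[of i j] N[OF that(1)] N[OF that(2)] by linarith
    then show "\<exists>M. \<forall>cell_mass\<ge>M. \<forall>n\<ge>M. norm (l' cell_mass - l' n) < e" by blast
  qed
  then obtain l where l: "l' \<longlonglongrightarrow> l" by (auto simp: Cauchy_convergent_iff convergent_def)
  have "unif_avg X l"
  proof (rule unif_avg_approx[OF X])
    fix \<epsilon> :: real assume e: "\<epsilon> > 0"
    obtain N1 where N1: "\<forall>i\<ge>N1. inverse (real (Suc i)) < \<epsilon>" using small[OF e] by blast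
    obtain N2 where N2: "\<forall>i\<ge>N2. norm (l' i - l) < \<epsilon>" using LIMSEQ_D[OF l e] by blast
    let ?i = "max N1 N2"
    have "norm (l' ?i - l) \<le> \<epsilon>" using N2 by (simp add: less_imp_le)
    moreover have "AE x in \<mu>. norm (X n x - Y ?i n x) \<le> \<epsilon>" for n
      using Y(3)[of n ?i]
    proof eventually_elim
      fix x assume "norm (X n x - Y ?i n x) \<le> inverse (real (Suc ?i))"
      moreover have "inverse (real (Suc ?i)) < \<epsilon>" using N1 by simp
      ultimately show "norm (X n x - Y ?i n x) \<le> \<epsilon>" by linarith
    qed
    ultimately show "\<exists>Y l'. (\<forall>n. Y n \<in> Linf \<mu>) \<and> unif_avg Y l' \<and> norm (l' - l) \<le> \<epsilon> \<and>
        (\<forall>n. AE x in \<mu>. norm (X n x - Y n x) \<le> \<epsilon>)" using Y(1,2) by blast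
  qed
  then show ?thesis by blast
qed

lemma unif_avg_add:
  assumes X: "\<And>n. X n \<in> Linf \<mu>" and Y: "\<And>n. Y n \<in> Linf \<mu>" and "unif_avg X l" "unif_avg Y l'"
  shows "unif_avg (\<lambda>n x. X n x + Y n x) (l + l')"
  unfolding unif_avg_def
proof (intro allI impI)
  fix \<epsilon> :: real assume "\<epsilon> > 0"
  then have e: "\<epsilon> / 2 > 0" by simp
  obtain M1 where M1: "\<And>V n. V \<in> volumes a \<Longrightarrow> measure \<mu> V \<ge> M1 \<Longrightarrow> real n \<ge> M1 \<Longrightarrow> norm (vol_avg \<mu> V (X n) - l) \<le> \<epsilon> / 2"
    using assms(3) e unfolding unif_avg_def by metis
  obtain M2 where M2: "\<And>V n. V \<in> volumes a \<Longrightarrow> measure \<mu> V \<ge> M2 \<Longrightarrow> real n \<ge> M2 \<Longrightarrow> norm (vol_avg \<mu> V (Y n) - l') \<le> \<epsilon> / 2"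
    using assms(4) e unfolding unif_avg_def by metis
  show "\<exists>M0. \<forall>V n. V \<in> volumes a \<longrightarrow> measure \<mu> V \<ge> M0 \<longrightarrow> real n \<ge> M0 \<longrightarrow>
      norm (vol_avg \<mu> V (\<lambda>x. X n x + Y n x) - (l + l')) \<le> \<epsilon>"
  proof (intro exI[of _ "max M1 M2"] allI impI)
    fix V n assume V: "V \<in> volumes a" "measure \<mu> V \<ge> max M1 M2" "real n \<ge> max M1 M2"
    then have "norm (vol_avg \<mu> V (X n) - l) \<le> \<epsilon> / 2" "norm (vol_avg \<mu> V (Y n) - l') \<le> \<epsilon> / 2"
      using M1[OF V(1), of n] M2[OF V(1), of n] by auto
    then show "norm (vol_avg \<mu> V (\<lambda>x. X n x + Y n x) - (l + l')) \<le> \<epsilon>"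
      unfolding vol_avg_add[OF V(1) X Y]
      using norm_triangle_ineq[of "vol_avg \<mu> V (X n) - l" "vol_avg \<mu> V (Y n) - l'"] by (simp add: algebra_simps)
  qed
qed

lemma unif_avg_cmult:
  assumes "unif_avg X l" shows "unif_avg (\<lambda>n x. c * X n x) (c * l)"
  unfolding unif_avg_def
proof (intro allI impI)
  fix \<epsilon> :: real assume "\<epsilon> > 0"
  then have e: "\<epsilon> / (norm c + 1) > 0" by (simp add: add_nonneg_pos)
  obtain M0 where M0: "\<And>V n. V \<in> volumes a \<Longrightarrow> measure \<mu> V \<ge> M0 \<Longrightarrow> real n \<ge> M0 \<Longrightarrow> norm (vol_avg \<mu> V (X n) - l) \<le> \<epsilon> / (norm c + 1)"
    using assms e unfolding unif_avg_def by metis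
  show "\<exists>M0. \<forall>V n. V \<in> volumes a \<longrightarrow> measure \<mu> V \<ge> M0 \<longrightarrow> real n \<ge> M0 \<longrightarrow>
      norm (vol_avg \<mu> V (\<lambda>x. c * X n x) - c * l) \<le> \<epsilon>"
  proof (intro exI[of _ M0] allI impI)
    fix V n assume V: "V \<in> volumes a" "measure \<mu> V \<ge> M0" "real n \<ge> M0"
    have "norm (vol_avg \<mu> V (\<lambda>x. c * X n x) - c * l) = norm c * norm (vol_avg \<mu> V (X n) - l)"
      unfolding vol_avg_cmult right_diff_distrib[symmetric] norm_mult ..
    also have "\<dots> \<le> (norm c + 1) * (\<epsilon> / (norm c + 1))" using M0[OF V] by (intro mult_mono) auto
    also have "\<dots> = \<epsilon>" using norm_ge_zero[of c] by (simp add: add_nonneg_eq_0_iff)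
    finally show "norm (vol_avg \<mu> V (\<lambda>x. c * X n x) - c * l) \<le> \<epsilon>" .
  qed
qed

lemma unif_avg_sum:
  assumes "finite I" "\<And>i n. i \<in> I \<Longrightarrow> X i n \<in> Linf \<mu>" "\<And>i. i \<in> I \<Longrightarrow> unif_avg (X i) (l i)"
  shows "unif_avg (\<lambda>n x. \<Sum>i\<in>I. X i n x) (\<Sum>i\<in>I. l i)"
  using assms
proof (induction I rule: finite_induct)
  case empty
  have "vol_avg \<mu> V (\<lambda>x. 0) = 0" for V by (simp add: vol_avg_def)
  then show ?case by (simp add: unif_avg_def)
next
  case (insert i I)
  then show ?case
    using unif_avg_add[of "X i" "\<lambda>n x. \<Sum>i\<in>I. X i n x" "l i" "\<Sum>i\<in>I. l i"] Linf_sum[of I] by simp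
qed

end

section \<open>Quasi-periodic observables\<close>

lemma norm_add_diff_le: "norm (x + y - z) \<le> norm x + norm y + norm z" for x y z :: "'a::real_normed_vector"
  using norm_triangle_ineq4[of "x + y" z] norm_triangle_ineq[of x y] by linarith

context quasi_lift_measure
begin

lemma cint_diff: "X \<in> Linf \<mu> \<Longrightarrow> Y \<in> Linf \<mu> \<Longrightarrow> cint (\<lambda>x. X x - Y x) = cint X - cint Y"
  using cint_add[OF _ Linf_cmult[of Y "-1"], of X] cint_cmult[of "-1" Y] by simp

section \<open>Invariance for periodic observables and correlations on cells\<close>

lemma AE_periodic:
  assumes "AE x in \<mu>. P (x + a) = P x" shows "AE x in \<mu>. \<forall>j::int. P (x + a * of_int j) = P x"
proof -
  have "AE x in \<mu>. \<forall>j::int. P (x + a * of_int j + a) = P (x + a * of_int j)"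
    unfolding AE_all_countable using AE_translate[OF assms] by blast
  then show ?thesis
  proof eventually_elim
    fix x assume *: "\<forall>j::int. P (x + a * of_int j + a) = P (x + a * of_int j)"
    have step: "P (x + a * of_int (j + 1)) = P (x + a * of_int j)" for j
      using *[rule_format, of j] by (simp add: algebra_simps)
    show "\<forall>j::int. P (x + a * of_int j) = P x"
    proof
      fix j :: int
      show "P (x + a * of_int j) = P x"
        by (induction j rule: int_induct[of _ 0]) (use step[of "_ - 1"] step in auto)
    qed
  qed
qed

lemma cint_circle:
  assumes [measurable]: "Q \<in> borel_measurable borel"
  shows "cint Q = (\<integral>x. Q x \<partial>\<mu>\<^sub>a)"
proof -
  have "(\<integral>x. Q x \<partial>\<mu>\<^sub>a) = (\<integral>x. indicator {0..<a} x *\<^sub>R Q x \<partial>\<mu>)"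
    unfolding restrict_\<mu>[symmetric] by (rule integral_restrict_space) simp
  also have "\<dots> = cint Q"
    unfolding cint_def
  proof (rule integral_cong_AE)
    show "AE x in \<mu>. indicator {0..<a} x *\<^sub>R Q x = Q x * indicator (open_cell 0) x"
      using AE_\<mu>_open_cell
    proof eventually_elim
      fix x assume x: "x \<in> open_cell \<lfloor>x / a\<rfloor>"
      have "x \<in> {0..<a} \<longleftrightarrow> x \<in> open_cell 0"
      proof
        assume "x \<in> {0..<a}"
        then have "\<lfloor>x / a\<rfloor> = 0" using a_pos by (intro floor_unique) auto
        then show "x \<in> open_cell 0" using x by simp
      qed (auto simp: open_cell_def)
      then show "indicator {0..<a} x *\<^sub>R Q x = Q x * indicator (open_cell 0) x" by (simp add: indicator_def)
    qed
  qed measurable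
  finally show ?thesis ..
qed

text \<open>For periodic \<open>Q\<close> the values at \<open>lift x\<close> and at
  \<open>circle_map a T x\<close> agree almost everywhere, since the arguments differ by a multiple
  of \<open>a\<close>; invariance of \<open>\<mu>\<^sub>a\<close> then applies.\<close>

lemma cint_lift:
  assumes Q[measurable]: "Q \<in> borel_measurable borel" and per: "AE x in \<mu>. Q (x + a) = Q x"
  shows "cint (\<lambda>x. Q (lift x)) = cint Q"
proof -
  have inv: "circle_map a T \<in> measurable \<mu>\<^sub>a \<mu>\<^sub>a" "distr \<mu>\<^sub>a \<mu>\<^sub>a (circle_map a T) = \<mu>\<^sub>a"
    using circle_inv by (auto simp: circle_invariant_measure_def invariant_measure_def)
  have Qa: "Q \<in> borel_measurable \<mu>\<^sub>a"
    unfolding restrict_\<mu>[symmetric] by (rule measurable_restrict_space1) simp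
  have cm: "circle_map a T \<in> borel_measurable borel"
    unfolding circle_map_def rmod_def by measurable
  then have [measurable]: "(\<lambda>x. Q (circle_map a T x)) \<in> borel_measurable borel" by measurable
  have "cint Q = (\<integral>x. Q x \<partial>distr \<mu>\<^sub>a \<mu>\<^sub>a (circle_map a T))" unfolding inv(2) by (rule cint_circle[OF Q])
  also have "\<dots> = (\<integral>x. Q (circle_map a T x) \<partial>\<mu>\<^sub>a)" by (rule integral_distr[OF inv(1) Qa])
  also have "\<dots> = cint (\<lambda>x. Q (circle_map a T x))" by (rule cint_circle[symmetric]) measurable
  also have "\<dots> = cint (\<lambda>x. Q (lift x))"
  proof (rule cint_cong_AE)
    show "AE x in \<mu>. Q (circle_map a T x) = Q (lift x)"
      using AE_lift[OF AE_periodic[OF per]] T_pow_AE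
    proof eventually_elim
      fix x assume per: "\<forall>j. Q (lift x + a * of_int j) = Q (lift x)" and "\<forall>n. (T ^^ n) x = (lift ^^ n) x"
      then have T: "T x = lift x" by (metis funpow_0 funpow_simps_right(2) o_apply)
      have "circle_map a T x = lift x + a * of_int (- \<lfloor>lift x / a\<rfloor>)"
        using a_pos by (simp add: circle_map_def T rmod_def)
      then show "Q (circle_map a T x) = Q (lift x)" using per by metis
    qed
  qed measurable
  finally show ?thesis ..
qed

lemma cint_lift_pow:
  assumes Q[measurable]: "Q \<in> borel_measurable borel" and per: "AE x in \<mu>. Q (x + a) = Q x"
  shows "cint (\<lambda>x. Q ((lift ^^ n) x)) = cint Q"
proof (induction n)
  case (Suc n)
  have "AE x in \<mu>. Q ((lift ^^ n) (x + a)) = Q ((lift ^^ n) x)"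
    using AE_lift_pow[OF per, of n] by eventually_elim (use lift_pow_shift[of n _ 1] in simp)
  then have "cint (\<lambda>x. Q ((lift ^^ n) (lift x))) = cint (\<lambda>x. Q ((lift ^^ n) x))"
    by (intro cint_lift) measurable
  then show ?case using Suc by (simp add: funpow_swap1)
qed simp

abbreviation "cell_ind \<equiv> (\<lambda>j. indicator (open_cell j) :: real \<Rightarrow> complex)"

lemma mu_corr_cell_ind:
  assumes "F \<in> Linf \<mu>" shows "mu_corr F n (cell_ind 0) = cint (\<lambda>x. F ((lift ^^ n) x))"
  unfolding mu_corr_lift[OF assms borel_measurable_indicator[OF open_cell_measurable]] cint_def ..

lemma mu_corr_periodic:
  assumes "F \<in> Linf \<mu>" "AE x in \<mu>. F (x + a) = F x" shows "mu_corr F n (cell_ind 0) = cint F"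
  unfolding mu_corr_cell_ind[OF assms(1)] using LinfD(1)[OF assms(1)] assms(2) by (rule cint_lift_pow)

lemma mu_corr_cell_ind_translate:
  assumes F: "F \<in> Linf \<mu>" shows "mu_corr F n (cell_ind j) = mu_corr (\<lambda>x. F (x + a * of_int j)) n (cell_ind 0)"
proof -
  note [measurable] = LinfD(1)[OF F]
  have "mu_corr F n (cell_ind j) = (\<integral>x. F ((lift ^^ n) x) * cell_ind j x \<partial>\<mu>)"
    by (rule mu_corr_lift[OF F]) simp
  also have "\<dots> = (\<integral>x. F ((lift ^^ n) (x + a * of_int j)) * cell_ind j (x + a * of_int j) \<partial>\<mu>)"
    by (rule integral_translate[symmetric]) measurable
  also have "\<dots> = (\<integral>x. F ((lift ^^ n) x + a * of_int j) * cell_ind 0 x \<partial>\<mu>)"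
  proof -
    have "cell_ind j (x + a * of_int j) = cell_ind 0 x" for x
      by (auto simp: indicator_def open_cell_def algebra_simps)
    then show ?thesis by (simp add: lift_pow_shift)
  qed
  also have "\<dots> = mu_corr (\<lambda>x. F (x + a * of_int j)) n (cell_ind 0)"
    by (rule mu_corr_lift[OF Linf_translate[OF F], symmetric]) simp
  finally show ?thesis .
qed

lemma mu_corr_integrable:
  assumes F: "F \<in> Linf \<mu>" and g: "integrable \<mu> g" shows "integrable \<mu> (\<lambda>x. F ((T ^^ n) x) * g x)"
  by (rule Linf_mult_integrable[OF Linf_T[OF F] g])

lemma mu_corr_same_mean:
  assumes F: "F \<in> Linf \<mu>" and g: "integrable \<mu> g" and h: "integrable \<mu> h"
    and "(\<integral>x. g x \<partial>\<mu>) = c * (\<integral>x. h x \<partial>\<mu>)" and lim: "(\<lambda>n. mu_corr F n h) \<longlonglongrightarrow> l"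
  shows "(\<lambda>n. mu_corr F n g) \<longlonglongrightarrow> c * l"
proof -
  have i: "integrable \<mu> (\<lambda>x. g x - c * h x)" using g h by simp
  have "(\<integral>x. g x - c * h x \<partial>\<mu>) = 0" using g h assms(4) by simp
  then have "(\<lambda>n. mu_corr F n (\<lambda>x. g x - c * h x)) \<longlonglongrightarrow> 0" by (rule mean_zero_mixing[OF F i])
  moreover have "mu_corr F n (\<lambda>x. g x - c * h x) = mu_corr F n g - c * mu_corr F n h" for n
    using mu_corr_integrable[OF F g, of n] mu_corr_integrable[OF F h, of n]
    by (simp add: mu_corr_def right_diff_distrib mult.left_commute[of _ c])
  ultimately have "(\<lambda>n. (mu_corr F n g - c * mu_corr F n h) + c * mu_corr F n h) \<longlonglongrightarrow> 0 + c * l"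
    by (intro tendsto_add tendsto_mult_left lim) simp
  then show ?thesis by simp
qed

lemma mu_corr_cell_ind_diff:
  assumes F: "F \<in> Linf \<mu>" shows "(\<lambda>n. mu_corr F n (cell_ind j) - mu_corr F n (cell_ind 0)) \<longlonglongrightarrow> 0"
proof -
  have "(\<lambda>n. mu_corr F n (\<lambda>x. cell_ind j x - cell_ind 0 x)) \<longlonglongrightarrow> 0"
    by (rule mean_zero_mixing[OF F]) (simp_all add: integrable_open_cell integral_open_cell)
  moreover have "mu_corr F n (\<lambda>x. cell_ind j x - cell_ind 0 x) = mu_corr F n (cell_ind j) - mu_corr F n (cell_ind 0)" for n
    using mu_corr_integrable[OF F integrable_open_cell, of n j] mu_corr_integrable[OF F integrable_open_cell, of n 0]
    by (simp add: mu_corr_def right_diff_distrib)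
  ultimately show ?thesis by simp
qed

text \<open>By (a) correlations depend asymptotically only on the mean of \<open>g\<close>, so their
  limit on a single cell determines all others.\<close>

lemma mu_corr_from_cell:
  assumes F: "F \<in> Linf \<mu>" and g: "integrable \<mu> g" and "(\<lambda>n. mu_corr F n (cell_ind 0)) \<longlonglongrightarrow> l * of_real cell_mass"
  shows "(\<lambda>n. mu_corr F n g) \<longlonglongrightarrow> l * (\<integral>x. g x \<partial>\<mu>)"
proof -
  have "(\<lambda>n. mu_corr F n g) \<longlonglongrightarrow> ((\<integral>x. g x \<partial>\<mu>) / of_real cell_mass) * (l * of_real cell_mass)"
    by (rule mu_corr_same_mean[OF F g integrable_open_cell _ assms(3)]) (use cell_mass_pos in \<open>simp add: integral_open_cell\<close>)
  then show ?thesis using cell_mass_pos by (simp add: mult.commute)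
qed

text \<open>Recording the multiplier \<omega> instead of the frequency makes products easy:
  multipliers multiply.\<close>

definition qp :: "complex \<Rightarrow> (real \<Rightarrow> complex) \<Rightarrow> bool" where
  "qp \<omega> E \<longleftrightarrow> norm \<omega> = 1 \<and> E \<in> Linf \<mu> \<and> (AE x in \<mu>. E (x + a) = \<omega> * E x)"

text \<open>The value of the infinite-volume average: with multiplier \<open>1\<close> every cell
  contributes the same, otherwise the contributions cancel.\<close>

definition qavg :: "complex \<Rightarrow> (real \<Rightarrow> complex) \<Rightarrow> complex" where
  "qavg \<omega> E = (if \<omega> = 1 then cint E / of_real cell_mass else 0)"

text \<open>If \<omega> is not \<open>1\<close>, moving the density by one cell multiplies the
  correlation by \<omega>, while by (a) the change is asymptotically negligible; hence the
  correlation tends to \<open>0\<close>.\<close>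

lemma qp_L:
  assumes E: "qp \<omega> E" shows "(\<lambda>n. mu_corr E n (cell_ind 0)) \<longlonglongrightarrow> qavg \<omega> E * of_real cell_mass"
proof (cases "\<omega> = 1")
  case True
  then show ?thesis using mu_corr_periodic[of E] E cell_mass_pos by (simp add: qp_def qavg_def)
next
  case False
  have Ei: "E \<in> Linf \<mu>" using E by (simp add: qp_def)
  note [measurable] = LinfD(1)[OF Ei]
  have "mu_corr E n (cell_ind 1) = \<omega> * mu_corr E n (cell_ind 0)" for n
  proof -
    have per: "AE x in \<mu>. E (x + a) = \<omega> * E x" using E by (simp add: qp_def)
    have "mu_corr E n (cell_ind 1) = cint (\<lambda>x. E ((lift ^^ n) x + a))"
      using mu_corr_cell_ind_translate[OF Ei, of n 1] mu_corr_cell_ind[OF Linf_translate[OF Ei, of 1], of n] by simp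
    also have "\<dots> = cint (\<lambda>x. \<omega> * E ((lift ^^ n) x))"
    proof (rule cint_cong_AE)
      show "AE x in \<mu>. E ((lift ^^ n) x + a) = \<omega> * E ((lift ^^ n) x)" by (rule AE_lift_pow[OF per])
    qed measurable
    also have "\<dots> = \<omega> * mu_corr E n (cell_ind 0)" unfolding cint_cmult mu_corr_cell_ind[OF Ei] ..
    finally show ?thesis .
  qed
  then have "(\<lambda>n. (\<omega> - 1) * mu_corr E n (cell_ind 0)) \<longlonglongrightarrow> 0"
    using mu_corr_cell_ind_diff[OF Ei, of 1] by (simp add: left_diff_distrib)
  then have "(\<lambda>n. ((\<omega> - 1) * mu_corr E n (cell_ind 0)) / (\<omega> - 1)) \<longlonglongrightarrow> 0 / (\<omega> - 1)"
    using False by (intro tendsto_divide tendsto_const) auto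
  then show ?thesis using False by (simp add: qavg_def)
qed

lemma qp_translate:
  assumes E: "qp \<omega> E"
  shows "AE x in \<mu>. E (x + a * of_int (k + int j)) = \<omega> ^ j * E (x + a * of_int k)"
proof (induction j)
  case (Suc j)
  have per: "AE x in \<mu>. E (x + a) = \<omega> * E x" using E by (simp add: qp_def)
  show ?case using Suc AE_translate[OF per, of "k + int j"]
    by eventually_elim (simp add: algebra_simps)
qed simp

lemma qp_vol_avg:
  assumes E: "qp \<omega> E" and V: "V \<in> volumes a"
  obtains k N where "N \<ge> 1" "measure \<mu> V = real N * cell_mass"
    "vol_avg \<mu> V E = (\<Sum>j<N. \<omega> ^ j) * cint (\<lambda>x. E (x + a * of_int k)) / of_real (real N * cell_mass)"
proof -
  have Ei: "E \<in> Linf \<mu>" using E by (simp add: qp_def)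
  note [measurable] = LinfD(1)[OF Ei]
  obtain k N where kN: "N \<ge> 1" "measure \<mu> V = real N * cell_mass"
    "\<And>X. X \<in> Linf \<mu> \<Longrightarrow> vol_avg \<mu> V X = (\<Sum>j<N. cint (\<lambda>x. X (x + a * of_int (k + int j)))) / of_real (real N * cell_mass)"
    using volume_form[OF V] by metis
  have "cint (\<lambda>x. E (x + a * of_int (k + int j))) = \<omega> ^ j * cint (\<lambda>x. E (x + a * of_int k))" for j
    unfolding cint_cmult[symmetric]
  proof (rule cint_cong_AE)
    show "AE x in \<mu>. E (x + a * of_int (k + int j)) = \<omega> ^ j * E (x + a * of_int k)"
      by (rule qp_translate[OF E])
  qed measurable
  then have "(\<Sum>j<N. cint (\<lambda>x. E (x + a * of_int (k + int j)))) = (\<Sum>j<N. \<omega> ^ j) * cint (\<lambda>x. E (x + a * of_int k))"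
    by (simp only: sum_distrib_right)
  then have "vol_avg \<mu> V E = (\<Sum>j<N. \<omega> ^ j) * cint (\<lambda>x. E (x + a * of_int k)) / of_real (real N * cell_mass)"
    unfolding kN(3)[OF Ei] by (simp only:)
  then show thesis by (rule that[OF kN(1,2)])
qed

lemma qp1_vol_avg:
  assumes E: "qp 1 E" and V: "V \<in> volumes a" shows "vol_avg \<mu> V E = cint E / of_real cell_mass"
proof -
  have Ei: "E \<in> Linf \<mu>" using E by (simp add: qp_def)
  note [measurable] = LinfD(1)[OF Ei]
  obtain k N where kN: "N \<ge> 1" "measure \<mu> V = real N * cell_mass"
    "vol_avg \<mu> V E = (\<Sum>j<N. 1 ^ j) * cint (\<lambda>x. E (x + a * of_int k)) / of_real (real N * cell_mass)"
    by (rule qp_vol_avg[OF E V])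
  have "cint (\<lambda>x. E (x + a * of_int k)) = cint E"
  proof (rule cint_cong_AE)
    have "AE x in \<mu>. E (x + a) = E x" using E by (simp add: qp_def)
    from AE_periodic[OF this] show "AE x in \<mu>. E (x + a * of_int k) = E x" by eventually_elim blast
  qed measurable
  then show ?thesis using kN(1) by (simp add: kN(3))
qed

text \<open>The geometric sum over the cells of \<open>V\<close> is bounded by
  \<open>2 / norm (1 - \<omega>)\<close> independently of their number.\<close>

lemma qp_vol_avg_le:
  assumes E: "qp \<omega> E" and V: "V \<in> volumes a" and ne: "\<omega> \<noteq> 1" and M: "AE x in \<mu>. norm (E x) \<le> M"
  shows "norm (vol_avg \<mu> V E) \<le> (2 / norm (1 - \<omega>) * M * cell_mass) / measure \<mu> V"
proof -
  have Ei: "E \<in> Linf \<mu>" using E by (simp add: qp_def)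
  obtain k N where kN: "N \<ge> 1" "measure \<mu> V = real N * cell_mass"
    "vol_avg \<mu> V E = (\<Sum>j<N. \<omega> ^ j) * cint (\<lambda>x. E (x + a * of_int k)) / of_real (real N * cell_mass)"
    by (rule qp_vol_avg[OF E V])
  have "norm (\<Sum>j<N. \<omega> ^ j) = norm (1 - \<omega> ^ N) / norm (1 - \<omega>)"
    using ne by (simp add: sum_gp_strict norm_divide)
  also have "\<dots> \<le> 2 / norm (1 - \<omega>)"
    using norm_triangle_ineq4[of 1 "\<omega> ^ N"] E by (intro divide_right_mono) (simp_all add: qp_def norm_power)
  finally have s: "norm (\<Sum>j<N. \<omega> ^ j) \<le> 2 / norm (1 - \<omega>)" .
  have c: "norm (cint (\<lambda>x. E (x + a * of_int k))) \<le> M * cell_mass"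
    by (rule cint_bound[OF Linf_translate[OF Ei] AE_translate[OF M]])
  have "norm (vol_avg \<mu> V E) = norm (\<Sum>j<N. \<omega> ^ j) * norm (cint (\<lambda>x. E (x + a * of_int k))) / (real N * cell_mass)"
    unfolding kN(3) norm_divide norm_mult norm_of_real using cell_mass_pos by simp
  also have "\<dots> \<le> (2 / norm (1 - \<omega>)) * (M * cell_mass) / (real N * cell_mass)"
    using s c cell_mass_pos by (intro divide_right_mono mult_mono) auto
  finally show ?thesis unfolding kN(2) by (simp add: mult.assoc)
qed

text \<open>The bound involves \<open>E n\<close> only through \<omega> and \<open>M\<close>, so the
  observable may vary with \<open>n\<close>.\<close>

lemma qp_unif_avg_null:
  assumes E: "\<And>n. qp \<omega> (E n)" and ne: "\<omega> \<noteq> 1" and M: "\<And>n. AE x in \<mu>. norm (E n x) \<le> M"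
  shows "unif_avg E 0"
  unfolding unif_avg_def
proof (intro allI impI)
  fix \<epsilon> :: real assume e: "\<epsilon> > 0"
  let ?A = "2 / norm (1 - \<omega>) * M * cell_mass"
  show "\<exists>M0. \<forall>V n. V \<in> volumes a \<longrightarrow> measure \<mu> V \<ge> M0 \<longrightarrow> real n \<ge> M0 \<longrightarrow> norm (vol_avg \<mu> V (E n) - 0) \<le> \<epsilon>"
  \<comment> \<open>The \<open>1\<close> guarantees a positive denominator.\<close>
  proof (intro exI[of _ "max 1 (?A / \<epsilon>)"] allI impI)
    fix V and n :: nat assume V: "V \<in> volumes a" "measure \<mu> V \<ge> max 1 (?A / \<epsilon>)"
    have "norm (vol_avg \<mu> V (E n)) \<le> ?A / measure \<mu> V" by (rule qp_vol_avg_le[OF E V(1) ne M])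
    also have "\<dots> \<le> \<epsilon>"
    proof -
      have pos: "measure \<mu> V > 0" using V(2) by linarith
      have "?A / \<epsilon> \<le> measure \<mu> V" by (rule order_trans[OF max.cobounded2 V(2)])
      then have "?A \<le> measure \<mu> V * \<epsilon>" unfolding pos_divide_le_eq[OF e] .
      then show ?thesis unfolding pos_divide_le_eq[OF pos] by (simp only: mult.commute)
    qed
    finally show "norm (vol_avg \<mu> V (E n) - 0) \<le> \<epsilon>" by simp
  qed
qed

text \<open>Iterates of \<open>T\<close> commute with the shift almost everywhere, so composing with
  them keeps the multiplier.\<close>

lemma qp_prod:
  assumes E: "qp \<omega> E" and E': "qp \<omega>' E'" shows "qp (\<omega> * \<omega>') (\<lambda>x. E ((T ^^ n) x) * E' x)"
proof -
  have Ei: "E \<in> Linf \<mu>" "E' \<in> Linf \<mu>" using E E' by (simp_all add: qp_def)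
  have p: "AE x in \<mu>. E (x + a) = \<omega> * E x" "AE x in \<mu>. E' (x + a) = \<omega>' * E' x" using E E' by (simp_all add: qp_def)
  have "AE x in \<mu>. E ((T ^^ n) (x + a)) * E' (x + a) = \<omega> * \<omega>' * (E ((T ^^ n) x) * E' x)"
    using AE_lift_pow[OF p(1), of n] p(2) T_pow_AE AE_translate[OF T_pow_AE, of 1]
  proof eventually_elim
    fix x assume *: "E ((lift ^^ n) x + a) = \<omega> * E ((lift ^^ n) x)" "E' (x + a) = \<omega>' * E' x"
      "\<forall>n. (T ^^ n) x = (lift ^^ n) x" "\<forall>n. (T ^^ n) (x + a * of_int 1) = (lift ^^ n) (x + a * of_int 1)"
    have "(T ^^ n) (x + a) = (lift ^^ n) x + a" using *(4) lift_pow_shift[of n x 1] by simp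
    then show "E ((T ^^ n) (x + a)) * E' (x + a) = \<omega> * \<omega>' * (E ((T ^^ n) x) * E' x)"
      using *(1-3) by simp
  qed
  then show ?thesis using E E' Linf_mult[OF Linf_T[OF Ei(1)] Ei(2)] by (simp add: qp_def norm_mult)
qed

lemma qp_prod_bound:
  assumes E: "qp \<omega> E" and E': "qp \<omega>' E'"
  obtains M where "\<And>n. AE x in \<mu>. norm (E ((T ^^ n) x) * E' x) \<le> M"
proof -
  have Ei: "E \<in> Linf \<mu>" "E' \<in> Linf \<mu>" using E E' by (simp_all add: qp_def)
  obtain M N where MN: "M > 0" "AE x in \<mu>. norm (E x) \<le> M" "AE x in \<mu>. norm (E' x) \<le> N"
    using LinfD(2)[OF Ei(1)] LinfD(2)[OF Ei(2)] by blast
  have "AE x in \<mu>. norm (E ((T ^^ n) x) * E' x) \<le> M * N" for n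
    using AE_lift_pow[OF MN(2), of n] MN(3) T_pow_AE
    by eventually_elim (use MN(1) in \<open>auto simp: norm_mult intro!: mult_mono\<close>)
  then show thesis by (rule that)
qed

lemma qp_exists_avg:
  assumes E: "qp \<omega> E" and E': "qp \<omega>' E'"
  shows "\<exists>l. unif_avg (\<lambda>_ x. E ((T ^^ n) x) * E' x) l"
proof (cases "\<omega> * \<omega>' = 1")
  case True
  let ?X = "\<lambda>x. E ((T ^^ n) x) * E' x"
  have "qp 1 ?X" using qp_prod[OF E E', of n] True by simp
  then have "unif_avg (\<lambda>_. ?X) (cint ?X / of_real cell_mass)"
    unfolding unif_avg_def using qp1_vol_avg by (auto simp: less_imp_le)
  then show ?thesis by blast
next
  case False
  obtain M where M: "\<And>n. AE x in \<mu>. norm (E ((T ^^ n) x) * E' x) \<le> M" using qp_prod_bound[OF E E'] by blast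
  have "unif_avg (\<lambda>_ x. E ((T ^^ n) x) * E' x) 0"
    by (rule qp_unif_avg_null[OF qp_prod[OF E E', of n] False M])
  then show ?thesis by blast
qed

text \<open>If \<open>\<omega> \<omega>' \<noteq> 1\<close>, the product averages to zero by a geometric sum, uniformly in \<open>n\<close>; otherwise it is
  periodic, all volumes give the same average, and the claim is a global-local mixing statement on
  one cell.\<close>

lemma qp_mixing:
  assumes E: "qp \<omega> E" and E': "qp \<omega>' E'"
  shows "unif_avg (\<lambda>n x. E ((T ^^ n) x) * E' x) (qavg \<omega> E * qavg \<omega>' E')"
proof (cases "\<omega> * \<omega>' = 1")
  case False
  obtain M where M: "\<And>n. AE x in \<mu>. norm (E ((T ^^ n) x) * E' x) \<le> M" using qp_prod_bound[OF E E'] by blast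
  have "unif_avg (\<lambda>n x. E ((T ^^ n) x) * E' x) 0"
    by (rule qp_unif_avg_null[OF qp_prod[OF E E'] False M])
  \<comment> \<open>Not both multipliers are \<open>1\<close>, so one of the factors is zero by
    definition.\<close>
  moreover have "qavg \<omega> E * qavg \<omega>' E' = 0" using False by (auto simp: qavg_def)
  ultimately show ?thesis by (simp only:)
next
  case True
  have Ei: "E \<in> Linf \<mu>" "E' \<in> Linf \<mu>" using E E' by (simp_all add: qp_def)
  let ?X = "\<lambda>n x. E ((T ^^ n) x) * E' x"
  have X: "qp 1 (?X n)" for n using qp_prod[OF E E', of n] True by simp
  \<comment> \<open>\<open>E'\<close> restricted to one cell takes the role of the local
    density.\<close>
  have "(\<lambda>n. mu_corr E n (\<lambda>x. E' x * cell_ind 0 x)) \<longlonglongrightarrow> qavg \<omega> E * (\<integral>x. E' x * cell_ind 0 x \<partial>\<mu>)"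
    by (rule mu_corr_from_cell[OF Ei(1) Linf_open_cell[OF Ei(2)] qp_L[OF E]])
  then have "(\<lambda>n. cint (?X n) / of_real cell_mass) \<longlonglongrightarrow> qavg \<omega> E * cint E' / of_real cell_mass"
    using cell_mass_pos by (intro tendsto_divide tendsto_const) (simp_all add: mu_corr_def cint_def mult.assoc)
  \<comment> \<open>Either both multipliers are \<open>1\<close>, or neither is and both sides
    vanish.\<close>
  moreover have "qavg \<omega> E * cint E' / of_real cell_mass = qavg \<omega> E * qavg \<omega>' E'"
    using True by (auto simp: qavg_def)
  ultimately have lim: "(\<lambda>n. cint (?X n) / of_real cell_mass) \<longlonglongrightarrow> qavg \<omega> E * qavg \<omega>' E'" by simp
  show ?thesis
    unfolding unif_avg_def
  proof (intro allI impI)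
    fix \<epsilon> :: real assume e: "\<epsilon> > 0"
    obtain N where N: "\<And>n. n \<ge> N \<Longrightarrow> norm (cint (?X n) / of_real cell_mass - qavg \<omega> E * qavg \<omega>' E') < \<epsilon>"
      using LIMSEQ_D[OF lim e] by blast
    show "\<exists>M0. \<forall>V n. V \<in> volumes a \<longrightarrow> measure \<mu> V \<ge> M0 \<longrightarrow> real n \<ge> M0 \<longrightarrow>
        norm (vol_avg \<mu> V (?X n) - qavg \<omega> E * qavg \<omega>' E') \<le> \<epsilon>"
    proof (intro exI[of _ "real N"] allI impI)
      fix V n assume V: "V \<in> volumes a" and "real N \<le> real n"
      then show "norm (vol_avg \<mu> V (?X n) - qavg \<omega> E * qavg \<omega>' E') \<le> \<epsilon>"
        using N[of n] by (simp add: qp1_vol_avg[OF X V])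
    qed
  qed
qed

lemma quasi_periodic_qp: "E \<in> quasi_periodic a \<mu> \<Longrightarrow> \<exists>\<omega>. qp \<omega> E"
proof -
  assume E: "E \<in> quasi_periodic a \<mu>"
  then obtain \<beta> :: real where b: "AE x in \<mu>. E (shift a x) = exp (\<i> * of_real (a * \<beta>)) * E x"
    by (auto simp: quasi_periodic_def)
  then have "qp (exp (\<i> * of_real (a * \<beta>))) E"
    using E by (simp add: qp_def quasi_periodic_def shift_def)
  then show ?thesis by blast
qed

section \<open>Finite combinations of quasi-periodic observables and their uniform limits\<close>

abbreviation "qspan \<equiv> complex_span (quasi_periodic a \<mu>)"

lemma qspanE:
  assumes "H \<in> qspan"
  obtains t c \<omega> where "finite t" "\<And>E. E \<in> t \<Longrightarrow> qp (\<omega> E) E" "H = (\<lambda>x. \<Sum>E\<in>t. c E * E x)"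
proof -
  obtain t c where t: "finite t" "t \<subseteq> quasi_periodic a \<mu>" "H = (\<lambda>x. \<Sum>E\<in>t. c E * E x)"
    using assms by (auto simp: complex_span_def)
  then have "\<forall>E\<in>t. \<exists>\<omega>. qp \<omega> E" using quasi_periodic_qp by blast
  then obtain \<omega> where "\<forall>E\<in>t. qp (\<omega> E) E" by metis
  with t that show thesis by blast
qed

lemma qspan_Linf: "H \<in> qspan \<Longrightarrow> H \<in> Linf \<mu>"
  by (erule qspanE) (auto simp: qp_def intro!: Linf_sum Linf_cmult)

text \<open>Bilinearity over pairs of quasi-periodic terms. The first claim fixes the time and gives
  existence of the average; the second lets time grow with the volume and identifies the
  limit.\<close>

lemma qspan_prod:
  assumes "H \<in> qspan" "H' \<in> qspan"
  shows "\<exists>l. unif_avg (\<lambda>_ x. H ((T ^^ n) x) * H' x) l"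
    and "\<exists>l l'. unif_avg (\<lambda>_. H) l \<and> unif_avg (\<lambda>_. H') l' \<and> unif_avg (\<lambda>n x. H ((T ^^ n) x) * H' x) (l * l')"
proof -
  obtain t c \<omega> where t: "finite t" "\<And>E. E \<in> t \<Longrightarrow> qp (\<omega> E) E" "H = (\<lambda>x. \<Sum>E\<in>t. c E * E x)"
    using qspanE[OF assms(1)] by metis
  obtain t' c' \<omega>' where t': "finite t'" "\<And>E. E \<in> t' \<Longrightarrow> qp (\<omega>' E) E" "H' = (\<lambda>x. \<Sum>E\<in>t'. c' E * E x)"
    using qspanE[OF assms(2)] by metis
  have fin: "finite (t \<times> t')" using t t' by simp
  have prod: "H ((T ^^ n) x) * H' x = (\<Sum>p\<in>t \<times> t'. (c (fst p) * c' (snd p)) * (fst p ((T ^^ n) x) * snd p x))" for n x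
    unfolding t(3) t'(3) sum_product sum.cartesian_product by (intro sum.cong) (auto simp: mult_ac)
  have li: "(\<lambda>x. (c (fst p) * c' (snd p)) * (fst p ((T ^^ n) x) * snd p x)) \<in> Linf \<mu>" if "p \<in> t \<times> t'" for p n
    using qp_prod[OF t(2) t'(2), of "fst p" "snd p" n] that by (intro Linf_cmult) (auto simp: qp_def)
  show "\<exists>l. unif_avg (\<lambda>_ x. H ((T ^^ n) x) * H' x) l"
  proof -
    have "\<forall>p\<in>t \<times> t'. \<exists>l. unif_avg (\<lambda>_ x. fst p ((T ^^ n) x) * snd p x) l"
      using qp_exists_avg[OF t(2) t'(2)] by auto
    then obtain l where l: "\<And>p. p \<in> t \<times> t' \<Longrightarrow> unif_avg (\<lambda>_ x. fst p ((T ^^ n) x) * snd p x) (l p)" by metis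
    have "unif_avg (\<lambda>_ x. \<Sum>p\<in>t \<times> t'. (c (fst p) * c' (snd p)) * (fst p ((T ^^ n) x) * snd p x))
        (\<Sum>p\<in>t \<times> t'. (c (fst p) * c' (snd p)) * l p)"
      by (rule unif_avg_sum[OF fin li unif_avg_cmult[OF l]])
    then show ?thesis unfolding prod by blast
  qed
  have single: "unif_avg (\<lambda>_. E) (qavg w E)" if E: "qp w E" for w E
  proof (cases "w = 1")
    case True
    then show ?thesis unfolding unif_avg_def using qp1_vol_avg E by (auto simp: less_imp_le qavg_def)
  next
    case False
    have Ei: "E \<in> Linf \<mu>" using E by (simp add: qp_def)
    obtain M where "AE x in \<mu>. norm (E x) \<le> M" using LinfD(2)[OF Ei] by blast
    then show ?thesis using qp_unif_avg_null[OF E False] False by (simp add: qavg_def)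
  qed
  have sH: "unif_avg (\<lambda>_. H) (\<Sum>E\<in>t. c E * qavg (\<omega> E) E)"
    unfolding t(3)
    by (rule unif_avg_sum[OF t(1) _ unif_avg_cmult[OF single[OF t(2)]]]) (use t(2) in \<open>auto simp: qp_def intro!: Linf_cmult\<close>)
  have sH': "unif_avg (\<lambda>_. H') (\<Sum>E\<in>t'. c' E * qavg (\<omega>' E) E)"
    unfolding t'(3)
    by (rule unif_avg_sum[OF t'(1) _ unif_avg_cmult[OF single[OF t'(2)]]]) (use t'(2) in \<open>auto simp: qp_def intro!: Linf_cmult\<close>)
  have p1: "unif_avg (\<lambda>n x. \<Sum>p\<in>t \<times> t'. (c (fst p) * c' (snd p)) * (fst p ((T ^^ n) x) * snd p x))
      (\<Sum>p\<in>t \<times> t'. (c (fst p) * c' (snd p)) * (qavg (\<omega> (fst p)) (fst p) * qavg (\<omega>' (snd p)) (snd p)))"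
    by (rule unif_avg_sum[OF fin li unif_avg_cmult[OF qp_mixing]]) (use t(2) t'(2) in auto)
  have p2: "(\<Sum>p\<in>t \<times> t'. (c (fst p) * c' (snd p)) * (qavg (\<omega> (fst p)) (fst p) * qavg (\<omega>' (snd p)) (snd p)))
     = (\<Sum>E\<in>t. c E * qavg (\<omega> E) E) * (\<Sum>E\<in>t'. c' E * qavg (\<omega>' E) E)"
    unfolding sum_product sum.cartesian_product by (intro sum.cong) (auto simp: mult_ac)
  have sP: "unif_avg (\<lambda>n x. H ((T ^^ n) x) * H' x) ((\<Sum>E\<in>t. c E * qavg (\<omega> E) E) * (\<Sum>E\<in>t'. c' E * qavg (\<omega>' E) E))"
    unfolding prod using p1 unfolding p2 .
  show "\<exists>l l'. unif_avg (\<lambda>_. H) l \<and> unif_avg (\<lambda>_. H') l' \<and> unif_avg (\<lambda>n x. H ((T ^^ n) x) * H' x) (l * l')"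
    by (intro exI conjI) (rule sH, rule sH', rule sP)
qed

lemma G2_Linf: "F \<in> G2 a \<mu> \<Longrightarrow> F \<in> Linf \<mu>"
  by (simp add: G2_def Linf_closure_def)

lemma G2_approx:
  assumes "F \<in> G2 a \<mu>" "\<epsilon> > 0"
  obtains H where "H \<in> qspan" "AE x in \<mu>. norm (F x - H x) \<le> \<epsilon>"
proof -
  have "\<forall>e>0. \<exists>H\<in>qspan. Linf_norm \<mu> (\<lambda>x. F x - H x) < e" using assms(1) by (simp add: G2_def Linf_closure_def)
  then obtain H where H: "H \<in> qspan" "Linf_norm \<mu> (\<lambda>x. F x - H x) < ennreal \<epsilon>"
    using assms(2) by (meson ennreal_less_zero_iff)
  with Linf_norm_AE[of "\<lambda>x. F x - H x" \<epsilon>] assms(2) that show thesis by (simp add: less_imp_le)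
qed

lemma prod_approx:
  fixes F G H H' :: "real \<Rightarrow> complex"
  assumes MN: "AE x in \<mu>. norm (F x) \<le> M" "AE x in \<mu>. norm (G x) \<le> M" "M > 0"
    and d: "AE x in \<mu>. norm (F x - H x) \<le> d" "AE x in \<mu>. norm (G x - H' x) \<le> d" and d1: "d > 0" "d \<le> 1"
  shows "AE x in \<mu>. norm (F ((T ^^ n) x) * G x - H ((T ^^ n) x) * H' x) \<le> (2 * M + 1) * d"
  using AE_lift_pow[OF MN(1), of n] MN(2) AE_lift_pow[OF d(1), of n] d(2) T_pow_AE
proof eventually_elim
  fix x
  let ?f = "F ((T ^^ n) x)" and ?h = "H ((T ^^ n) x)"
  assume "norm (F ((lift ^^ n) x)) \<le> M" "norm (G x) \<le> M" "norm (F ((lift ^^ n) x) - H ((lift ^^ n) x)) \<le> d"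
    "norm (G x - H' x) \<le> d" "\<forall>n. (T ^^ n) x = (lift ^^ n) x"
  then have *: "norm ?f \<le> M" "norm (G x) \<le> M" "norm (?f - ?h) \<le> d" "norm (G x - H' x) \<le> d" by simp_all
  \<comment> \<open>Expanded around \<open>F\<close> and \<open>G\<close>, so that no bound on the
    approximants is required; the quadratic term is at most \<open>d\<close> because
    \<open>d \<le> 1\<close>.\<close>
  have "?f * G x - ?h * H' x = (?f - ?h) * G x + ?f * (G x - H' x) - (?f - ?h) * (G x - H' x)"
    by (simp add: algebra_simps)
  then have "norm (?f * G x - ?h * H' x) \<le> norm (?f - ?h) * norm (G x) + norm ?f * norm (G x - H' x) + norm (?f - ?h) * norm (G x - H' x)"
    unfolding norm_mult[symmetric] by (simp only:) (rule norm_add_diff_le)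
  also have "\<dots> \<le> d * M + M * d + d * 1"
    using * d1 MN(3) by (intro add_mono mult_mono) auto
  also have "\<dots> = (2 * M + 1) * d" by (simp add: algebra_simps)
  finally show "norm (?f * G x - ?h * H' x) \<le> (2 * M + 1) * d" .
qed

lemma complex_prod_approx:
  fixes l l' h h' :: complex
  assumes "norm l \<le> M" "norm l' \<le> M" "norm (l - h) \<le> d" "norm (l' - h') \<le> d" "0 < d" "d \<le> 1" "M > 0"
  shows "norm (h * h' - l * l') \<le> (2 * M + 1) * d"
proof -
  have "norm (h * h' - l * l') = norm ((l - h) * l' + l * (l' - h') - (l - h) * (l' - h'))"
    by (subst norm_minus_commute) (simp add: algebra_simps)
  also have "\<dots> \<le> norm (l - h) * norm l' + norm l * norm (l' - h') + norm (l - h) * norm (l' - h')"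
    unfolding norm_mult[symmetric] by (rule norm_add_diff_le)
  also have "\<dots> \<le> d * M + M * d + d * 1"
    using assms by (intro add_mono mult_mono) auto
  also have "\<dots> = (2 * M + 1) * d" by (simp add: algebra_simps)
  finally show ?thesis .
qed

lemma scale_exists:
  assumes "M > (0::real)" "\<epsilon> > 0" obtains d where "0 < d" "d \<le> 1" "d \<le> \<epsilon>" "(2 * M + 1) * d \<le> \<epsilon>"
proof
  let ?d = "min 1 (\<epsilon> / (2 * M + 1))"
  have M: "2 * M + 1 > 1" using assms by simp
  show "0 < ?d" "?d \<le> 1" using assms M by simp_all
  have "(2 * M + 1) * ?d \<le> (2 * M + 1) * (\<epsilon> / (2 * M + 1))" using M by (intro mult_left_mono) auto
  also have "\<dots> = \<epsilon>" using M by simp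
  finally show 1: "(2 * M + 1) * ?d \<le> \<epsilon>" .
  have "1 * ?d \<le> (2 * M + 1) * ?d" using M \<open>0 < ?d\<close> by (intro mult_right_mono) auto
  then show "?d \<le> \<epsilon>" using 1 by linarith
qed

text \<open>Existence at each fixed time, which (GGM1) asks for and joint uniformity in volume and
  time does not provide.\<close>

lemma G2_exists_prod:
  assumes F: "F \<in> G2 a \<mu>" and G: "G \<in> G2 a \<mu>" shows "\<exists>l. unif_avg (\<lambda>_ x. F ((T ^^ n) x) * G x) l"
proof (rule unif_avg_closure)
  note Fi = G2_Linf[OF F] and Gi = G2_Linf[OF G]
  show "(\<lambda>x. F ((T ^^ n) x) * G x) \<in> Linf \<mu>" by (rule Linf_mult[OF Linf_T[OF Fi] Gi])
  obtain M1 M2 where M12: "M1 > 0" "AE x in \<mu>. norm (F x) \<le> M1" "AE x in \<mu>. norm (G x) \<le> M2"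
    using LinfD(2)[OF Fi] LinfD(2)[OF Gi] by blast
  let ?M = "max M1 M2"
  have M: "AE x in \<mu>. norm (F x) \<le> ?M" "AE x in \<mu>. norm (G x) \<le> ?M" "?M > 0"
    subgoal using M12(2) by eventually_elim simp
    subgoal using M12(3) by eventually_elim simp
    subgoal using M12(1) by simp
    done
  fix \<epsilon> :: real assume "\<epsilon> > 0"
  then obtain d where d: "0 < d" "d \<le> 1" "d \<le> \<epsilon>" "(2 * ?M + 1) * d \<le> \<epsilon>" using scale_exists[OF M(3)] by blast
  obtain H where H: "H \<in> qspan" "AE x in \<mu>. norm (F x - H x) \<le> d" by (rule G2_approx[OF F d(1)])
  obtain H' where H': "H' \<in> qspan" "AE x in \<mu>. norm (G x - H' x) \<le> d" by (rule G2_approx[OF G d(1)])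
  obtain l' where l': "unif_avg (\<lambda>_ x. H ((T ^^ n) x) * H' x) l'" using qspan_prod(1)[OF H(1) H'(1)] by blast
  show "\<exists>Y l'. (\<forall>k. Y k \<in> Linf \<mu>) \<and> unif_avg Y l' \<and>
      (\<forall>k::nat. AE x in \<mu>. norm (F ((T ^^ n) x) * G x - Y k x) \<le> \<epsilon>)"
  proof (intro exI[of _ "\<lambda>_ x. H ((T ^^ n) x) * H' x"] exI[of _ l'] conjI allI l')
    show "(\<lambda>x. H ((T ^^ n) x) * H' x) \<in> Linf \<mu>"
      by (rule Linf_mult[OF Linf_T[OF qspan_Linf[OF H(1)]] qspan_Linf[OF H'(1)]])
    show "AE x in \<mu>. norm (F ((T ^^ n) x) * G x - H ((T ^^ n) x) * H' x) \<le> \<epsilon>"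
      using prod_approx[OF M H(2) H'(2) d(1,2), of n] by eventually_elim (use d(4) in linarith)
  qed
qed

lemma G2_exists:
  assumes F: "F \<in> G2 a \<mu>" shows "\<exists>l. unif_avg (\<lambda>_. F) l"
proof (rule unif_avg_closure)
  show "F \<in> Linf \<mu>" by (rule G2_Linf[OF F])
  fix \<epsilon> :: real assume "\<epsilon> > 0"
  then obtain H where H: "H \<in> qspan" "AE x in \<mu>. norm (F x - H x) \<le> \<epsilon>" by (rule G2_approx[OF F])
  obtain l where "unif_avg (\<lambda>_. H) l" using qspan_prod(2)[OF H(1) H(1)] by blast
  then show "\<exists>Y l'. (\<forall>n. Y n \<in> Linf \<mu>) \<and> unif_avg Y l' \<and> (\<forall>n::nat. AE x in \<mu>. norm (F x - Y n x) \<le> \<epsilon>)"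
    using qspan_Linf[OF H(1)] H(2) by (intro exI[of _ "\<lambda>_. H"]) blast
qed

text \<open>Products of approximants are close to the product uniformly in \<open>n\<close>, and
  averages are as close as the functions themselves, so factorisation passes to the limit.\<close>

lemma G2_mixing:
  assumes F: "F \<in> G2 a \<mu>" and G: "G \<in> G2 a \<mu>" and l: "unif_avg (\<lambda>_. F) l" and l': "unif_avg (\<lambda>_. G) l'"
  shows "unif_avg (\<lambda>n x. F ((T ^^ n) x) * G x) (l * l')"
proof (rule unif_avg_approx)
  note Fi = G2_Linf[OF F] and Gi = G2_Linf[OF G]
  show "(\<lambda>x. F ((T ^^ n) x) * G x) \<in> Linf \<mu>" for n by (rule Linf_mult[OF Linf_T[OF Fi] Gi])
  obtain M1 M2 where M12: "M1 > 0" "AE x in \<mu>. norm (F x) \<le> M1" "AE x in \<mu>. norm (G x) \<le> M2"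
    using LinfD(2)[OF Fi] LinfD(2)[OF Gi] by blast
  \<comment> \<open>The averages are included so that the same formula bounds the error of their
    product.\<close>
  let ?M = "max (max M1 M2) (max (norm l) (norm l'))"
  have M: "AE x in \<mu>. norm (F x) \<le> ?M" "AE x in \<mu>. norm (G x) \<le> ?M" "?M > 0"
    subgoal using M12(2) by eventually_elim simp
    subgoal using M12(3) by eventually_elim simp
    subgoal using M12(1) by simp
    done
  fix \<epsilon> :: real assume "\<epsilon> > 0"
  then obtain d where d: "0 < d" "d \<le> 1" "d \<le> \<epsilon>" "(2 * ?M + 1) * d \<le> \<epsilon>" using scale_exists[OF M(3)] by blast
  obtain H where H: "H \<in> qspan" "AE x in \<mu>. norm (F x - H x) \<le> d" by (rule G2_approx[OF F d(1)])
  obtain H' where H': "H' \<in> qspan" "AE x in \<mu>. norm (G x - H' x) \<le> d" by (rule G2_approx[OF G d(1)])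
  obtain h h' where h: "unif_avg (\<lambda>_. H) h" "unif_avg (\<lambda>_. H') h'" "unif_avg (\<lambda>n x. H ((T ^^ n) x) * H' x) (h * h')"
    using qspan_prod(2)[OF H(1) H'(1)] by blast
  note Hi = qspan_Linf[OF H(1)] and Hi' = qspan_Linf[OF H'(1)]
  show "\<exists>Y h. (\<forall>n. Y n \<in> Linf \<mu>) \<and> unif_avg Y h \<and> norm (h - l * l') \<le> \<epsilon> \<and>
      (\<forall>n. AE x in \<mu>. norm (F ((T ^^ n) x) * G x - Y n x) \<le> \<epsilon>)"
  proof (intro exI[of _ "\<lambda>n x. H ((T ^^ n) x) * H' x"] exI[of _ "h * h'"] conjI allI h(3))
    show "(\<lambda>x. H ((T ^^ n) x) * H' x) \<in> Linf \<mu>" for n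
      by (rule Linf_mult[OF Linf_T[OF Hi] Hi'])
    show "AE x in \<mu>. norm (F ((T ^^ n) x) * G x - H ((T ^^ n) x) * H' x) \<le> \<epsilon>" for n
      using prod_approx[OF M H(2) H'(2) d(1,2), of n] by eventually_elim (use d(4) in linarith)
    have "norm (l - h) \<le> d" by (rule unif_avg_dist[OF Fi Hi l h(1) H(2)])
    moreover have "norm (l' - h') \<le> d" by (rule unif_avg_dist[OF Gi Hi' l' h(2) H'(2)])
    ultimately have "norm (h * h' - l * l') \<le> (2 * ?M + 1) * d"
      using d M(3) by (intro complex_prod_approx) auto
    then show "norm (h * h' - l * l') \<le> \<epsilon>" using d(4) by linarith
  qed
qed

section \<open>Observables with uniformly convergent translation averages\<close>

lemma shift_funpow: "(shift a ^^ j) x = x + a * real j"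
  by (induction j) (auto simp: shift_def algebra_simps)

text \<open>Both conclusions hold with the same constant, the mean of the periodic limit over a
  cell: averaging \<open>F\<close> over \<open>N\<close> cells is averaging a translate of
  \<open>A N\<close> over one cell, and \<open>A k\<close> is uniformly close to a function with
  constant correlations.\<close>

lemma G1_avg:
  assumes F: "F \<in> G1 a \<mu>"
  obtains l where "unif_avg (\<lambda>_. F) l" "(\<lambda>n. mu_corr F n (cell_ind 0)) \<longlonglongrightarrow> l * of_real cell_mass"
proof -
  have Fi: "F \<in> Linf \<mu>" using F by (simp add: G1_def)
  obtain Fa where Fa: "Fa \<in> Linf \<mu>" "AE x in \<mu>. Fa (shift a x) = Fa x"
    "(\<lambda>k. Linf_norm \<mu> (\<lambda>x. shift_avg a k F x - Fa x)) \<longlonglongrightarrow> 0" using F by (auto simp: G1_def)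
  have per: "AE x in \<mu>. Fa (x + a) = Fa x" using Fa(2) by (simp add: shift_def)
  note [measurable] = LinfD(1)[OF Fi] LinfD(1)[OF Fa(1)]
  define A where "A k x = (\<Sum>j<k. F (x + a * of_int (int j))) / of_nat k" for k x
  have A_eq: "shift_avg a k F = A k" for k by (simp add: shift_avg_def A_def fun_eq_iff shift_funpow)
  have A_eq': "A k = (\<lambda>x. (1 / of_nat k) * (\<Sum>j<k. F (x + a * of_int (int j))))" for k
    by (simp add: A_def fun_eq_iff)
  have Ai: "A k \<in> Linf \<mu>" for k
    unfolding A_eq' by (intro Linf_cmult Linf_sum Linf_translate Fi)
  have approx: "\<exists>K. \<forall>k\<ge>K. AE x in \<mu>. norm (A k x - Fa x) \<le> e" if "e > 0" for e :: real
  proof -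
    have "\<forall>\<^sub>F k in sequentially. Linf_norm \<mu> (\<lambda>x. shift_avg a k F x - Fa x) < ennreal e"
      by (rule order_tendstoD(2)[OF Fa(3)]) (use that in simp)
    then obtain K where "\<forall>k\<ge>K. Linf_norm \<mu> (\<lambda>x. A k x - Fa x) < ennreal e"
      by (auto simp: eventually_sequentially A_eq)
    then show ?thesis using Linf_norm_AE that by (meson less_imp_le)
  qed
  have cint_sum: "(\<Sum>j<k. cint (\<lambda>x. F (x + a * of_int (i + int j)))) = of_nat k * cint (\<lambda>x. A k (x + a * of_int i))"
    if "k \<ge> 1" for k i
  proof -
    have c1: "cint (\<lambda>x. \<Sum>j<k'. F (x + a * of_int (i + int j))) = (\<Sum>j<k'. cint (\<lambda>x. F (x + a * of_int (i + int j))))" for k'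
    proof (induction k')
      case (Suc k')
      have "(\<lambda>x. \<Sum>j<k'. F (x + a * of_int (i + int j))) \<in> Linf \<mu>"
        by (intro Linf_sum Linf_translate Fi)
      from cint_add[OF this Linf_translate[OF Fi, of "i + int k'"]] Suc show ?case
        by (simp only: sum.lessThan_Suc)
    qed (simp add: cint_def)
    have c2: "A k (x + a * of_int i) = (1 / of_nat k) * (\<Sum>j<k. F (x + a * of_int (i + int j)))" for x
      unfolding A_eq' by (simp add: algebra_simps)
    show ?thesis unfolding c2 cint_cmult c1 using that by (simp del: of_int_add)
  qed
  let ?l = "cint Fa / of_real cell_mass"
  \<comment> \<open>Uniform in the position \<open>i\<close> of the volume, as the limit is periodic
    and the approximation is in the sup norm.\<close>
  have close: "norm (cint (\<lambda>x. A k (x + a * of_int i)) - cint Fa) \<le> e * cell_mass"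
    if "AE x in \<mu>. norm (A k x - Fa x) \<le> e" for k i e
  proof -
    have "cint Fa = cint (\<lambda>x. Fa (x + a * of_int i))"
    proof (rule cint_cong_AE)
      show "AE x in \<mu>. Fa x = Fa (x + a * of_int i)" using AE_periodic[OF per] by eventually_elim simp
    qed measurable
    then have "cint (\<lambda>x. A k (x + a * of_int i)) - cint Fa = cint (\<lambda>x. A k (x + a * of_int i) - Fa (x + a * of_int i))"
      using cint_diff[OF Linf_translate[OF Ai] Linf_translate[OF Fa(1)]] by simp
    then show ?thesis
      using cint_bound[OF Linf_translate[OF Linf_diff[OF Ai Fa(1)]] AE_translate[OF that]] by simp
  qed
  have "unif_avg (\<lambda>_. F) ?l"
    unfolding unif_avg_def
  proof (intro allI impI)
    fix \<epsilon> :: real assume "\<epsilon> > 0"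
    then obtain K where K: "\<And>k. k \<ge> K \<Longrightarrow> AE x in \<mu>. norm (A k x - Fa x) \<le> \<epsilon>" using approx by blast
    show "\<exists>M0. \<forall>V (n::nat). V \<in> volumes a \<longrightarrow> measure \<mu> V \<ge> M0 \<longrightarrow> real n \<ge> M0 \<longrightarrow> norm (vol_avg \<mu> V F - ?l) \<le> \<epsilon>"
    proof (intro exI[of _ "real K * cell_mass"] allI impI)
      fix V assume V: "V \<in> volumes a" "measure \<mu> V \<ge> real K * cell_mass"
      obtain i N where N: "N \<ge> 1" "measure \<mu> V = real N * cell_mass"
        "vol_avg \<mu> V F = (\<Sum>j<N. cint (\<lambda>x. F (x + a * of_int (i + int j)))) / of_real (real N * cell_mass)"
        using volume_form[OF V(1)] Fi by metis
      have "N \<ge> K" using V(2) cell_mass_pos unfolding N(2) by simp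
      then have c: "norm (cint (\<lambda>x. A N (x + a * of_int i)) - cint Fa) \<le> \<epsilon> * cell_mass" by (intro close K)
      have "vol_avg \<mu> V F - ?l = (cint (\<lambda>x. A N (x + a * of_int i)) - cint Fa) / of_real cell_mass"
        unfolding N(3) cint_sum[OF N(1)] using N(1) cell_mass_pos by (simp add: diff_divide_distrib)
      then have "norm (vol_avg \<mu> V F - ?l) = norm (cint (\<lambda>x. A N (x + a * of_int i)) - cint Fa) / cell_mass"
        using cell_mass_pos by (simp add: norm_divide)
      also have "\<dots> \<le> \<epsilon>" using c cell_mass_pos by (simp add: divide_le_eq)
      finally show "norm (vol_avg \<mu> V F - ?l) \<le> \<epsilon>" .
    qed
  qed
  moreover have "(\<lambda>n. mu_corr F n (cell_ind 0)) \<longlonglongrightarrow> cint Fa"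
  proof (rule LIMSEQ_I)
    fix e :: real assume e: "e > 0"
    then have "e / (2 * cell_mass) > 0" using cell_mass_pos by simp
    then obtain K where K: "\<And>k. k \<ge> K \<Longrightarrow> AE x in \<mu>. norm (A k x - Fa x) \<le> e / (2 * cell_mass)" using approx by blast
    \<comment> \<open>Positive, so that the average is a genuine mean.\<close>
    let ?k = "Suc K"
    have dev: "norm (mu_corr (A ?k) n (cell_ind 0) - cint Fa) \<le> e / 2" for n
    proof -
      have "mu_corr (A ?k) n (cell_ind 0) - cint Fa = mu_corr (A ?k) n (cell_ind 0) - mu_corr Fa n (cell_ind 0)"
        by (simp add: mu_corr_periodic[OF Fa(1) per])
      also have "\<dots> = cint (\<lambda>x. A ?k ((lift ^^ n) x) - Fa ((lift ^^ n) x))"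
        unfolding mu_corr_cell_ind[OF Ai] mu_corr_cell_ind[OF Fa(1)]
        by (rule cint_diff[OF Linf_lift[OF Ai] Linf_lift[OF Fa(1)], symmetric])
      finally have "norm (mu_corr (A ?k) n (cell_ind 0) - cint Fa) \<le> e / (2 * cell_mass) * cell_mass"
        using cint_bound[OF Linf_diff[OF Linf_lift[OF Ai] Linf_lift[OF Fa(1)]] AE_lift_pow[OF K[of ?k], of n]] by simp
      then show ?thesis using cell_mass_pos by simp
    qed
    \<comment> \<open>By translation, averaging the observable amounts to averaging the density over
      \<open>?k\<close> cells, each asymptotically equivalent to cell \<open>0\<close>.\<close>
    have split: "mu_corr (A ?k) n (cell_ind 0) - mu_corr F n (cell_ind 0) =
       (\<Sum>j<?k. mu_corr F n (cell_ind (int j)) - mu_corr F n (cell_ind 0)) / of_nat ?k" for n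
    proof -
      have "mu_corr (A ?k) n (cell_ind 0) = (\<integral>x. (\<Sum>j<?k. F ((T ^^ n) x + a * of_int (int j)) * cell_ind 0 x) / of_nat ?k \<partial>\<mu>)"
        unfolding mu_corr_def A_def by (simp only: sum_distrib_right times_divide_eq_left)
      also have "\<dots> = (\<Sum>j<?k. \<integral>x. F ((T ^^ n) x + a * of_int (int j)) * cell_ind 0 x \<partial>\<mu>) / of_nat ?k"
        unfolding integral_divide_zero
        by (subst Bochner_Integration.integral_sum[OF mu_corr_integrable[OF Linf_translate[OF Fi] integrable_open_cell]]) (rule refl)
      also have "\<dots> = (\<Sum>j<?k. mu_corr F n (cell_ind (int j))) / of_nat ?k"
      proof -
        have "(\<integral>x. F ((T ^^ n) x + a * of_int (int j)) * cell_ind 0 x \<partial>\<mu>) = mu_corr F n (cell_ind (int j))" for j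
          unfolding mu_corr_cell_ind_translate[OF Fi, of n "int j"] by (simp only: mu_corr_def)
        then show ?thesis by (simp only:)
      qed
      finally show ?thesis by (simp add: sum_subtractf diff_divide_distrib del: sum.lessThan_Suc of_nat_Suc)
    qed
    have lim0: "(\<lambda>n. mu_corr (A ?k) n (cell_ind 0) - mu_corr F n (cell_ind 0)) \<longlonglongrightarrow> 0"
      unfolding split by (intro tendsto_divide_zero tendsto_null_sum mu_corr_cell_ind_diff[OF Fi])
    have "0 < e / 2" using e by simp
    from LIMSEQ_D[OF lim0 this] obtain N where
      N: "\<And>n. n \<ge> N \<Longrightarrow> norm (mu_corr (A ?k) n (cell_ind 0) - mu_corr F n (cell_ind 0)) < e / 2"
      unfolding diff_zero by blast
    have "norm (mu_corr F n (cell_ind 0) - cint Fa) < e" if "n \<ge> N" for n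
    proof -
      have "norm (mu_corr F n (cell_ind 0) - cint Fa) \<le>
          norm (mu_corr F n (cell_ind 0) - mu_corr (A ?k) n (cell_ind 0)) + norm (mu_corr (A ?k) n (cell_ind 0) - cint Fa)"
        using norm_triangle_ineq[of "mu_corr F n (cell_ind 0) - mu_corr (A ?k) n (cell_ind 0)" "mu_corr (A ?k) n (cell_ind 0) - cint Fa"] by simp
      then show ?thesis using N[OF that] dev[of n] norm_minus_commute[of "mu_corr F n (cell_ind 0)" "mu_corr (A ?k) n (cell_ind 0)"] by linarith
    qed
    then show "\<exists>N. \<forall>n\<ge>N. norm (mu_corr F n (cell_ind 0) - cint Fa) < e" by blast
  qed
  ultimately show thesis using that[of ?l] cell_mass_pos by simp
qed

section \<open>The four mixing properties\<close>

lemma GLM1_all: "\<G> \<subseteq> Linf \<mu> \<Longrightarrow> GLM1 \<mu> T \<G> (L1 \<mu>)"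
  using mean_zero_mixing unfolding GLM1_def L1_def mu_corr_def by blast

lemma GLM2_G1: "GLM2 a \<mu> T (G1 a \<mu>) (L1 \<mu>)"
  unfolding GLM2_def
proof (intro ballI)
  fix F g assume F: "F \<in> G1 a \<mu>" and g: "g \<in> L1 \<mu>"
  have Fi: "F \<in> Linf \<mu>" using F by (simp add: G1_def)
  obtain l where l: "unif_avg (\<lambda>_. F) l" "(\<lambda>n. mu_corr F n (cell_ind 0)) \<longlonglongrightarrow> l * of_real cell_mass" by (rule G1_avg[OF F])
  have "(\<lambda>n. mu_corr F n g) \<longlonglongrightarrow> l * (\<integral>x. g x \<partial>\<mu>)"
    by (rule mu_corr_from_cell[OF Fi _ l(2)]) (use g in \<open>simp add: L1_def\<close>)
  then show "(\<lambda>n. LINT x|\<mu>. F ((T ^^ n) x) * g x) \<longlonglongrightarrow> inf_vol_avg a \<mu> F * (LINT x|\<mu>. g x)"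
    unfolding inf_vol_avg_eq[OF l(1)] mu_corr_def .
qed

lemma G2_inf_vol_avg:
  assumes "F \<in> G2 a \<mu>" "G \<in> G2 a \<mu>"
  shows "unif_avg (\<lambda>n x. F ((T ^^ n) x) * G x) (inf_vol_avg a \<mu> F * inf_vol_avg a \<mu> G)"
proof -
  obtain l l' where l: "unif_avg (\<lambda>_. F) l" "unif_avg (\<lambda>_. G) l'" using G2_exists assms by blast
  show ?thesis unfolding inf_vol_avg_eq[OF l(1)] inf_vol_avg_eq[OF l(2)] by (rule G2_mixing[OF assms l])
qed

lemma GGM2_G2: "GGM2 a \<mu> T (G2 a \<mu>)"
  unfolding GGM2_def
proof (intro ballI)
  fix F G assume FG: "F \<in> G2 a \<mu>" "G \<in> G2 a \<mu>"
  let ?X = "\<lambda>n x. F ((T ^^ n) x) * G x" and ?l = "inf_vol_avg a \<mu> F * inf_vol_avg a \<mu> G"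
  let ?S = "\<lambda>M. {(V, n). V \<in> volumes a \<and> measure \<mu> V \<ge> M \<and> real n \<ge> M}"
  have "((\<lambda>M. SUP p\<in>?S M. ennreal (norm (vol_avg \<mu> (fst p) (?X (snd p)) - ?l))) \<longlongrightarrow> 0) at_top"
  proof (subst SUP_ennreal_tendsto_0_iff, simp, intro allI impI)
    fix \<epsilon> :: real assume "\<epsilon> > 0"
    then obtain M0 where M0: "\<And>V n. V \<in> volumes a \<Longrightarrow> measure \<mu> V \<ge> M0 \<Longrightarrow> real n \<ge> M0 \<Longrightarrow> norm (vol_avg \<mu> V (?X n) - ?l) \<le> \<epsilon>"
      using G2_inf_vol_avg[OF FG] unfolding unif_avg_def by metis
    show "\<exists>M0. \<forall>M\<ge>M0. \<forall>p\<in>?S M. norm (vol_avg \<mu> (fst p) (?X (snd p)) - ?l) \<le> \<epsilon>"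
      by (intro exI[of _ M0]) (auto intro!: M0)
  qed
  then show "((\<lambda>M. SUP (V, n)\<in>?S M. ennreal (norm (vol_avg \<mu> V (?X n) - ?l))) \<longlongrightarrow> 0) at_top"
    by (simp add: case_prod_beta')
qed

lemma GGM1_G2: "GGM1 a \<mu> T (G2 a \<mu>)"
  unfolding GGM1_def
proof (intro ballI conjI)
  fix F G assume FG: "F \<in> G2 a \<mu>" "G \<in> G2 a \<mu>"
  let ?X = "\<lambda>n x. F ((T ^^ n) x) * G x" and ?l = "inf_vol_avg a \<mu> F * inf_vol_avg a \<mu> G"
  show "\<forall>\<^sub>F n in sequentially. \<exists>l. has_inf_vol_avg a \<mu> (?X n) l"
    using G2_exists_prod[OF FG] by (simp add: has_inf_vol_avg_iff)
  show "(\<lambda>n. inf_vol_avg a \<mu> (?X n)) \<longlonglongrightarrow> ?l"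
  proof (rule LIMSEQ_I)
    fix e :: real assume e: "e > 0"
    then have e3: "e / 3 > 0" by simp
    obtain M0 where M0: "\<And>V n. V \<in> volumes a \<Longrightarrow> measure \<mu> V \<ge> M0 \<Longrightarrow> real n \<ge> M0 \<Longrightarrow> norm (vol_avg \<mu> V (?X n) - ?l) \<le> e / 3"
      using G2_inf_vol_avg[OF FG] e3 unfolding unif_avg_def by metis
    obtain N :: nat where N: "real N \<ge> M0" using real_arch_simple by blast
    have "norm (inf_vol_avg a \<mu> (?X n) - ?l) < e" if n: "n \<ge> N" for n
    proof -
      obtain l where l: "unif_avg (\<lambda>_. ?X n) l" using G2_exists_prod[OF FG] by blast
      obtain M1 where M1: "\<And>V k. V \<in> volumes a \<Longrightarrow> measure \<mu> V \<ge> M1 \<Longrightarrow> real k \<ge> M1 \<Longrightarrow> norm (vol_avg \<mu> V (?X n) - l) \<le> e / 3"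
        using l e3 unfolding unif_avg_def by metis
      obtain k :: nat where k: "real k \<ge> M1" using real_arch_simple by blast
      \<comment> \<open>One volume that is large both for the joint estimate and for the average at
        this fixed \<open>n\<close>.\<close>
      obtain V where V: "V \<in> volumes a" "measure \<mu> V \<ge> max M0 M1" using volume_large by blast
      have "norm (vol_avg \<mu> V (?X n) - ?l) \<le> e / 3" using M0[OF V(1), of n] V(2) N n by simp
      moreover have "norm (vol_avg \<mu> V (?X n) - l) \<le> e / 3" using M1[OF V(1) _ k] V(2) by simp
      ultimately have "norm (l - ?l) < e"
        using dist_triangle3[of l ?l "vol_avg \<mu> V (?X n)"] e by (simp add: dist_norm)
      then show ?thesis using inf_vol_avg_eq[OF l] by simp
    qed
    then show "\<exists>N. \<forall>n\<ge>N. norm (inf_vol_avg a \<mu> (?X n) - ?l) < e" by blast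
  qed
qed

end

theorem theorem4p3:
  fixes a :: real and k1 k2 :: int and \<tau>\<^sub>0 T :: "real \<Rightarrow> real" and \<mu>\<^sub>a \<mu> :: "real measure"
  assumes "a > 0"
    and "expanding_branch a k1 k2 \<tau>\<^sub>0"
    and "quasi_lift a \<tau>\<^sub>0 T"
    and "circle_invariant_measure a T \<mu>\<^sub>a"
    and "shift_invariant_extension a \<mu>\<^sub>a \<mu>"
  shows "(\<forall>\<G>. \<G> \<subseteq> Linf \<mu> \<longrightarrow> GLM1 \<mu> T \<G> (L1 \<mu>)) \<and>
         GLM2 a \<mu> T (G1 a \<mu>) (L1 \<mu>) \<and>
         GGM1 a \<mu> T (G2 a \<mu>) \<and> GGM2 a \<mu> T (G2 a \<mu>)"
proof -
  have cell: "cell a 0 = {0..a}" by (simp add: cell_def)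
  obtain \<tau>' \<tau>'' r C where *: "r > 1" "\<forall>x\<in>cell a 0.
           (\<tau>\<^sub>0 has_real_derivative \<tau>' x) (at x within cell a 0) \<and>
           (\<tau>' has_real_derivative \<tau>'' x) (at x within cell a 0) \<and>
           \<bar>\<tau>' x\<bar> \<ge> r \<and> \<bar>\<tau>'' x\<bar> \<le> C"
    using assms(2) unfolding expanding_branch_def by blast
  interpret quasi_lift_measure a k1 k2 \<tau>\<^sub>0 \<tau>' \<tau>'' r C T \<mu>\<^sub>a \<mu>
    by unfold_locales (use assms * in \<open>auto simp: expanding_branch_def cell\<close>)
  show ?thesis using GLM1_all GLM2_G1 GGM1_G2 GGM2_G2 by blast
qed

end
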